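(* There is an absolute $m_0\in\mathbb N$ such that for every integer $m\ge m_0$, every $n\in\mathbb N$, and every symmetric complex $m$-linear form $T:(\mathbb C^n)^m\to\mathbb C$, \[ \Bigl(\sum_{i_1,\ldots,i_m=1}^n|T(e_{i_1},\ldots,e_{i_m})|^{\frac{2m}{m+1}}\Bigr)^{\frac{m+1}{2m}} \le\sup_{\|z\|_{\ell_\infty^n}\le1}|T(z,\ldots,z)|, \] and, if $T$ is nonzero, equality holds in this estimate if and only if there exist $j\in\{1,\ldots,n\}$ and $c\in\mathbb C\setminus\{0\}$ such that $T(z,\ldots,z)=c\,z_j^m$ for all $z\in\mathbb C^n$.
   Context: $e_1,\ldots,e_n$ is the canonical basis of $\mathbb C^n$; the supremum on the right is over $z\in\mathbb C^n$ with $\max_j|z_j|\le1$. "Absolute" means independent of $m,n,T$. *)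

theory Defs
  imports "HOL-Analysis.Analysis" "Jordan_Normal_Form.Matrix"
begin

type_synonym cvec = "complex Matrix.vec"

text \<open>
  An \<open>m\<close>-tuple of vectors of \<open>\<complex>\<^sup>n\<close> is a list of length \<open>m\<close> over \<open>carrier_vec n\<close>. Forms are functions
  on lists of vectors; only their values on these tuples are constrained or used.
  Coordinates are numbered from \<open>0\<close> to \<open>n - 1\<close>.
\<close>

definition vec_tuples :: "nat \<Rightarrow> nat \<Rightarrow> cvec list set" where
  "vec_tuples n m = {vs. length vs = m \<and> set vs \<subseteq> carrier_vec n}"

definition multilinear_form :: "nat \<Rightarrow> nat \<Rightarrow> (cvec list \<Rightarrow> complex) \<Rightarrow> bool" where
  "multilinear_form n m T \<longleftrightarrow>
     (\<forall>vs \<in> vec_tuples n m. \<forall>k<m. \<forall>x \<in> carrier_vec n. \<forall>y \<in> carrier_vec n. \<forall>a.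
        T (vs[k := x + y]) = T (vs[k := x]) + T (vs[k := y]) \<and>
        T (vs[k := a \<cdot>\<^sub>v x]) = a * T (vs[k := x]))"

definition symmetric_form :: "nat \<Rightarrow> nat \<Rightarrow> (cvec list \<Rightarrow> complex) \<Rightarrow> bool" where
  "symmetric_form n m T \<longleftrightarrow>
     (\<forall>vs \<in> vec_tuples n m. \<forall>p. p permutes {..<m} \<longrightarrow> T (permute_list p vs) = T vs)"

definition nonzero_form :: "nat \<Rightarrow> nat \<Rightarrow> (cvec list \<Rightarrow> complex) \<Rightarrow> bool" where
  "nonzero_form n m T \<longleftrightarrow> (\<exists>vs \<in> vec_tuples n m. T vs \<noteq> 0)"

text \<open>The inserted \<open>0\<close> only matters in dimension \<open>0\<close>, where \<open>Max\<close> of the empty set is unspecified.\<close>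

definition linf_norm :: "cvec \<Rightarrow> real" where
  "linf_norm z = Max (insert 0 ((\<lambda>j. cmod (vec_index z j)) ` {..<dim_vec z}))"

definition coeff_norm :: "nat \<Rightarrow> nat \<Rightarrow> (cvec list \<Rightarrow> complex) \<Rightarrow> real" where
  "coeff_norm n m T =
     (\<Sum>is \<in> {is. length is = m \<and> set is \<subseteq> {..<n}}.
        cmod (T (map (unit_vec n) is)) powr (2 * real m / (real m + 1)))
       powr ((real m + 1) / (2 * real m))"

definition diag_sup :: "nat \<Rightarrow> nat \<Rightarrow> (cvec list \<Rightarrow> complex) \<Rightarrow> real" where
  "diag_sup n m T = (SUP z \<in> {z \<in> carrier_vec n. linf_norm z \<le> 1}. cmod (T (replicate m z)))"

end

theory Submission
  imports Defs "HOL-Combinatorics.Multiset_Permutations" "HOL-Computational_Algebra.Polynomial"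
    "HOL-Number_Theory.Cong" "HOL-Real_Asymp.Real_Asymp"
begin

text \<open>
  Normalise \<open>sup |P| = 1\<close> for \<open>P z = T(z, \<dots>, z)\<close>, let \<open>z\<^sub>l\<^sup>m\<close> be the pure power with the largest
  coefficient, of modulus \<open>1 - \<epsilon>\<close>, and put \<open>p = 2m/(m+1)\<close>. The coefficients of the pure powers have
  \<open>\<ell>\<^sup>1\<close> norm at most 1, so they contribute at most \<open>1 - \<epsilon>/2\<close>, and it suffices that all other entries
  contribute less than \<open>\<epsilon>/2\<close>. Two facts carry the factor \<open>\<epsilon>\<close>: by Parseval the weighted square sum of
  the remaining coefficients is at most \<open>2\<epsilon>\<close>, and removing \<open>z\<^sub>l\<^sup>m\<close> leaves a polynomial of sup norm
  at most \<open>2 min(1, m\<epsilon>)\<close>.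

  For words in which every letter occurs at most \<open>m - 8\<close> times, Blei's mixed-norm inequality bounds
  the \<open>\<ell>\<^sup>p\<close> sum by \<open>\<Sum>\<^sub>j (\<Sum>\<^sub>i |T(e\<^sub>j, e\<^sub>i)|\<^sup>2)\<^sup>1\<^sup>/\<^sup>2\<close>. This is at most a small multiple of the sup norm, since
  a tensorised Carleman-type inequality bounds \<open>\<Sum> |c\<^sub>\<alpha>|\<^sup>2 / \<Prod> 2\<alpha>\<^sub>j(\<alpha>\<^sub>j + 1)\<close> by the squared \<open>L\<^sup>1\<close> norm on the torus,
  while each entry is \<open>c\<^sub>\<alpha>\<close> divided by a multinomial coefficient that dominates these weights.
  The other words involve at most 8 letters and are treated by interpolating the mixed-norm
  inequality with the square sum. All means over the torus are taken over roots of unity.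
\<close>

subsection \<open>Averages over roots of unity\<close>

text \<open>Equality holds at \<open>z\<^sub>l\<^sup>m\<close>, so near it no fixed loss can be
  absorbed: the bound for the remaining entries has to be linear in \<epsilon>, with a factor that
  is small for large \<open>m\<close> and free of \<open>n\<close>. Parseval alone cannot give this,
  since \<open>p\<close> is below 2 and the number of words grows with \<open>n\<close>. The mixed
  norm controls exponent \<open>p\<close> without reference to \<open>n\<close>, but its bound costs
  a power of \<open>m\<close>, which comes from the weights. Multinomial coefficients of order
  \<open>m^7\<close> repay this cost; a word such as \<open>l ... l j\<close> has only
  \<open>m\<close> arrangements and cannot. Hence the split by the largest multiplicity. For the
  words dominated by one letter the mixed norm enters only with an exponent of order
  \<open>1/m\<close>, which makes powers of \<open>m\<close> harmless, and the gain is a factor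
  \<open>1/m\<close> in the square sum. The dimension also shapes the one-variable step: its
  constant is raised to the power \<open>n\<close>, so it must come arbitrarily close to 1.\<close>

definition unity :: "nat \<Rightarrow> complex set" where
  "unity N = {w. w ^ N = 1}"

lemma finite_unity [simp]: "N > 0 \<Longrightarrow> finite (unity N)"
  unfolding unity_def using finite_roots_unity[of N, where 'a=complex] by simp

lemma card_unity [simp]: "N > 0 \<Longrightarrow> card (unity N) = N"
  unfolding unity_def using card_roots_unity_eq by simp

lemma norm_unity: "N > 0 \<Longrightarrow> w \<in> unity N \<Longrightarrow> cmod w = 1"
  unfolding unity_def using power_eq_1_iff[of w N] by auto

text \<open>On roots of unity conjugation is a power with natural exponent, so orthogonality reduces
  to a single divisibility.\<close>

lemma cnj_unity:
  assumes "N > 0" "w \<in> unity N"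
  shows "cnj w = w ^ (N - 1)"
proof -
  have "w * cnj w = 1"
    using norm_unity[OF assms] by (simp add: complex_norm_square[symmetric])
  moreover have "w * w ^ (N - 1) = 1"
    using assms by (simp add: unity_def power_eq_if split: if_splits)
  ultimately show ?thesis
    by (metis mult.commute mult.left_commute mult.right_neutral)
qed

lemma sum_unity_power:
  assumes "N > 0"
  shows "(\<Sum>w\<in>unity N. w ^ k) = (if N dvd k then of_nat N else 0)"
proof (cases "N dvd k")
  case True
  then have "w ^ k = 1" if "w \<in> unity N" for w
    using that by (auto simp: unity_def power_mult)
  then show ?thesis using True assms by simp
next
  case False
  define z where "z = cis (2 * pi / real N)"
  have "z ^ N = cis (real N * (2 * pi / real N))" unfolding z_def by (rule Complex.DeMoivre)
  then have z: "z \<in> unity N" using assms by (simp add: unity_def)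
  have zk: "z ^ k \<noteq> 1"
  proof
    assume zk: "z ^ k = 1"
    have zN: "z ^ N = 1" using z by (simp add: unity_def)
    have "z ^ k = z ^ (k mod N) * (z ^ N) ^ (k div N)"
      by (simp add: power_mult[symmetric] power_add[symmetric])
    then have "z ^ (k mod N) = 1" using zk zN by simp
    then have "cis (2 * pi * real (k mod N) / real N) = cis (2 * pi * real 0 / real N)"
      by (simp add: z_def Complex.DeMoivre mult_ac)
    then have "k mod N = 0"
      using assms by (intro inj_onD[OF bij_betw_imp_inj_on[OF Complex.bij_betw_roots_unity[OF assms]]]) auto
    then show False using False by auto
  qed
  have z0: "z \<noteq> 0" by (simp add: z_def)
  have bij: "bij_betw ((*) z) (unity N) (unity N)"
  proof (rule bij_betw_byWitness[where f' = "\<lambda>w. w / z"])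
    show "(*) z ` unity N \<subseteq> unity N" using z by (auto simp: unity_def power_mult_distrib)
    show "(\<lambda>w. w / z) ` unity N \<subseteq> unity N" using z by (auto simp: unity_def power_divide)
  qed (use z0 in auto)
  have "(\<Sum>w\<in>unity N. w ^ k) = (\<Sum>w\<in>unity N. (z * w) ^ k)"
    using sum.reindex_bij_betw[OF bij, of "\<lambda>w. w ^ k"] by simp
  also have "\<dots> = z ^ k * (\<Sum>w\<in>unity N. w ^ k)"
    by (simp add: power_mult_distrib sum_distrib_left)
  finally show ?thesis using zk False by simp
qed

lemma unity_orthogonal:
  assumes "N > 0"
  shows "(\<Sum>w\<in>unity N. w ^ a * cnj w ^ b) = (if [a = b] (mod N) then of_nat N else 0)"
proof -
  have "(\<Sum>w\<in>unity N. w ^ a * cnj w ^ b) = (\<Sum>w\<in>unity N. w ^ (a + (N - 1) * b))"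
    by (rule sum.cong) (simp_all add: cnj_unity[OF assms] power_add power_mult)
  moreover have "N dvd a + (N - 1) * b \<longleftrightarrow> [a = b] (mod N)"
  proof -
    \<comment> \<open>The exponent is congruent to \<open>a - b\<close> modulo \<open>N\<close>;
      over the integers this difference is not truncated.\<close>
    have "N dvd a + (N - 1) * b \<longleftrightarrow> int N dvd int a - int b + int N * int b"
      using assms by (cases N) (simp_all add: int_dvd_int_iff[symmetric] algebra_simps del: int_dvd_int_iff)
    also have "\<dots> \<longleftrightarrow> int N dvd int a - int b" by (meson dvd_add_times_triv_right_iff dvd_triv_left dvd_add_left_iff)
    also have "\<dots> \<longleftrightarrow> [a = b] (mod N)"
      by (simp add: cong_int_iff[symmetric] cong_iff_dvd_diff)
    finally show ?thesis .
  qed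
  ultimately show ?thesis using sum_unity_power[OF assms] by simp
qed

text \<open>With all exponents below \<open>N\<close>, distinct exponents stay distinct modulo
  \<open>N\<close>, so the average is an exact Fourier coefficient.\<close>

lemma sum_unity_coeff:
  fixes c :: "nat \<Rightarrow> complex"
  assumes "d < N" "k < N"
  shows "(\<Sum>w\<in>unity N. (\<Sum>i\<le>d. c i * w ^ i) * cnj w ^ k) = of_nat N * (if k \<le> d then c k else 0)"
proof -
  have N: "N > 0" using assms by simp
  have "(\<Sum>w\<in>unity N. (\<Sum>i\<le>d. c i * w ^ i) * cnj w ^ k)
      = (\<Sum>i\<le>d. c i * (\<Sum>w\<in>unity N. w ^ i * cnj w ^ k))"
    by (simp add: sum_distrib_left sum_distrib_right mult.assoc) (rule sum.swap)
  also have "\<dots> = (\<Sum>i\<le>d. c i * (if i = k then of_nat N else 0))"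
    using assms by (intro sum.cong refl) (auto simp: unity_orthogonal[OF N] cong_def)
  also have "\<dots> = of_nat N * (if k \<le> d then c k else 0)"
    by (simp add: if_distrib sum.delta cong: if_cong)
  finally show ?thesis .
qed

lemma norm_sum_unity_le:
  assumes "N > 0" and g: "\<And>w. w \<in> unity N \<Longrightarrow> cmod (g w) \<le> B"
  shows "cmod (\<Sum>w\<in>unity N. g w) \<le> real N * B"
  using sum_norm_bound[OF g, of "unity N" "\<lambda>w. w"] assms(1) by simp

lemma coeff_le_of_circle_bound:
  fixes c :: "nat \<Rightarrow> complex"
  assumes "\<And>w. cmod w = 1 \<Longrightarrow> cmod (\<Sum>i\<le>d. c i * w ^ i) \<le> B" and "k \<le> d"
  shows "cmod (c k) \<le> B"
proof -
  define N where "N = Suc d"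
  have "cmod (of_nat N * c k) = cmod (\<Sum>w\<in>unity N. (\<Sum>i\<le>d. c i * w ^ i) * cnj w ^ k)"
    using assms(2) sum_unity_coeff[of d N k c] by (simp add: N_def)
  also have "\<dots> \<le> real N * B"
  proof (rule norm_sum_unity_le)
    fix w assume "w \<in> unity N"
    then have "cmod w = 1" using norm_unity[of N w] by (simp add: N_def)
    then show "cmod ((\<Sum>i\<le>d. c i * w ^ i) * cnj w ^ k) \<le> B"
      using assms(1)[of w] by (simp add: norm_mult norm_power)
  qed (simp add: N_def)
  finally show ?thesis by (simp add: N_def norm_mult del: of_nat_Suc)
qed

text \<open>
  \<open>1 - Re (\<kappa> w\<^sup>-\<^sup>d f w)\<close> is nonnegative with mean \<open>1 - \<bar>c\<^sub>d\<bar>\<close>, which bounds its other Fourier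
  coefficients, and these are \<open>\<kappa> c\<^sub>k / 2\<close> up to sign.
\<close>

lemma coeff_le_defect:
  fixes c :: "nat \<Rightarrow> complex"
  assumes b: "\<And>w. cmod w = 1 \<Longrightarrow> cmod (\<Sum>i\<le>d. c i * w ^ i) \<le> 1" and k: "k < d"
  shows "cmod (c k) \<le> 2 * (1 - cmod (c d))"
proof -
  \<comment> \<open>\<open>2 * d + 1\<close> points separate all frequencies that occur: those of
    \<open>cnj (X w) * w ^ (d - k)\<close> are \<open>2 * d - k - i\<close>, lie between 1 and
    \<open>2 * d\<close>, and vanish in the mean.\<close>
  define N where "N = 2 * d + 1"
  have N: "N > 0" by (simp add: N_def)
  obtain \<kappa> where \<kappa>: "cmod \<kappa> = 1" "\<kappa> * c d = of_real (cmod (c d))"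
  proof (cases "c d = 0")
    case True then show ?thesis using that[of 1] by simp
  next
    case False
    then show ?thesis using that[of "of_real (cmod (c d)) / c d"] by (simp add: norm_divide)
  qed
  define f where "f w = (\<Sum>i\<le>d. c i * w ^ i)" for w
  define X where "X w = \<kappa> * (f w * cnj w ^ d)" for w
  define G where "G w = 1 - Re (X w)" for w
  have Xle: "Re (X w) \<le> 1" if "w \<in> unity N" for w
  proof -
    have "Re (X w) \<le> cmod (X w)" by (rule complex_Re_le_cmod)
    also have "\<dots> \<le> 1" using b[of w] norm_unity[OF N that] \<kappa>
      by (simp add: X_def norm_mult norm_power f_def)
    finally show ?thesis .
  qed
  have sX: "(\<Sum>w\<in>unity N. X w) = of_nat N * of_real (cmod (c d))"
  proof -
    have "(\<Sum>w\<in>unity N. X w) = \<kappa> * (\<Sum>w\<in>unity N. f w * cnj w ^ d)"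
      by (simp add: X_def sum_distrib_left)
    also have "\<dots> = \<kappa> * (of_nat N * c d)"
      unfolding f_def using sum_unity_coeff[of d N d c] by (simp add: N_def)
    also have "\<dots> = of_nat N * (\<kappa> * c d)" by (simp add: mult_ac)
    finally show ?thesis by (simp add: \<kappa>)
  qed
  have sG: "(\<Sum>w\<in>unity N. G w) = real N * (1 - cmod (c d))"
  proof -
    have "(\<Sum>w\<in>unity N. Re (X w)) = Re (\<Sum>w\<in>unity N. X w)" by simp
    also have "\<dots> = real N * cmod (c d)" by (simp add: sX)
    finally show ?thesis using N by (simp add: G_def sum_subtractf algebra_simps)
  qed
  have ww: "cnj w ^ d * w ^ (d - k) = cnj w ^ k" if "w \<in> unity N" for w
  proof -
    have "cnj w * w = 1" using norm_unity[OF N that]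
      by (metis complex_norm_square mult.commute of_real_1 power_one)
    then have "cnj w ^ (d - k) * w ^ (d - k) = 1" by (metis power_mult_distrib power_one)
    moreover have "cnj w ^ d = cnj w ^ k * cnj w ^ (d - k)"
      using k by (simp add: power_add[symmetric])
    ultimately show ?thesis by (simp add: mult.assoc)
  qed
  have "(\<Sum>w\<in>unity N. of_real (G w) * w ^ (d - k))
      = (\<Sum>w\<in>unity N. w ^ (d - k)) - (\<Sum>w\<in>unity N. X w * w ^ (d - k)) / 2
        - (\<Sum>w\<in>unity N. cnj (X w) * w ^ (d - k)) / 2"
  proof -
    have "of_real (G w) * w ^ (d - k)
        = w ^ (d - k) - X w * w ^ (d - k) / 2 - cnj (X w) * w ^ (d - k) / 2" for w
    proof -
      have "of_real (Re (X w)) = (X w + cnj (X w)) / 2" by (simp add: complex_add_cnj)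
      then show ?thesis by (simp add: G_def algebra_simps diff_divide_distrib add_divide_distrib)
    qed
    then show ?thesis by (simp add: sum_subtractf sum_divide_distrib)
  qed
  also have "(\<Sum>w\<in>unity N. w ^ (d - k)) = 0"
    using k by (subst sum_unity_power[OF N]) (auto simp: N_def dest: dvd_imp_le)
  also have "(\<Sum>w\<in>unity N. X w * w ^ (d - k)) = \<kappa> * (of_nat N * c k)"
  proof -
    have "(\<Sum>w\<in>unity N. X w * w ^ (d - k)) = (\<Sum>w\<in>unity N. \<kappa> * (f w * cnj w ^ k))"
      by (rule sum.cong) (simp_all add: X_def mult.assoc ww)
    also have "\<dots> = \<kappa> * (of_nat N * c k)"
      unfolding f_def using sum_unity_coeff[of d N k c] k by (simp add: N_def sum_distrib_left[symmetric])
    finally show ?thesis .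
  qed
  also have "(\<Sum>w\<in>unity N. cnj (X w) * w ^ (d - k)) = 0"
  proof -
    have "(\<Sum>w\<in>unity N. cnj (X w) * w ^ (d - k))
        = (\<Sum>w\<in>unity N. \<Sum>i\<le>d. cnj \<kappa> * cnj (c i) * (w ^ (d + (d - k)) * cnj w ^ i))"
      by (simp add: X_def f_def sum_distrib_left sum_distrib_right power_add mult_ac)
    also have "\<dots> = (\<Sum>i\<le>d. cnj \<kappa> * cnj (c i) * (\<Sum>w\<in>unity N. w ^ (d + (d - k)) * cnj w ^ i))"
      by (subst sum.swap) (simp add: sum_distrib_left)
    also have "\<dots> = 0"
    proof (intro sum.neutral ballI)
      fix i assume "i \<in> {..d}"
      then have "\<not> [d + (d - k) = i] (mod N)"
        using k by (auto simp: cong_def N_def)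
      then show "cnj \<kappa> * cnj (c i) * (\<Sum>w\<in>unity N. w ^ (d + (d - k)) * cnj w ^ i) = 0"
        by (simp only: unity_orthogonal[OF N]) simp
    qed
    finally show ?thesis .
  qed
  finally have "cmod (\<Sum>w\<in>unity N. of_real (G w) * w ^ (d - k)) = real N * cmod (c k) / 2"
    by (simp add: norm_mult norm_divide \<kappa>)
  moreover have "cmod (\<Sum>w\<in>unity N. of_real (G w) * w ^ (d - k)) \<le> (\<Sum>w\<in>unity N. G w)"
    by (rule order_trans[OF norm_sum], rule sum_mono)
       (use Xle in \<open>auto simp: norm_mult norm_power norm_unity[OF N] G_def simp del: of_real_diff\<close>)
  ultimately have "real N * cmod (c k) \<le> real N * (2 * (1 - cmod (c d)))"
    using sG by (simp add: algebra_simps)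
  then show ?thesis using N by (simp only: mult_le_cancel_left_pos of_nat_0_less_iff)
qed

subsection \<open>From the mean of \<open>\<bar>f\<bar>\<close> to a weighted square sum of coefficients\<close>

text \<open>The two-coefficient bound \<open>|c_0|^2 + |c_k|^2 / 2 <= A^2\<close>, averaged over
  \<open>k\<close> with the telescoping masses \<open>1 / (k (k + 1))\<close>, yields the
  reciprocals of these weights. Carleman's inequality has \<open>k + 1\<close> instead; here
  polynomial growth and supermultiplicativity of \<open>weight k * fact k\<close> are what
  counts.\<close>

definition weight :: "nat \<Rightarrow> real" where
  "weight k = (if k = 0 then 1 else 2 * real k * (real k + 1))"

lemma weight_pos [simp]: "weight k > 0"
  by (simp add: weight_def)

text \<open>A bound for the modulus of a Blaschke factor cut off after \<open>K\<close> terms. It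
  tends to 1 as \<open>K\<close> grows, which is essential because it is later raised to the power
  \<open>n\<close>.\<close>

definition mean_bound :: "nat \<Rightarrow> real" where
  "mean_bound K = 1 + 2 / 2 ^ K"

lemma mean_bound_ge_1: "mean_bound K \<ge> 1"
  by (simp add: mean_bound_def)

text \<open>\<kappa> rotates the function and \<zeta> the variable, so that two coefficients become
  nonnegative at once. With \<open>b = 0\<close> the lemma supplies a single phase.\<close>

lemma sgn_pair:
  fixes a b :: complex
  obtains \<kappa> \<zeta> where "cmod \<kappa> = 1" "cmod \<zeta> = 1" "\<kappa> * a = of_real (cmod a)"
    "\<kappa> * cnj \<zeta> * b = of_real (cmod b)"
proof -
  have ex: "\<exists>u. cmod u = 1 \<and> u * x = of_real (cmod x)" for x :: complex
  proof (cases "x = 0")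
    case True then show ?thesis by (intro exI[of _ 1]) simp
  next
    case False
    then show ?thesis by (intro exI[of _ "of_real (cmod x) / x"]) (simp add: norm_divide)
  qed
  obtain u where u: "cmod u = 1" "u * a = of_real (cmod a)" using ex by blast
  obtain v where v: "cmod v = 1" "v * b = of_real (cmod b)" using ex by blast
  have uu: "u * cnj u = 1" using u(1) by (simp add: complex_norm_square[symmetric])
  show ?thesis
  proof (rule that[of u "u * cnj v"])
    have "u * cnj (u * cnj v) * b = (u * cnj u) * (v * b)" by (simp add: mult_ac)
    then show "u * cnj (u * cnj v) * b = of_real (cmod b)" using uu v by simp
  qed (use u v in \<open>auto simp: norm_mult\<close>)
qed

text \<open>
  On the unit circle \<open>s + (1 - s\<^sup>2) \<Sum> (-s)\<^sup>r x\<^sup>r\<^sup>+\<^sup>1\<close> is the expansion of the Blaschke factor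
  \<open>(s + x) / (1 + s x)\<close>, cut off after \<open>K\<close> terms.
\<close>

lemma truncated_Blaschke_bound:
  fixes x :: complex and s :: real
  assumes x: "cmod x = 1" and s: "0 \<le> s" "s \<le> 1/2"
  shows "cmod (of_real s + of_real (1 - s\<^sup>2) * (\<Sum>r<K. (- of_real s) ^ r * x ^ Suc r)) \<le> mean_bound K"
proof -
  define y where "y = - of_real s * x"
  define S where "S = (\<Sum>r<K. y ^ r)"
  have ny: "cmod y = s" using x s by (simp add: y_def norm_mult)
  have lower: "1 - s \<le> cmod (1 - y)" using norm_triangle_ineq2[of 1 y] ny by simp
  then have ne: "1 - y \<noteq> 0" using s by auto
  have gs: "(1 - y) * S = 1 - y ^ K" unfolding S_def by (rule one_diff_power_eq[symmetric])
  have sum_eq: "(\<Sum>r<K. (- of_real s) ^ r * x ^ Suc r) = x * S"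
    by (simp add: S_def y_def sum_distrib_left power_mult_distrib[symmetric] mult_ac)
  \<comment> \<open>Multiplying by \<open>1 - y\<close> sums the geometric series. The main part
    becomes \<open>s + x\<close>, whose modulus on the unit circle is that of
    \<open>1 - y = 1 + s x\<close>; the cut-off leaves an error of modulus
    \<open>(1 - s^2) s^K\<close>.\<close>
  have "(1 - y) * (of_real s + of_real (1 - s\<^sup>2) * (x * S))
      = of_real s * (1 - y) + of_real (1 - s\<^sup>2) * (x * ((1 - y) * S))"
    by (simp add: algebra_simps)
  also have "\<dots> = (of_real s + x) - of_real (1 - s\<^sup>2) * (x * y ^ K)"
    unfolding gs by (simp add: y_def algebra_simps power2_eq_square)
  finally have "cmod (1 - y) * cmod (of_real s + of_real (1 - s\<^sup>2) * (x * S))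
      = cmod ((of_real s + x) - of_real (1 - s\<^sup>2) * (x * y ^ K))"
    by (metis norm_mult)
  also have "\<dots> \<le> cmod (of_real s + x) + (1 - s\<^sup>2) * s ^ K"
  proof -
    have "1 - s\<^sup>2 \<ge> 0" using s by (simp add: power2_le_iff_abs_le abs_square_le_1)
    then show ?thesis
      using norm_triangle_ineq4[of "of_real s + x" "of_real (1 - s\<^sup>2) * (x * y ^ K)"] x ny
      by (simp add: norm_mult norm_power del: of_real_diff)
  qed
  also have "cmod (of_real s + x) = cmod (1 - y)"
  proof -
    have "x * cnj x = 1" using x by (simp add: complex_norm_square[symmetric])
    then have "x * cnj (1 - y) = of_real s + x"
      by (simp add: y_def algebra_simps)
    then show ?thesis using x by (metis complex_mod_cnj mult_1 norm_mult)
  qed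
  also have "cmod (1 - y) + (1 - s\<^sup>2) * s ^ K \<le> cmod (1 - y) * mean_bound K"
  proof -
    \<comment> \<open>The factor \<open>1 - s\<close> of the error is absorbed by
      \<open>|1 - y|\<close>, and \<open>s <= 1/2\<close> makes the rest at most
      \<open>2 / 2^K\<close>.\<close>
    have "(1 - s\<^sup>2) * s ^ K = (1 - s) * ((1 + s) * s ^ K)"
      by (simp add: algebra_simps power2_eq_square)
    also have "\<dots> \<le> cmod (1 - y) * ((1 + s) * s ^ K)"
      using lower s by (intro mult_right_mono) auto
    also have "\<dots> \<le> cmod (1 - y) * (2 * (1/2) ^ K)"
      using s by (intro mult_left_mono mult_mono power_mono) auto
    finally show ?thesis by (simp add: mean_bound_def algebra_simps power_one_over)
  qed
  finally show ?thesis using ne unfolding sum_eq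
    by (simp add: mult_le_cancel_left_pos)
qed

text \<open>Duality: \<open>f\<close> is tested against \<open>\<kappa> cnj x B(x)\<close> with
  \<open>x = \<zeta> w^k\<close>, where \<open>B\<close> is the truncated Blaschke factor. Up to
  phases this function has the frequency \<open>-k\<close> with weight \<open>s\<close>, the mean
  \<open>1 - s^2\<close>, and otherwise only positive frequencies, which meet no coefficient of
  \<open>f\<close>.\<close>

lemma mean_abs_ge_two_coeffs:
  fixes c :: "nat \<Rightarrow> complex"
  assumes s: "0 \<le> s" "s \<le> 1/2" and k: "0 < k" "k \<le> d" and N: "N > d * (K + 2)"
  shows "real N * ((1 - s\<^sup>2) * cmod (c 0) + s * cmod (c k))
    \<le> mean_bound K * (\<Sum>w\<in>unity N. cmod (\<Sum>i\<le>d. c i * w ^ i))"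
proof -
  have dN: "d < N" and N0: "N > 0" using N k by (auto simp: algebra_simps)
  obtain \<kappa> \<zeta> where \<kappa>: "cmod \<kappa> = 1" "cmod \<zeta> = 1" "\<kappa> * c 0 = of_real (cmod (c 0))"
    "\<kappa> * cnj \<zeta> * c k = of_real (cmod (c k))"
    using sgn_pair by blast
  have \<zeta>1: "\<zeta> * cnj \<zeta> = 1" using \<kappa>(2) by (simp add: complex_norm_square[symmetric])
  define f where "f w = (\<Sum>i\<le>d. c i * w ^ i)" for w
  define B where "B x = of_real s + of_real (1 - s\<^sup>2) * (\<Sum>r<K. (- of_real s) ^ r * x ^ Suc r)" for x :: complex
  define \<psi> where "\<psi> w = \<kappa> * cnj (\<zeta> * w ^ k) * B (\<zeta> * w ^ k)" for w
  have n\<psi>: "cmod (\<psi> w) \<le> mean_bound K" if "w \<in> unity N" for w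
    using truncated_Blaschke_bound[of "\<zeta> * w ^ k" s K] s norm_unity[OF N0 that] \<kappa>
    by (simp add: \<psi>_def B_def norm_mult norm_power)
  have \<psi>eq: "\<psi> w = \<kappa> * of_real s * cnj \<zeta> * cnj w ^ k
      + \<kappa> * of_real (1 - s\<^sup>2) * (\<Sum>r<K. (- of_real s) ^ r * \<zeta> ^ r * w ^ (k * r))"
    if "w \<in> unity N" for w
  proof -
    define x where "x = \<zeta> * w ^ k"
    have "cmod x = 1" using norm_unity[OF N0 that] \<kappa> by (simp add: x_def norm_mult norm_power)
    then have x1: "cnj x * x = 1" by (metis complex_norm_square mult.commute of_real_1 power_one)
    have "cnj x * x ^ Suc r = \<zeta> ^ r * w ^ (k * r)" for r
      using x1 by (simp add: mult.assoc[symmetric]) (simp add: x_def power_mult_distrib power_mult)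
    then have "cnj x * ((- of_real s) ^ r * x ^ Suc r) = (- of_real s) ^ r * \<zeta> ^ r * w ^ (k * r)" for r
      by (metis mult.assoc mult.left_commute)
    then have "cnj x * (\<Sum>r<K. (- of_real s) ^ r * x ^ Suc r)
        = (\<Sum>r<K. (- of_real s) ^ r * \<zeta> ^ r * w ^ (k * r))"
      by (simp only: sum_distrib_left)
    then have "cnj x * B x = of_real s * cnj x
        + of_real (1 - s\<^sup>2) * (\<Sum>r<K. (- of_real s) ^ r * \<zeta> ^ r * w ^ (k * r))"
      by (simp add: B_def distrib_left mult.left_commute mult.commute)
    then have "\<psi> w = \<kappa> * (of_real s * cnj x
        + of_real (1 - s\<^sup>2) * (\<Sum>r<K. (- of_real s) ^ r * \<zeta> ^ r * w ^ (k * r)))"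
      by (simp add: \<psi>_def x_def mult.assoc)
    then show ?thesis by (simp add: x_def distrib_left mult_ac)
  qed
  have freq: "(\<Sum>w\<in>unity N. f w * w ^ (k * r)) = (if r = 0 then of_nat N * c 0 else 0)" if "r < K" for r
  proof -
    have "(\<Sum>w\<in>unity N. f w * w ^ (k * r)) = (\<Sum>i\<le>d. c i * (\<Sum>w\<in>unity N. w ^ (i + k * r)))"
      by (simp add: f_def sum_distrib_left sum_distrib_right mult.assoc power_add) (rule sum.swap)
    also have "\<dots> = (\<Sum>i\<le>d. c i * (if i = 0 \<and> r = 0 then of_nat N else 0))"
    proof (intro sum.cong refl)
      fix i assume i: "i \<in> {..d}"
      \<comment> \<open>The condition on \<open>N\<close> excludes aliasing: a frequency below
        \<open>N\<close> is divisible by \<open>N\<close> only if it is 0.\<close>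
      have "k * r \<le> d * K" using k that by (intro mult_mono) auto
      then have "i + k * r < N" using i N by (simp add: algebra_simps)
      then have "N dvd i + k * r \<longleftrightarrow> i + k * r = 0" by (auto dest: dvd_imp_le)
      then show "c i * (\<Sum>w\<in>unity N. w ^ (i + k * r)) = c i * (if i = 0 \<and> r = 0 then of_nat N else 0)"
        using k by (simp add: sum_unity_power[OF N0])
    qed
    also have "\<dots> = (if r = 0 then of_nat N * c 0 else 0)"
      by (cases "r = 0") (simp_all add: if_distrib sum.delta cong: if_cong)
    finally show ?thesis .
  qed
  have "(\<Sum>w\<in>unity N. f w * \<psi> w)
      = (\<Sum>w\<in>unity N. \<kappa> * of_real s * cnj \<zeta> * (f w * cnj w ^ k)
          + \<kappa> * of_real (1 - s\<^sup>2) * (\<Sum>r<K. (- of_real s) ^ r * \<zeta> ^ r * (f w * w ^ (k * r))))"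
    by (rule sum.cong) (simp_all add: \<psi>eq distrib_left sum_distrib_left mult_ac)
  also have "\<dots> = \<kappa> * of_real s * cnj \<zeta> * (\<Sum>w\<in>unity N. f w * cnj w ^ k)
      + \<kappa> * of_real (1 - s\<^sup>2) * (\<Sum>r<K. (- of_real s) ^ r * \<zeta> ^ r * (\<Sum>w\<in>unity N. f w * w ^ (k * r)))"
    by (simp add: sum.distrib sum_distrib_left mult.assoc) (rule sum.swap)
  also have "(\<Sum>w\<in>unity N. f w * cnj w ^ k) = of_nat N * c k"
    unfolding f_def using sum_unity_coeff[of d N k c] dN k by simp
  finally have eq1: "(\<Sum>w\<in>unity N. f w * \<psi> w) = \<kappa> * of_real s * cnj \<zeta> * (of_nat N * c k)
      + \<kappa> * of_real (1 - s\<^sup>2) * (\<Sum>r<K. (- of_real s) ^ r * \<zeta> ^ r * (\<Sum>w\<in>unity N. f w * w ^ (k * r)))" .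
  show ?thesis
  \<comment> \<open>For \<open>K = 0\<close> the truncated series is empty, so \<psi> does not see
    \<open>c 0\<close>. Then the trivial bound of each coefficient by the mean suffices, as
    \<open>mean_bound 0 = 3\<close>.\<close>
  proof (cases "K = 0")
    case True
    have "cmod (c 0) * real N \<le> (\<Sum>w\<in>unity N. cmod (f w))" "cmod (c k) * real N \<le> (\<Sum>w\<in>unity N. cmod (f w))"
    proof -
      have "cmod (\<Sum>w\<in>unity N. f w * cnj w ^ j) \<le> (\<Sum>w\<in>unity N. cmod (f w))" for j
        by (rule order_trans[OF norm_sum], rule sum_mono)
           (simp add: norm_mult norm_power norm_unity[OF N0])
      from this[of 0] this[of k] show "cmod (c 0) * real N \<le> (\<Sum>w\<in>unity N. cmod (f w))"
        "cmod (c k) * real N \<le> (\<Sum>w\<in>unity N. cmod (f w))"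
        unfolding f_def using sum_unity_coeff[of d N 0 c] sum_unity_coeff[of d N k c] dN k
        by (simp_all add: norm_mult mult.commute)
    qed
    moreover have "(1 - s\<^sup>2) * (cmod (c 0) * real N) \<le> 1 * (cmod (c 0) * real N)"
      by (intro mult_right_mono) auto
    moreover have "s * (cmod (c k) * real N) \<le> 1 * (cmod (c k) * real N)"
      using s by (intro mult_right_mono) auto
    ultimately have "real N * ((1 - s\<^sup>2) * cmod (c 0) + s * cmod (c k)) \<le> 2 * (\<Sum>w\<in>unity N. cmod (f w))"
      by (simp only: distrib_left mult_ac)
    also have "\<dots> \<le> mean_bound K * (\<Sum>w\<in>unity N. cmod (f w))"
      using True by (intro mult_right_mono) (auto simp: mean_bound_def sum_nonneg)
    finally show ?thesis by (simp add: f_def)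
  next
    case False
    have "(\<Sum>r<K. (- of_real s) ^ r * \<zeta> ^ r * (\<Sum>w\<in>unity N. f w * w ^ (k * r)))
        = (\<Sum>r<K. if r = 0 then of_nat N * c 0 else 0)"
      by (intro sum.cong refl) (auto simp: freq)
    also have "\<dots> = of_nat N * c 0" using False by (simp add: sum.delta)
    finally have "(\<Sum>w\<in>unity N. f w * \<psi> w)
        = of_nat N * of_real s * (\<kappa> * cnj \<zeta> * c k) + of_nat N * of_real (1 - s\<^sup>2) * (\<kappa> * c 0)"
      unfolding eq1 by (simp add: mult_ac)
    also have "\<dots> = of_real (real N * ((1 - s\<^sup>2) * cmod (c 0) + s * cmod (c k)))"
      unfolding \<kappa> by (simp add: algebra_simps)
    finally have "real N * ((1 - s\<^sup>2) * cmod (c 0) + s * cmod (c k)) \<le> cmod (\<Sum>w\<in>unity N. f w * \<psi> w)"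
      by (metis abs_ge_self norm_of_real)
    also have "\<dots> \<le> (\<Sum>w\<in>unity N. cmod (f w) * mean_bound K)"
      by (rule order_trans[OF norm_sum], rule sum_mono) (auto simp: norm_mult intro!: mult_left_mono n\<psi>)
    finally show ?thesis by (simp add: f_def sum_distrib_left mult.commute)
  qed
qed

text \<open>The maximum of \<open>(1 - s^2) X + s Y\<close> lies at \<open>s = Y / (2 X)\<close>,
  which is admissible for \<open>Y <= X\<close>; its square exceeds \<open>X^2 + Y^2 / 2\<close> by
  a square. For \<open>Y\<close> between \<open>X\<close> and \<open>3/2 X\<close> the endpoint
  \<open>s = 1/2\<close> suffices, and beyond that the bound \<open>Y <= A\<close> alone.\<close>

lemma square_bound_of_family:
  fixes X Y A :: real
  assumes XY: "X \<ge> 0" "Y \<ge> 0" and Y: "Y \<le> A"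
    and fam: "\<And>s. 0 \<le> s \<Longrightarrow> s \<le> 1/2 \<Longrightarrow> (1 - s\<^sup>2) * X + s * Y \<le> A"
  shows "X\<^sup>2 + Y\<^sup>2 / 2 \<le> A\<^sup>2"
proof -
  consider "Y = 0" | "0 < Y" "Y \<le> X" | "X \<le> Y" "Y \<le> 3 / 2 * X" | "3 / 2 * X \<le> Y" using XY by linarith
  then show ?thesis
  proof cases
    case 1
    then show ?thesis using fam[of 0] XY by (auto intro!: power_mono)
  next
    case 2
    define s where "s = Y / (2 * X)"
    have X: "X > 0" using 2 by linarith
    have "(1 - s\<^sup>2) * X + s * Y \<le> A" by (rule fam) (use 2 X in \<open>auto simp: s_def field_simps\<close>)
    moreover have "(1 - s\<^sup>2) * X + s * Y = X + Y\<^sup>2 / (4 * X)"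
      using X by (simp add: s_def field_simps power2_eq_square)
    ultimately have "(X + Y\<^sup>2 / (4 * X))\<^sup>2 \<le> A\<^sup>2"
      using X by (intro power_mono) auto
    moreover have "(X + Y\<^sup>2 / (4 * X))\<^sup>2 = X\<^sup>2 + Y\<^sup>2 / 2 + (Y\<^sup>2 / (4 * X))\<^sup>2"
      using X by (simp add: power2_sum field_simps power2_eq_square)
    ultimately show ?thesis by (smt (verit) zero_le_power2)
  next
    case 3
    have "3 / 4 * X + Y / 2 \<le> A" using fam[of "1/2"] by (simp add: power2_eq_square)
    then have "(3 / 4 * X + Y / 2)\<^sup>2 \<le> A\<^sup>2" using XY by (intro power_mono) auto
    moreover have "X\<^sup>2 + Y\<^sup>2 / 2 \<le> (3 / 4 * X + Y / 2)\<^sup>2"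
    proof -
      have "0 \<le> (Y - X) * (3 / 2 * X - Y)" using 3 by simp
      moreover have "(Y - X) * (3 / 2 * X - Y) = 5/2 * (X * Y) - Y\<^sup>2 - 3/2 * X\<^sup>2"
        by (simp add: field_simps power2_eq_square)
      ultimately have "Y\<^sup>2 \<le> 5/2 * (X * Y) - 3/2 * X\<^sup>2" by linarith
      moreover have "X\<^sup>2 \<le> X * Y" using 3 XY by (simp add: power2_eq_square mult_left_mono)
      moreover have "(3 / 4 * X + Y / 2)\<^sup>2 = 9/16 * X\<^sup>2 + 3/4 * (X * Y) + Y\<^sup>2 / 4"
        by (simp add: power2_eq_square algebra_simps)
      moreover have "X\<^sup>2 \<ge> 0" "Y\<^sup>2 \<ge> 0" by simp_all
      ultimately show ?thesis by linarith
    qed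
    ultimately show ?thesis by linarith
  next
    case 4
    have "X\<^sup>2 \<le> (2 / 3 * Y)\<^sup>2" using 4 XY by (intro power_mono) auto
    moreover have "(2 / 3 * Y)\<^sup>2 = 4/9 * Y\<^sup>2" by (simp add: power2_eq_square)
    moreover have "Y\<^sup>2 \<ge> 0" by simp
    ultimately have "X\<^sup>2 + Y\<^sup>2 / 2 \<le> Y\<^sup>2" by linarith
    also have "\<dots> \<le> A\<^sup>2" using Y XY by (intro power_mono) auto
    finally show ?thesis .
  qed
qed

lemma weighted_coeffs_le_mean_abs:
  fixes c :: "nat \<Rightarrow> complex"
  assumes N: "N > d * (K + 2)"
  shows "(\<Sum>k\<le>d. (cmod (c k))\<^sup>2 / weight k)
    \<le> (mean_bound K * ((\<Sum>w\<in>unity N. cmod (\<Sum>i\<le>d. c i * w ^ i)) / real N))\<^sup>2" (is "_ \<le> ?A\<^sup>2")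
proof -
  have dN: "d < N" and N0: "N > 0" using N by (auto simp: algebra_simps)
  define M where "M = (\<Sum>w\<in>unity N. cmod (\<Sum>i\<le>d. c i * w ^ i)) / real N"
  have M0: "M \<ge> 0" by (simp add: M_def sum_nonneg)
  have MA: "M \<le> ?A" using mult_right_mono[OF mean_bound_ge_1 M0, of K] by (simp add: M_def)
  have cle: "cmod (c k) \<le> ?A" if "k \<le> d" for k
  proof -
    have "cmod (of_nat N * c k) = cmod (\<Sum>w\<in>unity N. (\<Sum>i\<le>d. c i * w ^ i) * cnj w ^ k)"
      using that dN sum_unity_coeff[of d N k c] by simp
    also have "\<dots> \<le> (\<Sum>w\<in>unity N. cmod (\<Sum>i\<le>d. c i * w ^ i))"
      by (rule order_trans[OF norm_sum], rule sum_mono)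
         (simp add: norm_mult norm_power norm_unity[OF N0])
    finally have "cmod (c k) \<le> M" using N0 by (simp add: M_def norm_mult field_simps)
    then show ?thesis using MA by linarith
  qed
  have two: "(cmod (c 0))\<^sup>2 + (cmod (c k))\<^sup>2 / 2 \<le> ?A\<^sup>2" if k: "0 < k" "k \<le> d" for k
  proof (rule square_bound_of_family)
    fix s :: real assume "0 \<le> s" "s \<le> 1/2"
    from mean_abs_ge_two_coeffs[OF this k N, of c]
    show "(1 - s\<^sup>2) * cmod (c 0) + s * cmod (c k) \<le> ?A"
      using N0 by (simp add: field_simps)
  qed (use cle[OF k(2)] in auto)
  define D where "D = ?A\<^sup>2 - (cmod (c 0))\<^sup>2"
  have D0: "D \<ge> 0" using cle[of 0] by (auto simp: D_def intro: power_mono)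
  have "(\<Sum>k\<le>d. (cmod (c k))\<^sup>2 / weight k)
      = (cmod (c 0))\<^sup>2 + (\<Sum>k=1..d. (cmod (c k))\<^sup>2 / weight k)"
    by (subst atLeast0AtMost[symmetric], subst sum.atLeast_Suc_atMost) (simp_all add: weight_def)
  also have "(\<Sum>k=1..d. (cmod (c k))\<^sup>2 / weight k) \<le> (\<Sum>k=1..d. D * (1 / real k - 1 / real (Suc k)))"
  proof (rule sum_mono)
    fix k assume k: "k \<in> {1..d}"
    have "(cmod (c k))\<^sup>2 / 2 \<le> D" using two[of k] k by (simp add: D_def)
    then have "(cmod (c k))\<^sup>2 / 2 / (real k * (real k + 1)) \<le> D / (real k * (real k + 1))"
      by (intro divide_right_mono) auto
    moreover have "1 / real k - 1 / real (Suc k) = 1 / (real k * (real k + 1))"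
      using k by (simp add: field_simps)
    ultimately show "(cmod (c k))\<^sup>2 / weight k \<le> D * (1 / real k - 1 / real (Suc k))"
      using k by (simp add: weight_def mult.assoc)
  qed
  also have "\<dots> = D * (1 - 1 / real (Suc d))"
  proof -
    have "(\<Sum>k=1..d. 1 / real k - 1 / real (Suc k)) = 1 - 1 / real (Suc d)"
      by (induction d) auto
    then show ?thesis by (simp only: sum_distrib_left[symmetric])
  qed
  also have "\<dots> \<le> D" using D0 by (simp add: algebra_simps)
  finally show ?thesis by (simp add: D_def)
qed

subsection \<open>Words and monomials\<close>

definition words :: "'a set \<Rightarrow> nat \<Rightarrow> 'a list set" where
  "words A n = {xs. length xs = n \<and> set xs \<subseteq> A}"

lemma words_0 [simp]: "words A 0 = {[]}"
  by (auto simp: words_def)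

lemma words_Suc: "words A (Suc n) = (\<lambda>(x, xs). x # xs) ` (A \<times> words A n)"
  by (auto simp: words_def length_Suc_conv)

lemma finite_words [simp]: "finite A \<Longrightarrow> finite (words A n)"
  by (induction n) (simp_all add: words_Suc)

lemma sum_words_Suc:
  "(\<Sum>xs\<in>words A (Suc n). g xs) = (\<Sum>x\<in>A. \<Sum>xs\<in>words A n. g (x # xs))"
proof -
  have "inj_on (\<lambda>(x, xs). x # xs) (A \<times> words A n)" by (auto simp: inj_on_def)
  then have "(\<Sum>xs\<in>words A (Suc n). g xs) = (\<Sum>p\<in>A \<times> words A n. g (case p of (x, xs) \<Rightarrow> x # xs))"
    by (simp add: words_Suc sum.reindex comp_def)
  also have "\<dots> = (\<Sum>x\<in>A. \<Sum>xs\<in>words A n. g (x # xs))"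
    by (subst sum.cartesian_product) (simp add: case_prod_unfold)
  finally show ?thesis .
qed

lemma card_words: "finite A \<Longrightarrow> card (words A n) = card A ^ n"
  using card_lists_length_eq[of A n] by (simp add: words_def conj_commute)

lemma length_words: "xs \<in> words A n \<Longrightarrow> length xs = n"
  by (simp add: words_def)

lemma nth_words: "xs \<in> words A n \<Longrightarrow> j < n \<Longrightarrow> xs ! j \<in> A"
  by (auto simp: words_def)

fun monom_list :: "complex list \<Rightarrow> nat list \<Rightarrow> complex" where
  "monom_list (z # zs) (k # ks) = z ^ k * monom_list zs ks"
| "monom_list _ _ = 1"

lemma monom_list_orthogonal:
  assumes N: "N > 0"
  shows "length ks = n \<Longrightarrow> length ls = n \<Longrightarrow>
    (\<Sum>z\<in>words (unity N) n. monom_list z ks * cnj (monom_list z ls))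
      = (if list_all2 (\<lambda>a b. [a = b] (mod N)) ks ls then of_nat N ^ n else 0)"
proof (induction n arbitrary: ks ls)
  case (Suc n)
  obtain k ks' where k: "ks = k # ks'" "length ks' = n" using Suc.prems by (auto simp: length_Suc_conv)
  obtain l ls' where l: "ls = l # ls'" "length ls' = n" using Suc.prems by (auto simp: length_Suc_conv)
  have "(\<Sum>z\<in>words (unity N) (Suc n). monom_list z ks * cnj (monom_list z ls))
      = (\<Sum>w\<in>unity N. \<Sum>z\<in>words (unity N) n.
          (w ^ k * cnj w ^ l) * (monom_list z ks' * cnj (monom_list z ls')))"
    by (simp add: sum_words_Suc k l mult_ac)
  also have "\<dots> = (\<Sum>w\<in>unity N. w ^ k * cnj w ^ l)
      * (\<Sum>z\<in>words (unity N) n. monom_list z ks' * cnj (monom_list z ls'))"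
    by (simp add: sum_product)
  finally show ?case
    using k l by (simp add: unity_orthogonal[OF N] Suc.IH)
qed simp

lemma monom_list_orthogonal_small:
  assumes ks: "ks \<in> words {..d} n" "ls \<in> words {..d} n" and dN: "d < N"
  shows "(\<Sum>z\<in>words (unity N) n. monom_list z ks * cnj (monom_list z ls))
      = (if ks = ls then of_nat N ^ n else 0)"
proof -
  have "[ks ! j = ls ! j] (mod N) \<longleftrightarrow> ks ! j = ls ! j" if "j < n" for j
    using nth_words[OF ks(1) that] nth_words[OF ks(2) that] dN by (simp add: cong_def)
  then have "list_all2 (\<lambda>a b. [a = b] (mod N)) ks ls \<longleftrightarrow> ks = ls"
    using ks by (auto simp: list_all2_conv_all_nth list_eq_iff_nth_eq length_words)
  then show ?thesis
    using monom_list_orthogonal[of N ks n ls] ks dN by (simp add: length_words)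
qed

lemma Parseval_words:
  fixes c :: "nat list \<Rightarrow> complex"
  assumes "d < N"
  shows "(\<Sum>z\<in>words (unity N) n. (cmod (\<Sum>\<alpha>\<in>words {..d} n. c \<alpha> * monom_list z \<alpha>))\<^sup>2)
    = real N ^ n * (\<Sum>\<alpha>\<in>words {..d} n. (cmod (c \<alpha>))\<^sup>2)"
proof -
  let ?W = "words {..d} n" and ?U = "words (unity N) n"
  have "of_real (\<Sum>z\<in>?U. (cmod (\<Sum>\<alpha>\<in>?W. c \<alpha> * monom_list z \<alpha>))\<^sup>2)
      = (\<Sum>z\<in>?U. (\<Sum>\<alpha>\<in>?W. c \<alpha> * monom_list z \<alpha>) * cnj (\<Sum>\<beta>\<in>?W. c \<beta> * monom_list z \<beta>))"
    by (simp only: of_real_sum complex_norm_square)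
  also have "\<dots> = (\<Sum>z\<in>?U. \<Sum>\<alpha>\<in>?W. \<Sum>\<beta>\<in>?W. c \<alpha> * cnj (c \<beta>) * (monom_list z \<alpha> * cnj (monom_list z \<beta>)))"
    by (simp add: sum_product mult_ac)
  also have "\<dots> = (\<Sum>\<alpha>\<in>?W. \<Sum>z\<in>?U. \<Sum>\<beta>\<in>?W. c \<alpha> * cnj (c \<beta>) * (monom_list z \<alpha> * cnj (monom_list z \<beta>)))"
    by (rule sum.swap)
  also have "\<dots> = (\<Sum>\<alpha>\<in>?W. \<Sum>\<beta>\<in>?W. c \<alpha> * cnj (c \<beta>) * (\<Sum>z\<in>?U. monom_list z \<alpha> * cnj (monom_list z \<beta>)))"
    by (rule sum.cong[OF refl], subst sum.swap) (simp add: sum_distrib_left)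
  also have "\<dots> = (\<Sum>\<alpha>\<in>?W. \<Sum>\<beta>\<in>?W. if \<alpha> = \<beta> then c \<alpha> * cnj (c \<beta>) * of_nat N ^ n else 0)"
    by (intro sum.cong refl) (simp add: monom_list_orthogonal_small[OF _ _ assms])
  also have "\<dots> = (\<Sum>\<alpha>\<in>?W. c \<alpha> * cnj (c \<alpha>) * of_nat N ^ n)"
    by (simp add: sum.delta')
  also have "\<dots> = of_real (real N ^ n * (\<Sum>\<alpha>\<in>?W. (cmod (c \<alpha>))\<^sup>2))"
    by (simp only: of_real_mult of_real_sum complex_norm_square sum_distrib_left mult.commute) simp
  finally show ?thesis by (simp only: of_real_eq_iff)
qed

section \<open>Passage from one variable to several\<close>

lemma L2_set_sum_le:
  assumes "finite I"
  shows "L2_set (\<lambda>k. \<Sum>i\<in>I. g i k) A \<le> (\<Sum>i\<in>I. L2_set (g i) A)"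
  using assms
proof (induction I rule: finite_induct)
  case empty
  then show ?case by (simp add: L2_set_def)
next
  case (insert i I)
  then show ?case
    using L2_set_triangle_ineq[of "g i" "\<lambda>k. \<Sum>i\<in>I. g i k" A] by simp
qed

text \<open>
  Minkowski's inequality moves the mean over the remaining variables outside the square sum, so
  that the one-variable inequality applies once per variable.
\<close>

lemma weighted_coeffs_le_mean_abs_words:
  fixes c :: "nat list \<Rightarrow> complex"
  assumes N: "N > d * (K + 2)"
  shows "L2_set (\<lambda>\<alpha>. cmod (c \<alpha>) / sqrt (\<Prod>k\<leftarrow>\<alpha>. weight k)) (words {..d} n)
    \<le> (mean_bound K / real N) ^ n
        * (\<Sum>z\<in>words (unity N) n. cmod (\<Sum>\<alpha>\<in>words {..d} n. c \<alpha> * monom_list z \<alpha>))"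
proof (induction n arbitrary: c)
  case 0
  then show ?case by (simp add: L2_set_def)
next
  case (Suc n)
  have N0: "N > 0" using N by auto
  define q where "q = mean_bound K / real N"
  have q0: "q \<ge> 0" using mean_bound_ge_1[of K] by (simp add: q_def)
  let ?U = "words (unity N) n" and ?W = "words {..d} n"
  define f where "f k z = (\<Sum>\<alpha>\<in>?W. c (k # \<alpha>) * monom_list z \<alpha>)" for k z
  have wpos: "(\<Prod>k\<leftarrow>\<alpha>. weight k) \<ge> 0" for \<alpha> by (induction \<alpha>) (simp_all add: less_imp_le)
  have "L2_set (\<lambda>\<alpha>. cmod (c \<alpha>) / sqrt (\<Prod>k\<leftarrow>\<alpha>. weight k)) (words {..d} (Suc n))
      = L2_set (\<lambda>k. L2_set (\<lambda>\<alpha>. cmod (c (k # \<alpha>)) / sqrt (\<Prod>k\<leftarrow>\<alpha>. weight k)) ?W / sqrt (weight k)) {..d}"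
  proof -
    have "(L2_set (\<lambda>\<alpha>. cmod (c (k # \<alpha>)) / sqrt (\<Prod>k\<leftarrow>\<alpha>. weight k)) ?W / sqrt (weight k))\<^sup>2
        = (\<Sum>\<alpha>\<in>?W. (cmod (c (k # \<alpha>)) / sqrt (\<Prod>k\<leftarrow>(k # \<alpha>). weight k))\<^sup>2)" for k
      by (simp add: L2_set_def sum_nonneg power_divide real_sqrt_mult power_mult_distrib
          sum_divide_distrib wpos less_imp_le mult.commute)
    then show ?thesis by (simp add: L2_set_def sum_words_Suc del: list.map prod_list.Cons)
  qed
  also have "\<dots> \<le> L2_set (\<lambda>k. \<Sum>z\<in>?U. q ^ n * cmod (f k z) / sqrt (weight k)) {..d}"
  proof (rule L2_set_mono)
    fix k
    show "L2_set (\<lambda>\<alpha>. cmod (c (k # \<alpha>)) / sqrt (\<Prod>k\<leftarrow>\<alpha>. weight k)) ?W / sqrt (weight k)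
        \<le> (\<Sum>z\<in>?U. q ^ n * cmod (f k z) / sqrt (weight k))"
      using Suc.IH[of "\<lambda>\<alpha>. c (k # \<alpha>)"]
      by (simp add: f_def q_def sum_distrib_left sum_divide_distrib[symmetric] divide_right_mono less_imp_le)
  qed (simp add: less_imp_le)
  also have "\<dots> \<le> (\<Sum>z\<in>?U. L2_set (\<lambda>k. q ^ n * cmod (f k z) / sqrt (weight k)) {..d})"
    using N0 by (intro L2_set_sum_le) simp
  also have "\<dots> = (\<Sum>z\<in>?U. q ^ n * L2_set (\<lambda>k. cmod (f k z) / sqrt (weight k)) {..d})"
    using q0 by (simp add: L2_set_right_distrib)
  \<comment> \<open>For fixed values \<open>z\<close> of the other variables the numbers
    \<open>f k z\<close> are the coefficients of a polynomial in the first variable.\<close>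
  also have "\<dots> \<le> (\<Sum>z\<in>?U. q ^ n * (q * (\<Sum>w\<in>unity N. cmod (\<Sum>k\<le>d. f k z * w ^ k))))"
  proof (intro sum_mono mult_left_mono)
    fix z
    have "L2_set (\<lambda>k. cmod (f k z) / sqrt (weight k)) {..d}
        = sqrt (\<Sum>k\<le>d. (cmod (f k z))\<^sup>2 / weight k)"
      by (simp add: L2_set_def power_divide less_imp_le)
    also have "\<dots> \<le> sqrt ((mean_bound K * ((\<Sum>w\<in>unity N. cmod (\<Sum>k\<le>d. f k z * w ^ k)) / real N))\<^sup>2)"
      by (rule real_sqrt_le_mono[OF weighted_coeffs_le_mean_abs[OF N]])
    also have "\<dots> = q * (\<Sum>w\<in>unity N. cmod (\<Sum>k\<le>d. f k z * w ^ k))"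
      using mean_bound_ge_1[of K] by (simp add: q_def sum_nonneg)
    finally show "L2_set (\<lambda>k. cmod (f k z) / sqrt (weight k)) {..d}
      \<le> q * (\<Sum>w\<in>unity N. cmod (\<Sum>k\<le>d. f k z * w ^ k))" .
  qed (use q0 in simp)
  also have "\<dots> = q ^ Suc n * (\<Sum>z\<in>?U. \<Sum>w\<in>unity N. cmod (\<Sum>k\<le>d. f k z * w ^ k))"
    by (simp add: sum_distrib_left mult_ac)
  also have "(\<Sum>z\<in>?U. \<Sum>w\<in>unity N. cmod (\<Sum>k\<le>d. f k z * w ^ k))
      = (\<Sum>z\<in>words (unity N) (Suc n). cmod (\<Sum>\<alpha>\<in>words {..d} (Suc n). c \<alpha> * monom_list z \<alpha>))"
    by (subst sum.swap) (simp add: sum_words_Suc f_def sum_distrib_left sum_distrib_right mult_ac)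
  finally show ?case by (simp add: q_def)
qed

subsection \<open>Symmetric arrays and their polynomials\<close>

text \<open>
  A symmetric array is a function of the multiset of its indices; the polynomial of the array
  \<open>t\<close> is \<open>z \<mapsto> T(z, \<dots>, z)\<close> for the symmetric form \<open>T\<close> with these coefficients.
\<close>

definition word_monom :: "(nat \<Rightarrow> complex) \<Rightarrow> nat list \<Rightarrow> complex" where
  "word_monom z i = (\<Prod>j\<leftarrow>i. z j)"

definition form :: "nat \<Rightarrow> nat \<Rightarrow> (nat multiset \<Rightarrow> complex) \<Rightarrow> (nat \<Rightarrow> complex) \<Rightarrow> complex" where
  "form n m t z = (\<Sum>i\<in>words {..<n} m. t (mset i) * word_monom z i)"

text \<open>The multinomial coefficient of the exponents of \<open>i\<close>, see
  \<open>arrangements_mult_fact\<close>.\<close>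

definition arrangements :: "nat list \<Rightarrow> nat" where
  "arrangements i = card (permutations_of_multiset (mset i))"

definition exponents :: "nat \<Rightarrow> nat list \<Rightarrow> nat list" where
  "exponents n i = map (count_list i) [0..<n]"

lemma exponents_in_words: "i \<in> words {..<n} m \<Longrightarrow> exponents n i \<in> words {..m} n"
  using count_le_length by (auto simp: exponents_def words_def)

lemma exponents_eq_iff:
  assumes "i \<in> words {..<n} m" "i' \<in> words {..<n} m'"
  shows "exponents n i = exponents n i' \<longleftrightarrow> mset i = mset i'"
proof
  assume eq: "exponents n i = exponents n i'"
  have "count_list i j = count_list i' j" for j
  proof (cases "j < n")
    case True
    then show ?thesis using arg_cong[OF eq, of "\<lambda>x. x ! j"] by (simp add: exponents_def)
  next
    case False
    then have "j \<notin> set i" "j \<notin> set i'" using assms by (auto simp: words_def)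
    then show ?thesis by (simp add: count_list_0_iff)
  qed
  then show "mset i = mset i'" by (intro multiset_eqI) (simp add: count_mset)
next
  assume "mset i = mset i'"
  then show "exponents n i = exponents n i'"
    by (metis (no_types, lifting) count_mset exponents_def map_eq_conv)
qed

lemma permutations_in_words:
  assumes "i \<in> words A m"
  shows "permutations_of_multiset (mset i) = {i' \<in> words A m. mset i' = mset i}"
proof -
  have "i' \<in> words A m" if "mset i' = mset i" for i'
    using that assms by (auto simp: words_def dest: mset_eq_setD mset_eq_length)
  then show ?thesis by (auto simp: permutations_of_multiset_def)
qed

lemma monom_list_eq_prod:
  "length zs = length ks \<Longrightarrow> monom_list zs ks = (\<Prod>j<length ks. zs ! j ^ (ks ! j))"
  by (induction zs ks rule: list_induct2) (simp_all add: lessThan_Suc_eq_insert_0 prod.reindex)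

lemma word_monom_eq_prod:
  "set i \<subseteq> {..<n} \<Longrightarrow> word_monom z i = (\<Prod>j<n. z j ^ count_list i j)"
proof (induction i)
  case (Cons a i)
  have "(\<Prod>j<n. z j ^ count_list (a # i) j)
      = (\<Prod>j<n. (if j = a then z j else 1) * z j ^ count_list i j)"
    by (rule prod.cong) auto
  also have "\<dots> = z a * (\<Prod>j<n. z j ^ count_list i j)"
    using Cons.prems by (simp add: prod.distrib)
  finally show ?case using Cons by (simp add: word_monom_def)
qed (simp add: word_monom_def)

lemma word_monom_eq_monom_list:
  assumes "i \<in> words {..<n} m" "length zs = n"
  shows "word_monom ((!) zs) i = monom_list zs (exponents n i)"
  using assms by (subst word_monom_eq_prod[of _ n]) (auto simp: words_def monom_list_eq_prod exponents_def)

definition poly_coeff :: "nat \<Rightarrow> nat \<Rightarrow> (nat multiset \<Rightarrow> complex) \<Rightarrow> nat list \<Rightarrow> complex" where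
  "poly_coeff n m t \<alpha> = (\<Sum>i | i \<in> words {..<n} m \<and> exponents n i = \<alpha>. t (mset i))"

lemma form_eq_poly:
  assumes "length zs = n"
  shows "form n m t ((!) zs) = (\<Sum>\<alpha>\<in>words {..m} n. poly_coeff n m t \<alpha> * monom_list zs \<alpha>)"
proof -
  have "form n m t ((!) zs) = (\<Sum>i\<in>words {..<n} m. t (mset i) * monom_list zs (exponents n i))"
    by (simp add: form_def word_monom_eq_monom_list[OF _ assms])
  also have "\<dots> = (\<Sum>\<alpha>\<in>words {..m} n. \<Sum>i | i \<in> words {..<n} m \<and> exponents n i = \<alpha>.
      t (mset i) * monom_list zs (exponents n i))"
    by (rule sum.group[symmetric]) (auto intro: exponents_in_words)
  also have "\<dots> = (\<Sum>\<alpha>\<in>words {..m} n. poly_coeff n m t \<alpha> * monom_list zs \<alpha>)"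
    by (simp add: poly_coeff_def sum_distrib_right)
  finally show ?thesis .
qed

text \<open>The coefficient of a monomial is the common entry times the number of arrangements. Its
  square, spread evenly over these words, leaves one factor \<open>arrangements i\<close> in each
  term.\<close>

lemma sum_poly_coeff_sq:
  "(\<Sum>\<alpha>\<in>words {..m} n. (cmod (poly_coeff n m t \<alpha>))\<^sup>2 * g \<alpha>)
    = (\<Sum>i\<in>words {..<n} m. real (arrangements i) * (cmod (t (mset i)))\<^sup>2 * g (exponents n i))"
proof -
  have "(cmod (poly_coeff n m t \<alpha>))\<^sup>2 * g \<alpha>
      = (\<Sum>i | i \<in> words {..<n} m \<and> exponents n i = \<alpha>.
          real (arrangements i) * (cmod (t (mset i)))\<^sup>2 * g (exponents n i))" for \<alpha>
  proof (cases "\<exists>i. i \<in> words {..<n} m \<and> exponents n i = \<alpha>")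
    case False
    then have e: "{i. i \<in> words {..<n} m \<and> exponents n i = \<alpha>} = {}" by blast
    show ?thesis unfolding poly_coeff_def e by simp
  next
    case True
    then obtain i where i: "i \<in> words {..<n} m" "exponents n i = \<alpha>" by blast
    have fib: "{i'. i' \<in> words {..<n} m \<and> exponents n i' = \<alpha>} = permutations_of_multiset (mset i)"
      unfolding permutations_in_words[OF i(1)] using i exponents_eq_iff[OF _ i(1)] by auto
    have ms: "mset i' = mset i" if "i' \<in> permutations_of_multiset (mset i)" for i'
      using that by (simp add: permutations_of_multiset_def)
    have "poly_coeff n m t \<alpha> = of_nat (arrangements i) * t (mset i)"
      unfolding poly_coeff_def fib by (simp add: ms arrangements_def)
    moreover have "(\<Sum>i' | i' \<in> words {..<n} m \<and> exponents n i' = \<alpha>.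
          real (arrangements i') * (cmod (t (mset i')))\<^sup>2 * g (exponents n i'))
        = (\<Sum>i'\<in>permutations_of_multiset (mset i). real (arrangements i) * (cmod (t (mset i)))\<^sup>2 * g \<alpha>)"
      unfolding fib by (rule sum.cong) (use fib in \<open>auto simp: ms arrangements_def\<close>)
    ultimately show ?thesis
      by (simp add: arrangements_def[of i, symmetric] norm_mult power2_eq_square)
  qed
  then have "(\<Sum>\<alpha>\<in>words {..m} n. (cmod (poly_coeff n m t \<alpha>))\<^sup>2 * g \<alpha>)
      = (\<Sum>\<alpha>\<in>words {..m} n. \<Sum>i | i \<in> words {..<n} m \<and> exponents n i = \<alpha>.
          real (arrangements i) * (cmod (t (mset i)))\<^sup>2 * g (exponents n i))"
    by simp
  also have "\<dots> = (\<Sum>i\<in>words {..<n} m. real (arrangements i) * (cmod (t (mset i)))\<^sup>2 * g (exponents n i))"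
    by (rule sum.group) (auto intro: exponents_in_words)
  finally show ?thesis .
qed

section \<open>Forms bounded on the polydisc\<close>

definition bounded_form :: "nat \<Rightarrow> nat \<Rightarrow> (nat multiset \<Rightarrow> complex) \<Rightarrow> real \<Rightarrow> bool" where
  "bounded_form n m t B \<longleftrightarrow> (\<forall>z. (\<forall>j. cmod (z j) \<le> 1) \<longrightarrow> cmod (form n m t z) \<le> B)"

lemma form_cong: "(\<And>j. j < n \<Longrightarrow> z j = z' j) \<Longrightarrow> form n m t z = form n m t z'"
  unfolding form_def word_monom_def
  by (intro sum.cong refl arg_cong2[where f="(*)"] arg_cong[where f=prod_list] map_cong)
     (auto simp: words_def)

lemma bounded_formD:
  assumes "bounded_form n m t B" "\<And>j. j < n \<Longrightarrow> cmod (z j) \<le> 1"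
  shows "cmod (form n m t z) \<le> B"
proof -
  have "form n m t z = form n m t (\<lambda>j. if j < n then z j else 0)" by (rule form_cong) simp
  then show ?thesis using assms by (simp add: bounded_form_def)
qed

lemma bounded_form_nonneg: "bounded_form n m t B \<Longrightarrow> B \<ge> 0"
  by (rule order_trans[OF norm_ge_zero bounded_formD[where z="\<lambda>_. 0"]]) auto

lemma Parseval_form:
  assumes b: "bounded_form n m t B"
  shows "(\<Sum>i\<in>words {..<n} m. real (arrangements i) * (cmod (t (mset i)))\<^sup>2) \<le> B\<^sup>2"
proof -
  define N where "N = Suc m"
  have N0: "N > 0" by (simp add: N_def)
  let ?U = "words (unity N) n"
  have "real N ^ n * (\<Sum>i\<in>words {..<n} m. real (arrangements i) * (cmod (t (mset i)))\<^sup>2)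
      = real N ^ n * (\<Sum>\<alpha>\<in>words {..m} n. (cmod (poly_coeff n m t \<alpha>))\<^sup>2)"
    using sum_poly_coeff_sq[of n m t "\<lambda>_. 1"] by simp
  also have "\<dots> = (\<Sum>z\<in>?U. (cmod (form n m t ((!) z)))\<^sup>2)"
    by (subst Parseval_words[of m N, symmetric]) (auto simp: N_def form_eq_poly length_words)
  also have "\<dots> \<le> (\<Sum>z\<in>?U. B\<^sup>2)"
  proof (intro sum_mono power_mono)
    fix z assume "z \<in> ?U"
    then show "cmod (form n m t ((!) z)) \<le> B"
      using norm_unity[OF N0] by (intro bounded_formD[OF b]) (simp add: nth_words)
  qed simp
  also have "\<dots> = real N ^ n * B\<^sup>2" using N0 by (simp add: card_words)
  finally show ?thesis using N0 by simp
qed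

lemma weighted_coeffs_le_mean_abs_form:
  assumes N: "N > m * (K + 2)"
  shows "sqrt (\<Sum>i\<in>words {..<n} m. real (arrangements i) * (cmod (t (mset i)))\<^sup>2 / (\<Prod>j<n. weight (count_list i j)))
    \<le> (mean_bound K / real N) ^ n * (\<Sum>z\<in>words (unity N) n. cmod (form n m t ((!) z)))"
proof -
  have wpos: "(\<Prod>k\<leftarrow>\<alpha>. weight k) \<ge> 0" for \<alpha> by (induction \<alpha>) (simp_all add: less_imp_le)
  have "L2_set (\<lambda>\<alpha>. cmod (poly_coeff n m t \<alpha>) / sqrt (\<Prod>k\<leftarrow>\<alpha>. weight k)) (words {..m} n)
      = sqrt (\<Sum>\<alpha>\<in>words {..m} n. (cmod (poly_coeff n m t \<alpha>))\<^sup>2 * (1 / (\<Prod>k\<leftarrow>\<alpha>. weight k)))"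
    by (simp add: L2_set_def power_divide wpos)
  also have "\<dots> = sqrt (\<Sum>i\<in>words {..<n} m. real (arrangements i) * (cmod (t (mset i)))\<^sup>2
      / (\<Prod>j<n. weight (count_list i j)))"
    by (subst sum_poly_coeff_sq)
       (simp add: exponents_def comp_def prod.distinct_set_conv_list[symmetric] atLeast0LessThan flip: prod.list_conv_set_nth)
  finally show ?thesis
    using weighted_coeffs_le_mean_abs_words[OF N, of "poly_coeff n m t" n]
    by (simp add: form_eq_poly length_words cong: sum.cong)
qed

subsection \<open>Weights against numbers of arrangements\<close>

text \<open>For positive \<open>x\<close> and \<open>y\<close>, raising \<open>x\<close> by 1
  multiplies the left side by \<open>r x\<close> and the right side by \<open>r (x + y)\<close>,
  where \<open>r k = (k + 1)(k + 2)/k\<close> satisfies \<open>r x <= r (x + y)\<close>. The step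
  from 0 to 1 has the factor \<open>weight 1 = 4 <= r y\<close>.\<close>

lemma weight_fact_supermult: "weight x * fact x * (weight y * fact y) \<le> weight (x + y) * fact (x + y)"
proof (cases "y = 0")
  case True
  then show ?thesis by (simp add: weight_def)
next
  case False
  define r where "r k = (real k + 1) * (real k + 2) / real k" for k
  have step: "weight (Suc k) * fact (Suc k) = r k * (weight k * fact k)" if "k > 0" for k
    using that by (simp add: weight_def r_def field_simps)
  have r: "r a \<le> r (a + y)" if "a > 0" for a
  proof -
    have "r (a + y) - r a = real y * (real a * (real a + real y) - 2) / (real a * (real a + real y))"
      using that by (simp add: r_def field_simps)
    moreover have "1 * 2 \<le> real a * (real a + real y)"
      using that False by (intro mult_mono) auto
    ultimately show ?thesis using that by (smt (verit) divide_nonneg_nonneg mult_nonneg_nonneg of_nat_0_le_iff)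
  qed
  show ?thesis
  proof (induction x)
    case 0
    then show ?case by (simp add: weight_def)
  next
    case (Suc x)
    have nn: "weight k * fact k \<ge> 0" for k by (simp add: less_imp_le)
    have s2: "weight (Suc x + y) * fact (Suc x + y) = r (x + y) * (weight (x + y) * fact (x + y))"
      using step[of "x + y"] False by simp
    show ?case
    proof (cases "x = 0")
      case True
      have "4 \<le> r y"
      proof -
        have "(real y + 1) * (real y + 2) - 4 * real y = (real y - 1/2)\<^sup>2 + 7/4"
          by (simp add: power2_eq_square algebra_simps)
        also have "\<dots> \<ge> 0" by simp
        finally show ?thesis using False by (simp add: r_def field_simps)
      qed
      then have "4 * (weight y * fact y) \<le> r y * (weight y * fact y)"
        by (intro mult_right_mono nn)
      moreover have "weight (Suc 0) = 4" by (simp add: weight_def)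
      ultimately show ?thesis using True s2 by (simp del: fact_Suc)
    next
      case False
      have "weight (Suc x) * fact (Suc x) * (weight y * fact y) = r x * (weight x * fact x * (weight y * fact y))"
        using step[of x] False by simp
      also have "\<dots> \<le> r x * (weight (x + y) * fact (x + y))"
        using Suc.IH by (intro mult_left_mono) (simp_all add: r_def)
      also have "\<dots> \<le> r (x + y) * (weight (x + y) * fact (x + y))"
        using r[of x] False by (intro mult_right_mono nn) simp
      finally show ?thesis using s2 by (simp del: fact_Suc)
    qed
  qed
qed

lemma prod_le_of_supermult:
  fixes \<phi> :: "nat \<Rightarrow> real"
  assumes "\<And>x y. \<phi> x * \<phi> y \<le> \<phi> (x + y)" "\<And>x. \<phi> x \<ge> 0" "\<phi> 0 = 1" "finite J"
  shows "(\<Prod>j\<in>J. \<phi> (b j)) \<le> \<phi> (\<Sum>j\<in>J. b j)"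
  using assms(4)
proof (induction J rule: finite_induct)
  case (insert j J)
  have "(\<Prod>j\<in>insert j J. \<phi> (b j)) \<le> \<phi> (b j) * \<phi> (\<Sum>j\<in>J. b j)"
    using insert by (simp add: mult_left_mono assms(2))
  also have "\<dots> \<le> \<phi> (\<Sum>j\<in>insert j J. b j)" using insert assms(1) by simp
  finally show ?case .
qed (simp add: assms)

lemma sum_count_words:
  fixes n m :: nat
  shows "i \<in> words {..<n} m \<Longrightarrow> (\<Sum>j<n. count_list i j) = m"
  using sum_count_set[of i "{..<n}"] by (auto simp: words_def)

lemma arrangements_mult_fact:
  assumes "i \<in> words {..<n} m"
  shows "real (arrangements i) * (\<Prod>j<n. fact (count_list i j)) = fact m"
proof -
  have "(\<Prod>j<n. fact (count_list i j)) = (\<Prod>j\<in>set i. fact (count_list i j) :: nat)"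
    using assms by (intro prod.mono_neutral_right) (auto simp: words_def count_list_0_iff)
  then have "arrangements i * (\<Prod>j<n. fact (count_list i j)) = fact m"
    using card_permutations_of_multiset_aux[of "mset i"] assms
    by (simp add: arrangements_def length_words count_mset)
  then have "real (arrangements i * (\<Prod>j<n. fact (count_list i j))) = real (fact m)" by simp
  then show ?thesis by simp
qed

lemma weight_le_arrangements:
  assumes i: "i \<in> words {..<n} m" and le: "(\<Prod>j<n. weight (count_list i j) * fact (count_list i j)) \<le> C * fact m"
  shows "(\<Prod>j<n. weight (count_list i j)) \<le> C * real (arrangements i)"
proof -
  have "(\<Prod>j<n. weight (count_list i j)) * (\<Prod>j<n. fact (count_list i j))
      \<le> C * real (arrangements i) * (\<Prod>j<n. fact (count_list i j))"
    using le arrangements_mult_fact[OF i] by (simp add: prod.distrib mult.assoc)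
  moreover have "(\<Prod>j<n. fact (count_list i j)) > (0::real)" by (intro prod_pos) simp
  ultimately show ?thesis by (simp add: mult_le_cancel_right)
qed

lemma weight_le: "x \<le> m \<Longrightarrow> weight x \<le> 2 * (real m + 1)\<^sup>2"
proof -
  assume x: "x \<le> m"
  have "real x * (real x + 1) \<le> (real m + 1) * (real m + 1)" using x by (intro mult_mono) auto
  moreover have "1 * 1 \<le> (real m + 1) * (real m + 1)" by (intro mult_mono) auto
  ultimately show ?thesis by (simp add: weight_def power2_eq_square)
qed

text \<open>Here all letters are merged into a single group of size \<open>m\<close>, whose weight
  is quadratic in \<open>m\<close>.\<close>

lemma weight_le_arrangements_all:
  assumes i: "i \<in> words {..<n} m"
  shows "(\<Prod>j<n. weight (count_list i j)) \<le> 2 * (real m + 1)\<^sup>2 * real (arrangements i)"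
proof (rule weight_le_arrangements[OF i])
  have "(\<Prod>j<n. weight (count_list i j) * fact (count_list i j)) \<le> weight m * fact m"
    using prod_le_of_supermult[of "\<lambda>k. weight k * fact k" "{..<n}" "count_list i"]
      weight_fact_supermult sum_count_words[OF i] by (simp add: less_imp_le) (simp add: weight_def)
  also have "\<dots> \<le> 2 * (real m + 1)\<^sup>2 * fact m" by (intro mult_right_mono weight_le) auto
  finally show "(\<Prod>j<n. weight (count_list i j) * fact (count_list i j)) \<le> 2 * (real m + 1)\<^sup>2 * fact m" .
qed

text \<open>Summands below \<open>q\<close>, added one at a time, cannot jump over the interval from
  \<open>q\<close> to \<open>2 * q\<close>.\<close>

lemma exists_intermediate_subset_sum:
  fixes b :: "'a \<Rightarrow> nat"
  assumes "finite I" "\<And>j. j \<in> I \<Longrightarrow> b j < q" "0 < q" "q \<le> (\<Sum>j\<in>I. b j)"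
  shows "\<exists>J\<subseteq>I. q \<le> (\<Sum>j\<in>J. b j) \<and> (\<Sum>j\<in>J. b j) < 2 * q"
  using assms
proof (induction I rule: finite_induct)
  case (insert x I)
  show ?case
  proof (cases "q \<le> (\<Sum>j\<in>I. b j)")
    case True
    then obtain J where "J \<subseteq> I" "q \<le> (\<Sum>j\<in>J. b j) \<and> (\<Sum>j\<in>J. b j) < 2 * q"
      using insert by auto
    then show ?thesis by blast
  next
    case False
    moreover have "b x < q" by (rule insert.prems(1)) simp
    ultimately have "(\<Sum>j\<in>insert x I. b j) < 2 * q" using insert.hyps by simp
    then show ?thesis using insert.prems by blast
  qed
qed auto

lemma binomial_ge_inner:
  assumes "q \<le> x" "x + q \<le> m"
  shows "m choose q \<le> m choose x"
proof (cases "2 * x \<le> m")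
  case True
  then show ?thesis using assms by (intro binomial_mono)
next
  case False
  then have "m choose q \<le> m choose (m - x)" using assms by (intro binomial_mono) auto
  then show ?thesis using assms binomial_symmetric[of x m] by simp
qed

text \<open>
  By supermultiplicativity the indices may be merged into two groups, both of size at least 7.
\<close>

lemma weight_le_arrangements_deep:
  assumes i: "i \<in> words {..<n} m" and m: "m \<ge> 20" and deep: "\<And>j. count_list i j + 7 \<le> m"
  shows "(\<Prod>j<n. weight (count_list i j))
    \<le> 4 * (real m + 1) ^ 4 / real (m choose 7) * real (arrangements i)"
proof (rule weight_le_arrangements[OF i])
  let ?\<phi> = "\<lambda>k. weight k * fact k :: real"
  \<comment> \<open>Either one frequent letter is a group of its own, or all multiplicities are
    below 7 and a group of size 7 to 13 can be collected; then \<open>m >= 20\<close> leaves at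
    least 7 for the complement.\<close>
  obtain J where J: "J \<subseteq> {..<n}" "7 \<le> (\<Sum>j\<in>J. count_list i j)" "(\<Sum>j\<in>J. count_list i j) + 7 \<le> m"
  proof (cases "\<exists>j<n. 7 \<le> count_list i j")
    case True
    then obtain j where "j < n" "7 \<le> count_list i j" by blast
    then show ?thesis using that[of "{j}"] deep[of j] by simp
  next
    case False
    then have "\<exists>J\<subseteq>{..<n}. 7 \<le> (\<Sum>j\<in>J. count_list i j) \<and> (\<Sum>j\<in>J. count_list i j) < 2 * 7"
      using m by (intro exists_intermediate_subset_sum) (auto simp: sum_count_words[OF i] not_le)
    then show ?thesis using that m by force
  qed
  define x where "x = (\<Sum>j\<in>J. count_list i j)"
  have fJ: "finite J" using J(1) finite_subset by blast
  have rest: "(\<Sum>j\<in>{..<n} - J. count_list i j) = m - x"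
    using sum.subset_diff[OF J(1), of "count_list i"] sum_count_words[OF i] by (simp add: x_def)
  have x: "7 \<le> x" "x + 7 \<le> m" using J by (simp_all add: x_def)
  have merge: "(\<Prod>j\<in>I. ?\<phi> (count_list i j)) \<le> ?\<phi> (\<Sum>j\<in>I. count_list i j)" if "finite I" for I
    using that weight_fact_supermult
    by (intro prod_le_of_supermult) (simp_all add: less_imp_le, simp add: weight_def)
  have nn: "?\<phi> k \<ge> 0" for k by (simp add: less_imp_le)
  have "(\<Prod>j<n. ?\<phi> (count_list i j))
      = (\<Prod>j\<in>{..<n} - J. ?\<phi> (count_list i j)) * (\<Prod>j\<in>J. ?\<phi> (count_list i j))"
    using prod.subset_diff[OF J(1)] by simp
  also have "\<dots> \<le> ?\<phi> (m - x) * ?\<phi> x"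
    using merge[of "{..<n} - J"] merge[OF fJ] rest
    by (intro mult_mono) (auto simp: x_def less_imp_le intro!: prod_nonneg)
  also have "\<dots> = weight (m - x) * weight x * (fact x * fact (m - x))" by simp
  also have "\<dots> \<le> (2 * (real m + 1)\<^sup>2) * (2 * (real m + 1)\<^sup>2) * (fact x * fact (m - x))"
    using x by (intro mult_right_mono mult_mono weight_le) (auto simp: less_imp_le)
  also have "fact x * fact (m - x) = (fact m / real (m choose x) :: real)"
    using x by (simp add: binomial_fact)
  also have "(2 * (real m + 1)\<^sup>2) * (2 * (real m + 1)\<^sup>2) * (fact m / real (m choose x))
      \<le> (2 * (real m + 1)\<^sup>2) * (2 * (real m + 1)\<^sup>2) * (fact m / real (m choose 7))"
    using x m binomial_ge_inner[of 7 x m] by (intro mult_left_mono divide_left_mono) auto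
  finally show "(\<Prod>j<n. weight (count_list i j) * fact (count_list i j))
      \<le> 4 * (real m + 1) ^ 4 / real (m choose 7) * fact m"
    by (simp add: power2_eq_square power4_eq_xxxx mult_ac)
qed

lemma replicate_of_count_list: "count_list xs l = length xs \<Longrightarrow> xs = replicate (length xs) l"
proof (induction xs)
  case (Cons x xs)
  then show ?case using count_le_length[of xs l] by (cases "x = l") auto
qed simp

text \<open>A multinomial coefficient is at least the binomial coefficient obtained by merging all
  letters but one; for a nonconstant word this is some \<open>m choose c\<close> with
  \<open>0 < c < m\<close>.\<close>

lemma arrangements_ge_length:
  assumes i: "i \<in> words {..<n} m" and nc: "\<And>j. j < n \<Longrightarrow> i \<noteq> replicate m j" and m: "m > 0"
  shows "real m \<le> real (arrangements i)"
proof -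
  obtain l where l: "l \<in> set i" using i m by (cases i) (auto simp: words_def)
  then have ln: "l < n" using i by (auto simp: words_def)
  define c where "c = count_list i l"
  have c0: "c > 0" using l by (simp add: c_def count_list_0_iff neq0_conv[symmetric] del: neq0_conv)
  have cm: "c < m"
  proof (rule ccontr)
    assume "\<not> c < m"
    then have "count_list i l = length i"
      using count_le_length[of i l] i by (simp add: c_def length_words)
    then have "i = replicate m l" using i replicate_of_count_list[of i l] by (simp add: length_words)
    then show False using nc ln by blast
  qed
  have rest: "(\<Sum>j\<in>{..<n} - {l}. count_list i j) = m - c"
    using sum.remove[of "{..<n}" l "count_list i"] ln sum_count_words[OF i] by (simp add: c_def)
  have fs: "fact x * fact y \<le> (fact (x + y) :: real)" for x y
    by (metis fact_fact_dvd_fact dvd_imp_le fact_gt_zero of_nat_fact of_nat_le_iff of_nat_mult)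
  have "(\<Prod>j<n. fact (count_list i j) :: real) = fact c * (\<Prod>j\<in>{..<n} - {l}. fact (count_list i j))"
    using ln by (simp add: prod.remove c_def)
  also have "\<dots> \<le> fact c * fact (m - c)"
    using prod_le_of_supermult[of "fact" "{..<n} - {l}" "count_list i"] rest fs by simp
  finally have "real (arrangements i) * (\<Prod>j<n. fact (count_list i j))
      \<le> real (arrangements i) * (fact c * fact (m - c))"
    by (intro mult_left_mono) auto
  then have "fact m / (fact c * fact (m - c)) \<le> real (arrangements i)"
    unfolding arrangements_mult_fact[OF i] by (simp add: divide_le_eq)
  also have "fact m / (fact c * fact (m - c)) = real (m choose c)"
    using cm by (simp add: binomial_fact)
  finally have "real (m choose c) \<le> real (arrangements i)" .
  moreover have "m choose 1 \<le> m choose c" using c0 cm by (intro binomial_ge_inner) auto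
  ultimately show ?thesis by simp
qed

subsection \<open>Directional derivatives\<close>

abbreviation slice :: "nat \<Rightarrow> (nat multiset \<Rightarrow> complex) \<Rightarrow> nat multiset \<Rightarrow> complex" where
  "slice j t \<equiv> (\<lambda>A. t (add_mset j A))"

definition line_poly :: "(nat \<Rightarrow> complex) \<Rightarrow> (nat \<Rightarrow> complex) \<Rightarrow> nat list \<Rightarrow> complex poly" where
  "line_poly z w i = (\<Prod>j\<leftarrow>i. [:z j, w j:])"

lemma line_poly_simps [simp]:
  "line_poly z w [] = 1" "line_poly z w (j # i) = [:z j, w j:] * line_poly z w i"
  by (simp_all add: line_poly_def)

lemma poly_line_poly: "poly (line_poly z w i) x = word_monom (\<lambda>j. z j + x * w j) i"
  by (induction i) (simp_all add: word_monom_def algebra_simps)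

lemma degree_line_poly: "degree (line_poly z w i) \<le> length i"
proof (induction i)
  case (Cons j i)
  have "degree (line_poly z w (j # i)) \<le> degree [:z j, w j:] + degree (line_poly z w i)"
    unfolding line_poly_simps by (rule degree_mult_le)
  also have "\<dots> \<le> 1 + length i" using Cons by (intro add_mono) auto
  finally show ?case by simp
qed simp

lemma coeff_line_poly_0: "coeff (line_poly z w i) 0 = word_monom z i"
  by (induction i) (simp_all add: word_monom_def coeff_mult)

lemma coeff_line_poly_length: "coeff (line_poly z w i) (length i) = word_monom w i"
proof (induction i)
  case (Cons j i)
  have "coeff (line_poly z w i) (Suc (length i)) = 0"
    using degree_line_poly[of z w i] by (intro coeff_eq_0) simp
  then show ?case using Cons by (simp add: word_monom_def)
qed (simp add: word_monom_def)

text \<open>Keeping the restriction to a line as a polynomial gives access to its coefficients: the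
  first is a derivative, the top one serves to isolate a pure power.\<close>

definition restrict_line :: "nat \<Rightarrow> nat \<Rightarrow> (nat multiset \<Rightarrow> complex) \<Rightarrow> (nat \<Rightarrow> complex) \<Rightarrow> (nat \<Rightarrow> complex) \<Rightarrow> complex poly" where
  "restrict_line n m t z w = (\<Sum>i\<in>words {..<n} m. Polynomial.smult (t (mset i)) (line_poly z w i))"

lemma coeff_restrict_line:
  "coeff (restrict_line n m t z w) k = (\<Sum>i\<in>words {..<n} m. t (mset i) * coeff (line_poly z w i) k)"
  by (simp add: restrict_line_def coeff_sum)

lemma poly_restrict_line: "poly (restrict_line n m t z w) x = form n m t (\<lambda>j. z j + x * w j)"
  by (simp add: restrict_line_def poly_sum poly_line_poly form_def)

lemma form_line_eq_sum:
  "form n m t (\<lambda>j. z j + x * w j) = (\<Sum>k\<le>m. coeff (restrict_line n m t z w) k * x ^ k)"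
proof -
  have deg: "degree (restrict_line n m t z w) \<le> m"
    unfolding restrict_line_def
    by (intro degree_sum_le) (auto intro!: order_trans[OF degree_smult_le] order_trans[OF degree_line_poly] simp: length_words)
  then show ?thesis
    unfolding poly_restrict_line[symmetric] poly_altdef
    by (intro sum.mono_neutral_left) (auto simp: coeff_eq_0)
qed

text \<open>This is the product rule at the first letter: it contributes either \<open>w j\<close>,
  or \<open>z j\<close> while the derivative falls on the rest. By symmetry all positions contribute
  alike, so slices are partial derivatives divided by the degree.\<close>

lemma coeff_restrict_line_1:
  "coeff (restrict_line n (Suc m) t z w) 1 = of_nat (Suc m) * (\<Sum>j<n. w j * form n m (slice j t) z)"
proof (induction m arbitrary: t)
  case 0
  show ?case
    by (simp add: coeff_restrict_line sum_words_Suc form_def word_monom_def mult.commute)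
next
  case (Suc m)
  have step: "coeff (restrict_line n (Suc (Suc m)) t z w) 1
      = (\<Sum>j<n. z j * coeff (restrict_line n (Suc m) (slice j t) z w) 1) + (\<Sum>j<n. w j * form n (Suc m) (slice j t) z)"
    unfolding coeff_restrict_line sum_words_Suc[of _ "{..<n}" "Suc m"] sum.distrib[symmetric]
    by (rule sum.cong[OF refl])
       (simp add: form_def coeff_line_poly_0 sum_distrib_left sum.distrib[symmetric] algebra_simps)
  have "(\<Sum>j<n. z j * coeff (restrict_line n (Suc m) (slice j t) z w) 1)
      = (\<Sum>j<n. \<Sum>k<n. of_nat (Suc m) * (w k * (z j * form n m (slice k (slice j t)) z)))"
    unfolding Suc.IH by (simp add: sum_distrib_left mult_ac del: of_nat_Suc)
  also have "\<dots> = of_nat (Suc m) * (\<Sum>k<n. w k * (\<Sum>j<n. z j * form n m (slice j (slice k t)) z))"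
    by (subst sum.swap) (simp add: sum_distrib_left add_mset_commute del: of_nat_Suc)
  also have "\<dots> = of_nat (Suc m) * (\<Sum>k<n. w k * form n (Suc m) (slice k t) z)"
    by (simp add: form_def sum_words_Suc sum_distrib_left word_monom_def mult_ac add_mset_commute del: of_nat_Suc)
  finally show ?case unfolding step by (simp add: algebra_simps)
qed

text \<open>Each of the \<open>Suc m\<close> positions contributes the same amount, since
  \<open>A\<close> depends only on the multiset of the word.\<close>

lemma sum_words_sum_list:
  fixes A :: "nat multiset \<Rightarrow> real" and g :: "nat \<Rightarrow> real"
  shows "(\<Sum>i\<in>words {..<n} (Suc m). A (mset i) * (\<Sum>j\<leftarrow>i. g j))
    = real (Suc m) * (\<Sum>j<n. g j * (\<Sum>i\<in>words {..<n} m. A (add_mset j (mset i))))"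
proof (induction m arbitrary: A)
  case 0
  show ?case by (simp add: sum_words_Suc mult.commute)
next
  case (Suc m)
  have "(\<Sum>i\<in>words {..<n} (Suc (Suc m)). A (mset i) * (\<Sum>j\<leftarrow>i. g j))
      = (\<Sum>j<n. g j * (\<Sum>i\<in>words {..<n} (Suc m). A (add_mset j (mset i))))
        + (\<Sum>j<n. \<Sum>i\<in>words {..<n} (Suc m). A (add_mset j (mset i)) * (\<Sum>k\<leftarrow>i. g k))"
    unfolding sum_words_Suc[of _ "{..<n}" "Suc m"] sum.distrib[symmetric]
    by (rule sum.cong[OF refl]) (simp add: sum_distrib_left sum.distrib[symmetric] algebra_simps)
  also have "(\<Sum>j<n. \<Sum>i\<in>words {..<n} (Suc m). A (add_mset j (mset i)) * (\<Sum>k\<leftarrow>i. g k))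
      = (\<Sum>j<n. real (Suc m) * (\<Sum>k<n. g k * (\<Sum>i\<in>words {..<n} m. A (add_mset j (add_mset k (mset i))))))"
    by (intro sum.cong refl Suc.IH)
  also have "\<dots> = (\<Sum>k<n. real (Suc m) * (g k * (\<Sum>j<n. \<Sum>i\<in>words {..<n} m. A (add_mset k (add_mset j (mset i))))))"
    by (simp only: sum_distrib_left, subst sum.swap) (simp add: add_mset_commute)
  also have "\<dots> = real (Suc m) * (\<Sum>k<n. g k * (\<Sum>i\<in>words {..<n} (Suc m). A (add_mset k (mset i))))"
    by (simp add: sum_words_Suc sum_distrib_left)
  finally show ?case by (simp add: algebra_simps)
qed

lemma form_scale: "form n m t (\<lambda>j. x * z j) = x ^ m * form n m t z"
proof -
  have "word_monom (\<lambda>j. x * z j) i = x ^ length i * word_monom z i" for i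
    by (induction i) (simp_all add: word_monom_def)
  then show ?thesis by (simp add: form_def length_words sum_distrib_left mult_ac)
qed

section \<open>Cauchy estimates for sums of slices\<close>

lemma one_plus_inverse_power_le_3: "(1 + 1 / real m) ^ m \<le> 3"
proof (cases "m = 0")
  case False
  have "(1 + 1 / real m) ^ m \<le> exp (1 / real m) ^ m"
    by (intro power_mono) (auto simp: exp_ge_add_one_self)
  also have "\<dots> = exp 1" using False by (simp add: exp_of_nat_mult[symmetric])
  also have "\<dots> \<le> 3" by (rule exp_le)
  finally show ?thesis .
qed simp

text \<open>
  Cauchy's estimate for the derivative in direction \<open>w\<close>, on a circle of radius \<open>1 / m\<close>.
\<close>

lemma sum_slices_le:
  assumes b: "bounded_form n (Suc m) t B" and z: "\<And>j. j < n \<Longrightarrow> cmod (z j) \<le> 1"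
  shows "(\<Sum>j<n. cmod (form n m (slice j t) z)) \<le> 3 * B"
proof -
  have "\<exists>u. cmod u \<le> 1 \<and> u * form n m (slice j t) z = of_real (cmod (form n m (slice j t) z))" for j
    by (rule sgn_pair[of "form n m (slice j t) z" 0]) (metis order_refl)
  then obtain w where w: "\<And>j. cmod (w j) \<le> 1"
    "\<And>j. w j * form n m (slice j t) z = of_real (cmod (form n m (slice j t) z))" by metis
  let ?M = "real (Suc m)"
  \<comment> \<open>The radius \<open>1 / Suc m\<close> cancels the factor \<open>Suc m\<close> of
    the derivative, and enlarging the polydisc costs only
    \<open>(1 + 1 / Suc m) ^ Suc m <= 3\<close>.\<close>
  define c where "c k = coeff (restrict_line n (Suc m) t z w) k * (1 / of_nat (Suc m)) ^ k" for k
  have bound: "cmod (\<Sum>k\<le>Suc m. c k * x ^ k) \<le> 3 * B" if x: "cmod x = 1" for x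
  proof -
    define r where "r = 1 + 1 / ?M"
    have r: "r > 0" by (simp add: r_def add_pos_nonneg)
    define y where "y j = (z j + (x / of_nat (Suc m)) * w j) / of_real r" for j
    have y1: "cmod (y j) \<le> 1" if "j < n" for j
    proof -
      have "cmod (z j + (x / of_nat (Suc m)) * w j) \<le> 1 + 1 / ?M * 1"
        using norm_triangle_ineq[of "z j" "(x / of_nat (Suc m)) * w j"] z[OF that] w(1)[of j] x
          mult_left_mono[OF w(1)[of j], of "1 / ?M"]
        by (simp add: norm_mult norm_divide del: of_nat_Suc)
      then have "cmod (z j + (x / of_nat (Suc m)) * w j) \<le> r" by (simp only: r_def mult_1_right)
      then show ?thesis using r by (simp add: y_def norm_divide del: of_nat_Suc)
    qed
    have "(\<Sum>k\<le>Suc m. c k * x ^ k) = form n (Suc m) t (\<lambda>j. z j + (x / of_nat (Suc m)) * w j)"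
      unfolding form_line_eq_sum c_def by (simp add: power_divide del: of_nat_Suc sum.atMost_Suc)
    also have "\<dots> = form n (Suc m) t (\<lambda>j. of_real r * y j)"
      using r by (simp add: y_def del: of_nat_Suc)
    also have "cmod \<dots> = r ^ Suc m * cmod (form n (Suc m) t y)"
      using r unfolding form_scale by (simp add: norm_mult norm_power)
    also have "\<dots> \<le> 3 * B"
      using one_plus_inverse_power_le_3[of "Suc m"] bounded_formD[OF b y1] r bounded_form_nonneg[OF b]
      unfolding r_def by (intro mult_mono) auto
    finally show ?thesis .
  qed
  have "c 1 = of_real (\<Sum>j<n. cmod (form n m (slice j t) z))"
    using coeff_restrict_line_1[of n m t z w] w(2) by (simp add: c_def del: of_nat_Suc)
  moreover have "cmod (c 1) \<le> 3 * B"
    by (rule coeff_le_of_circle_bound[OF bound]) auto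
  ultimately show ?thesis by (simp add: sum_nonneg del: of_real_sum)
qed

text \<open>Each column is dominated by the mean of \<open>|form n m (slice j t)|\<close> at the
  cost of \<open>sqrt \<rho>\<close>; the sum over \<open>j\<close> then moves inside the mean,
  where it is at most \<open>3 * B\<close> at every point. \<open>Q\<close> looks at the multiset of
  the whole word, so that the selected array is again symmetric.\<close>

lemma sum_sqrt_slices_le:
  assumes b: "bounded_form n (Suc m) t B" and \<rho>: "\<rho> \<ge> 0"
    and Q: "\<And>j i. j < n \<Longrightarrow> i \<in> words {..<n} m \<Longrightarrow> Q (add_mset j (mset i)) \<Longrightarrow>
      (\<Prod>l<n. weight (count_list i l)) \<le> \<rho> * real (arrangements i)"
  shows "(\<Sum>j<n. sqrt (\<Sum>i\<in>words {..<n} m. if Q (add_mset j (mset i)) then (cmod (t (add_mset j (mset i))))\<^sup>2 else 0))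
    \<le> 6 * sqrt \<rho> * B"
proof -
  \<comment> \<open>\<open>K\<close> may depend on \<open>n\<close>: it only refines the grid of
    roots of unity, and the final bound retains just the factor 2.\<close>
  have "(\<lambda>K. mean_bound K ^ n) \<longlonglongrightarrow> (1 + 0) ^ n"
    unfolding mean_bound_def by (intro tendsto_intros) real_asymp
  then have "eventually (\<lambda>K. mean_bound K ^ n < 2) sequentially"
    by (rule order_tendstoD) simp
  then obtain K where K: "mean_bound K ^ n < 2" by (auto simp: eventually_sequentially)
  define N where "N = Suc (m * (K + 2))"
  have N: "N > m * (K + 2)" "N > 0" by (simp_all add: N_def)
  let ?U = "words (unity N) n"
  have "(\<Sum>j<n. sqrt (\<Sum>i\<in>words {..<n} m. if Q (add_mset j (mset i)) then (cmod (t (add_mset j (mset i))))\<^sup>2 else 0))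
      \<le> (\<Sum>j<n. sqrt \<rho> * ((mean_bound K / real N) ^ n * (\<Sum>z\<in>?U. cmod (form n m (slice j t) ((!) z)))))"
  proof (rule sum_mono)
    fix j assume j: "j \<in> {..<n}"
    let ?W = "\<lambda>i. \<Prod>l<n. weight (count_list i l)"
    have "(\<Sum>i\<in>words {..<n} m. if Q (add_mset j (mset i)) then (cmod (t (add_mset j (mset i))))\<^sup>2 else 0)
        \<le> (\<Sum>i\<in>words {..<n} m. \<rho> * (real (arrangements i) * (cmod (t (add_mset j (mset i))))\<^sup>2 / ?W i))"
    proof (rule sum_mono)
      fix i assume i: "i \<in> words {..<n} m"
      have W: "?W i > 0" by (intro prod_pos) simp
      show "(if Q (add_mset j (mset i)) then (cmod (t (add_mset j (mset i))))\<^sup>2 else 0)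
          \<le> \<rho> * (real (arrangements i) * (cmod (t (add_mset j (mset i))))\<^sup>2 / ?W i)"
      proof (cases "Q (add_mset j (mset i))")
        case True
        then have "(cmod (t (add_mset j (mset i))))\<^sup>2 * ?W i
            \<le> (cmod (t (add_mset j (mset i))))\<^sup>2 * (\<rho> * real (arrangements i))"
          using Q[OF _ i] j by (intro mult_left_mono) auto
        then show ?thesis using True W by (simp add: field_simps)
      next
        case False
        then show ?thesis using W \<rho> by simp
      qed
    qed
    then have "sqrt (\<Sum>i\<in>words {..<n} m. if Q (add_mset j (mset i)) then (cmod (t (add_mset j (mset i))))\<^sup>2 else 0)
        \<le> sqrt \<rho> * sqrt (\<Sum>i\<in>words {..<n} m. real (arrangements i) * (cmod (t (add_mset j (mset i))))\<^sup>2 / ?W i)"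
      unfolding real_sqrt_mult[symmetric] sum_distrib_left[symmetric] by (rule real_sqrt_le_mono)
    also have "\<dots> \<le> sqrt \<rho> * ((mean_bound K / real N) ^ n * (\<Sum>z\<in>?U. cmod (form n m (slice j t) ((!) z))))"
      using \<rho> by (intro mult_left_mono weighted_coeffs_le_mean_abs_form[OF N(1)]) auto
    finally show "sqrt (\<Sum>i\<in>words {..<n} m. if Q (add_mset j (mset i)) then (cmod (t (add_mset j (mset i))))\<^sup>2 else 0)
        \<le> sqrt \<rho> * ((mean_bound K / real N) ^ n * (\<Sum>z\<in>?U. cmod (form n m (slice j t) ((!) z))))" .
  qed
  also have "\<dots> = sqrt \<rho> * ((mean_bound K / real N) ^ n * (\<Sum>z\<in>?U. \<Sum>j<n. cmod (form n m (slice j t) ((!) z))))"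
    by (simp only: sum_distrib_left[symmetric]) (subst sum.swap, rule refl)
  also have "\<dots> \<le> sqrt \<rho> * ((mean_bound K / real N) ^ n * (\<Sum>z\<in>?U. 3 * B))"
    using \<rho> mean_bound_ge_1[of K] norm_unity[OF N(2)]
    by (intro mult_left_mono sum_mono sum_slices_le[OF b]) (auto simp: nth_words)
  also have "\<dots> = sqrt \<rho> * (mean_bound K ^ n * (3 * B))"
    using N(2) by (simp add: card_words power_divide)
  also have "\<dots> \<le> sqrt \<rho> * (2 * (3 * B))"
    using K \<rho> bounded_form_nonneg[OF b] by (intro mult_left_mono mult_right_mono) auto
  finally show ?thesis by simp
qed

subsection \<open>Mixed norms\<close>

lemma Holder_sum_powr:
  fixes f g :: "'a \<Rightarrow> real"
  assumes fin: "finite X" and f: "\<And>i. i \<in> X \<Longrightarrow> f i \<ge> 0" and g: "\<And>i. i \<in> X \<Longrightarrow> g i \<ge> 0"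
    and ab: "a > 0" "b > 0" "a + b = 1"
  shows "(\<Sum>i\<in>X. f i powr a * g i powr b) \<le> (\<Sum>i\<in>X. f i) powr a * (\<Sum>i\<in>X. g i) powr b"
proof -
  define F where "F = (\<Sum>i\<in>X. f i)"
  define G where "G = (\<Sum>i\<in>X. g i)"
  have FG: "F \<ge> 0" "G \<ge> 0" using f g by (simp_all add: F_def G_def sum_nonneg)
  show ?thesis
  proof (cases "F = 0 \<or> G = 0")
    case True
    then have "\<forall>i\<in>X. f i = 0 \<or> g i = 0"
      using sum_nonneg_eq_0_iff[OF fin, of f] sum_nonneg_eq_0_iff[OF fin, of g] f g
      unfolding F_def G_def by blast
    then have "f i powr a * g i powr b = 0" if "i \<in> X" for i using that by auto
    then have "(\<Sum>i\<in>X. f i powr a * g i powr b) = 0" by (intro sum.neutral) blast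
    then show ?thesis by simp
  next
    case False
    then have pos: "F > 0" "G > 0" using FG by auto
    have "f i powr a * g i powr b \<le> F powr a * G powr b * (a * (f i / F) + b * (g i / G))" if "i \<in> X" for i
    proof (cases "f i = 0 \<or> g i = 0")
      case True
      then show ?thesis using ab f[OF that] g[OF that] pos by (auto intro!: mult_nonneg_nonneg add_nonneg_nonneg)
    next
      case False
      then have "f i / F > 0" "g i / G > 0" using f[OF that] g[OF that] pos by (auto simp: less_le)
      then have "(f i / F) powr a * (g i / G) powr b \<le> a * (f i / F) + b * (g i / G)"
        using ab by (intro Youngs_inequality_0) auto
      then have "F powr a * G powr b * ((f i / F) powr a * (g i / G) powr b)
          \<le> F powr a * G powr b * (a * (f i / F) + b * (g i / G))"
        by (intro mult_left_mono) auto
      moreover have "F powr a * G powr b * ((f i / F) powr a * (g i / G) powr b) = f i powr a * g i powr b"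
        using pos f[OF that] g[OF that] by (simp add: powr_divide)
      ultimately show ?thesis by simp
    qed
    then have "(\<Sum>i\<in>X. f i powr a * g i powr b)
        \<le> (\<Sum>i\<in>X. F powr a * G powr b * (a * (f i / F) + b * (g i / G)))"
      by (rule sum_mono)
    also have "\<dots> = F powr a * G powr b * (a * (F / F) + b * (G / G))"
      by (simp add: sum_distrib_left[symmetric] sum.distrib sum_divide_distrib[symmetric] F_def G_def)
    also have "\<dots> = F powr a * G powr b" using pos ab by simp
    finally show ?thesis by (simp add: F_def G_def)
  qed
qed

lemma sum_words_prod_list:
  fixes u :: "'a \<Rightarrow> real"
  shows "(\<Sum>i\<in>words A m. \<Prod>j\<leftarrow>i. u j) = (\<Sum>j\<in>A. u j) ^ m"
  by (induction m) (simp_all add: sum_words_Suc sum_distrib_left[symmetric] sum_distrib_right[symmetric])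

definition mixed_col :: "nat \<Rightarrow> nat \<Rightarrow> (nat multiset \<Rightarrow> real) \<Rightarrow> nat \<Rightarrow> real" where
  "mixed_col n m A j = sqrt (\<Sum>i\<in>words {..<n} m. (A (add_mset j (mset i)))\<^sup>2)"

text \<open>For a symmetric array every position of the distinguished index gives the same value, so
  one number stands for all the mixed norms in Blei's inequality.\<close>

definition mixed_norm :: "nat \<Rightarrow> nat \<Rightarrow> (nat multiset \<Rightarrow> real) \<Rightarrow> real" where
  "mixed_norm n m A = (\<Sum>j<n. mixed_col n m A j)"

lemma mixed_col_nonneg: "mixed_col n m A j \<ge> 0"
  by (simp add: mixed_col_def sum_nonneg)

lemma entry_le_mixed_col:
  assumes "i \<in> words {..<n} (Suc m)" "j \<in> set i" "A (mset i) \<ge> 0"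
  shows "A (mset i) \<le> mixed_col n m A j"
proof -
  define i' where "i' = remove1 j i"
  have i': "i' \<in> words {..<n} m" "mset i = add_mset j (mset i')"
    using assms set_remove1_subset[of j i] by (auto simp: i'_def words_def length_remove1)
  have "(A (mset i))\<^sup>2 \<le> (\<Sum>i\<in>words {..<n} m. (A (add_mset j (mset i)))\<^sup>2)"
    unfolding i'(2) by (rule member_le_sum[OF i'(1)]) auto
  then have "sqrt ((A (mset i))\<^sup>2) \<le> mixed_col n m A j"
    unfolding mixed_col_def by (rule real_sqrt_le_mono)
  then show ?thesis using assms by simp
qed

text \<open>
  With \<open>u\<close> the normalised column norms, the mean \<open>c i\<close> of the \<open>1 / u\<^sub>j\<close> over the entries \<open>j\<close> of \<open>i\<close>
  satisfies \<open>\<Sum> A\<^sup>2 c = S\<^sup>2\<close>, because by symmetry every position contributes \<open>\<Sum>\<^sub>j N\<^sub>j\<^sup>2 / u\<^sub>j = S \<Sum>\<^sub>j N\<^sub>j\<close>.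
\<close>

lemma mixed_norm_weights:
  fixes A :: "nat multiset \<Rightarrow> real"
  assumes A: "\<And>B. A B \<ge> 0" and S: "mixed_norm n m A > 0" and M: "M = Suc m"
  obtains u :: "nat \<Rightarrow> real" and c :: "nat list \<Rightarrow> real" where
    "\<And>j. u j \<ge> 0" "(\<Sum>j<n. u j) = 1" "\<And>i. c i \<ge> 0"
    "(\<Sum>i\<in>words {..<n} M. (A (mset i))\<^sup>2 * c i) = (mixed_norm n m A)\<^sup>2"
    "\<And>i. i \<in> words {..<n} M \<Longrightarrow> A (mset i) > 0 \<Longrightarrow> c i > 0"
    "\<And>i. i \<in> words {..<n} M \<Longrightarrow> A (mset i) > 0 \<Longrightarrow> (1 / c i) ^ M \<le> (\<Prod>j\<leftarrow>i. u j)"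
    "\<And>i j. i \<in> words {..<n} M \<Longrightarrow> A (mset i) > 0 \<Longrightarrow> j \<in> set i \<Longrightarrow> 1 / c i \<le> real M * u j"
proof -
  define S where "S = mixed_norm n m A"
  define u where "u j = mixed_col n m A j / S" for j
  define c where "c i = (\<Sum>j\<leftarrow>i. 1 / u j) / real (Suc m)" for i
  have S0: "S > 0" using S by (simp add: S_def)
  have u0: "u j \<ge> 0" for j using S0 mixed_col_nonneg by (simp add: u_def)
  have "(\<Sum>j<n. u j) = 1"
    using S0 by (simp add: u_def sum_divide_distrib[symmetric] S_def mixed_norm_def)
  moreover have c0: "c i \<ge> 0" for i
    unfolding c_def using u0 by (intro divide_nonneg_nonneg sum_list_nonneg) auto
  moreover have "(\<Sum>i\<in>words {..<n} (Suc m). (A (mset i))\<^sup>2 * c i) = (mixed_norm n m A)\<^sup>2"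
  proof -
    have "(\<Sum>i\<in>words {..<n} (Suc m). (A (mset i))\<^sup>2 * c i)
        = (\<Sum>i\<in>words {..<n} (Suc m). (A (mset i))\<^sup>2 * (\<Sum>j\<leftarrow>i. 1 / u j)) / real (Suc m)"
      by (simp add: c_def sum_divide_distrib del: of_nat_Suc)
    also have "\<dots> = (\<Sum>j<n. 1 / u j * (\<Sum>i\<in>words {..<n} m. (A (add_mset j (mset i)))\<^sup>2))"
      by (subst sum_words_sum_list) (simp del: of_nat_Suc)
    also have "\<dots> = (\<Sum>j<n. S * mixed_col n m A j)"
    proof (rule sum.cong[OF refl])
      fix j
      have "(\<Sum>i\<in>words {..<n} m. (A (add_mset j (mset i)))\<^sup>2) = (mixed_col n m A j)\<^sup>2"
        by (simp add: mixed_col_def sum_nonneg)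
      \<comment> \<open>If column \<open>j\<close> vanishes, so does \<open>u j\<close>, and the
        convention \<open>1 / 0 = 0\<close> makes both sides 0.\<close>
      then show "1 / u j * (\<Sum>i\<in>words {..<n} m. (A (add_mset j (mset i)))\<^sup>2) = S * mixed_col n m A j"
        by (simp add: u_def power2_eq_square)
    qed
    also have "\<dots> = S\<^sup>2" by (simp add: sum_distrib_left[symmetric] S_def mixed_norm_def power2_eq_square)
    finally show ?thesis by (simp add: S_def)
  qed
  moreover have props: "c i > 0 \<and> (1 / c i) ^ Suc m \<le> (\<Prod>j\<leftarrow>i. u j) \<and> (\<forall>j\<in>set i. 1 / c i \<le> real (Suc m) * u j)"
    if i: "i \<in> words {..<n} (Suc m)" and Ai: "A (mset i) > 0" for i
  proof -
    have upos: "u j > 0" if "j \<in> set i" for j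
      using entry_le_mixed_col[OF i that, of A] Ai S0 by (simp add: u_def)
    have le: "1 / u j \<le> real (Suc m) * c i" if "j \<in> set i" for j
    proof -
      have "1 / u j \<le> (\<Sum>j\<leftarrow>i. 1 / u j)"
        using that upos by (intro member_le_sum_list) (auto intro: less_imp_le)
      then show ?thesis by (simp add: c_def)
    qed
    obtain j where j: "j \<in> set i" using i by (cases i) (auto simp: words_def)
    have "0 < 1 / u j" using upos[OF j] by simp
    also have "\<dots> \<le> real (Suc m) * c i" by (rule le[OF j])
    finally have cpos: "c i > 0" by (simp add: zero_less_mult_iff)
    \<comment> \<open>\<open>1 / c i\<close> is the harmonic mean of the \<open>u j\<close> along
      \<open>i\<close>, hence at most their geometric mean. All of them are positive because
      \<open>A (mset i) > 0\<close>.\<close>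
    have "(\<Prod>k<Suc m. 1 / u (i ! k)) powr (1 / real (Suc m)) \<le> (\<Sum>k<Suc m. 1 / u (i ! k) / real (Suc m))"
      using arith_geom_mean[of "{..<Suc m}" "\<lambda>k. 1 / u (i ! k)"] u0
      by (simp add: lessThan_empty_iff del: prod.lessThan_Suc sum.lessThan_Suc of_nat_Suc)
    also have "\<dots> = c i"
      unfolding c_def sum_divide_distrib[symmetric] using length_words[OF i]
      by (simp add: sum_list_sum_nth atLeast0LessThan del: sum.lessThan_Suc of_nat_Suc)
    finally have "((\<Prod>k<Suc m. 1 / u (i ! k)) powr (1 / real (Suc m))) ^ Suc m \<le> c i ^ Suc m"
      by (intro power_mono) auto
    moreover have ppos: "(\<Prod>k<Suc m. u (i ! k)) > 0"
      using upos length_words[OF i] by (intro prod_pos) auto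
    moreover have "(\<Prod>k<Suc m. 1 / u (i ! k)) = 1 / (\<Prod>k<Suc m. u (i ! k))"
      by (simp add: prod_dividef del: prod.lessThan_Suc)
    moreover have "(x powr (1 / real (Suc m))) ^ Suc m = x" if "x > 0" for x
      using that by (simp add: powr_realpow[symmetric] powr_powr del: power_Suc of_nat_Suc)
    ultimately have "1 / (\<Prod>k<Suc m. u (i ! k)) \<le> c i ^ Suc m"
      by (simp del: prod.lessThan_Suc power_Suc of_nat_Suc)
    then have "1 / c i ^ Suc m \<le> (\<Prod>k<Suc m. u (i ! k))"
      using ppos cpos by (simp add: field_simps del: prod.lessThan_Suc power_Suc)
    also have "\<dots> = (\<Prod>j\<leftarrow>i. u j)"
      using length_words[OF i] by (simp add: prod.list_conv_set_nth atLeast0LessThan del: prod.lessThan_Suc)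
    finally have "(1 / c i) ^ Suc m \<le> (\<Prod>j\<leftarrow>i. u j)" by (simp add: power_one_over del: power_Suc)
    moreover have "1 / c i \<le> real (Suc m) * u j" if "j \<in> set i" for j
      using le[OF that] upos[OF that] cpos by (simp add: field_simps del: of_nat_Suc)
    ultimately show ?thesis using cpos by blast
  qed
  ultimately show ?thesis using that[of u c] u0 unfolding M by blast
qed

lemma entries_zero_of_mixed_norm:
  assumes A: "\<And>B. A B \<ge> (0::real)" and S: "\<not> mixed_norm n m A > 0" and i: "i \<in> words {..<n} (Suc m)"
  shows "A (mset i) = 0"
proof -
  obtain j where j: "j \<in> set i" using i by (cases i) (auto simp: words_def)
  then have jn: "j < n" using i by (auto simp: words_def)
  have "mixed_col n m A j \<le> mixed_norm n m A"
    unfolding mixed_norm_def using jn by (intro member_le_sum) (auto simp: mixed_col_nonneg)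
  then show ?thesis using entry_le_mixed_col[OF i j, where A = A] A[of "mset i"] S by linarith
qed

lemma mixed_norm_nonneg: "mixed_norm n m A \<ge> 0"
  by (simp add: mixed_norm_def sum_nonneg mixed_col_nonneg)

text \<open>Blei's inequality for symmetric arrays. With \<open>e = M/(M+1)\<close> an entry splits
  as \<open>A^(2e) = (A^2 c)^e ((1/c)^M)^(1/(M+1))\<close>; in Hoelder's inequality the second sum
  is at most \<open>\<Sum> \<Prod> u = (\<Sum> u)^M = 1\<close>.\<close>

lemma sum_powr_le_mixed_norm:
  fixes A :: "nat multiset \<Rightarrow> real"
  assumes A: "\<And>B. A B \<ge> 0" and M: "M = Suc m"
  shows "(\<Sum>i\<in>words {..<n} M. A (mset i) powr (2 * real M / (real M + 1)))
    \<le> ((mixed_norm n m A)\<^sup>2) powr (real M / (real M + 1))"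
proof (cases "mixed_norm n m A > 0")
  case False
  then have "(\<Sum>i\<in>words {..<n} M. A (mset i) powr (2 * real M / (real M + 1))) = 0"
    using entries_zero_of_mixed_norm[OF A False] M by (intro sum.neutral) auto
  then show ?thesis by simp
next
  case True
  obtain u c where uc:
    "\<And>j. u j \<ge> 0" "(\<Sum>j<n. u j) = 1" "\<And>i. c i \<ge> 0"
    "(\<Sum>i\<in>words {..<n} M. (A (mset i))\<^sup>2 * c i) = (mixed_norm n m A)\<^sup>2"
    "\<And>i. i \<in> words {..<n} M \<Longrightarrow> A (mset i) > 0 \<Longrightarrow> c i > 0"
    "\<And>i. i \<in> words {..<n} M \<Longrightarrow> A (mset i) > 0 \<Longrightarrow> (1 / c i) ^ M \<le> (\<Prod>j\<leftarrow>i. u j)"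
    "\<And>i j. i \<in> words {..<n} M \<Longrightarrow> A (mset i) > 0 \<Longrightarrow> j \<in> set i \<Longrightarrow> 1 / c i \<le> real M * u j"
    by (rule mixed_norm_weights[OF A True M]) (rule that; assumption)
  define e where "e = real M / (real M + 1)"
  have e: "e > 0" "1 / (real M + 1) > 0" "e + 1 / (real M + 1) = 1"
    using M by (simp_all add: e_def field_simps)
  define X where "X = {i \<in> words {..<n} M. A (mset i) > 0}"
  have fX: "finite X" by (simp add: X_def)
  have pw: "A (mset i) powr (2 * real M / (real M + 1))
      = ((A (mset i))\<^sup>2 * c i) powr e * ((1 / c i) ^ M) powr (1 / (real M + 1))" if "i \<in> X" for i
  proof -
    have pos: "A (mset i) > 0" "c i > 0" using that uc by (auto simp: X_def)
    have "((1 / c i) ^ M) powr (1 / (real M + 1)) = (1 / c i) powr e"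
      using pos by (simp add: powr_realpow[symmetric] powr_powr e_def)
    moreover have "((A (mset i))\<^sup>2 * c i) powr e = A (mset i) powr (2 * e) * c i powr e"
      using pos by (simp add: powr_mult powr_powr flip: powr_numeral)
    ultimately show ?thesis using pos by (simp add: powr_divide e_def)
  qed
  have "(\<Sum>i\<in>words {..<n} M. A (mset i) powr (2 * real M / (real M + 1)))
      = (\<Sum>i\<in>X. A (mset i) powr (2 * real M / (real M + 1)))"
    using A by (intro sum.mono_neutral_right) (auto simp: X_def order.strict_iff_order)
  also have "\<dots> = (\<Sum>i\<in>X. ((A (mset i))\<^sup>2 * c i) powr e * ((1 / c i) ^ M) powr (1 / (real M + 1)))"
    by (rule sum.cong[OF refl pw])
  also have "\<dots> \<le> (\<Sum>i\<in>X. (A (mset i))\<^sup>2 * c i) powr e * (\<Sum>i\<in>X. (1 / c i) ^ M) powr (1 / (real M + 1))"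
    using e uc(3) by (intro Holder_sum_powr fX) auto
  also have "\<dots> \<le> ((mixed_norm n m A)\<^sup>2) powr e * 1 powr (1 / (real M + 1))"
  proof (intro mult_mono powr_mono2)
    show "(\<Sum>i\<in>X. (A (mset i))\<^sup>2 * c i) \<le> (mixed_norm n m A)\<^sup>2"
      unfolding uc(4)[symmetric] using uc(3) by (intro sum_mono2) (auto simp: X_def)
    have "(\<Sum>i\<in>X. (1 / c i) ^ M) \<le> (\<Sum>i\<in>X. \<Prod>j\<leftarrow>i. u j)"
      by (rule sum_mono) (use uc(6) in \<open>auto simp: X_def\<close>)
    also have "\<dots> \<le> (\<Sum>i\<in>words {..<n} M. \<Prod>j\<leftarrow>i. u j)"
      using uc(1) by (intro sum_mono2) (auto simp: X_def intro!: prod_list_nonneg)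
    also have "\<dots> = 1" by (simp add: sum_words_prod_list uc(2))
    finally show "(\<Sum>i\<in>X. (1 / c i) ^ M) \<le> 1" .
  qed (use e uc(3) in \<open>auto intro!: sum_nonneg\<close>)
  finally show ?thesis by (simp add: e_def)
qed

text \<open>Decodes a nearly constant word from its dominant letter, a list of positions that covers
  all exceptions, and the letters found there.\<close>

definition rebuild :: "nat \<Rightarrow> nat \<times> nat list \<times> nat list \<Rightarrow> nat list" where
  "rebuild M = (\<lambda>(l, ps, js). map (\<lambda>k. case map_of (zip ps js) k of None \<Rightarrow> l | Some j \<Rightarrow> j) [0..<M])"

text \<open>The recorded letters are required to occur in \<open>i\<close>, so that the bound
  \<open>1 / c i <= M * u j\<close> will apply to each of them.\<close>

lemma ex_rebuild:
  assumes i: "i \<in> words {..<n} M" and l: "M \<le> count_list i l + q" and M: "M > q"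
  shows "\<exists>\<sigma>\<in>{..<n} \<times> words {..<M} q \<times> words {..<n} q.
    i = rebuild M \<sigma> \<and> fst \<sigma> \<in> set i \<and> set (snd (snd \<sigma>)) \<subseteq> set i"
proof -
  define D where "D = {k. k < M \<and> i ! k \<noteq> l}"
  have fD: "finite D" by (simp add: D_def)
  have len: "length i = M" using i by (rule length_words)
  have "count_list i l = card {k. k < M \<and> i ! k = l}"
    using len by (simp add: count_list_eq_length_filter length_filter_conv_card eq_commute)
  moreover have "{k. k < M \<and> i ! k = l} \<union> D = {..<M}" by (auto simp: D_def)
  then have "card {k. k < M \<and> i ! k = l} + card D = card {..<M}"
    by (subst card_Un_disjoint[symmetric]) (auto simp: D_def)
  ultimately have cD: "card D \<le> q" using l by simp
  \<comment> \<open>Padding with position 0 brings the list to length exactly \<open>q\<close>. It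
    is harmless, because every listed position is stored with its own letter.\<close>
  define ps where "ps = sorted_list_of_set D @ replicate (q - card D) 0"
  have ps: "ps \<in> words {..<M} q" "D \<subseteq> set ps"
    using cD fD M by (auto simp: ps_def words_def D_def)
  define js where "js = map ((!) i) ps"
  have sub: "set js \<subseteq> set i" using ps(1) len by (auto simp: js_def words_def)
  then have js: "js \<in> words {..<n} q" using ps(1) i by (auto simp: js_def words_def)
  have li: "l \<in> set i" using l M by (metis add_0 count_list_0_iff leD)
  have "i = rebuild M (l, ps, js)"
  proof (rule nth_equalityI)
    show "length i = length (rebuild M (l, ps, js))" by (simp add: rebuild_def len)
    fix k assume k: "k < length i"
    then have kM: "k < M" by (simp add: len)
    have "map_of (zip ps js) k = (if k \<in> set ps then Some (i ! k) else None)"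
      unfolding js_def by (simp add: map_of_zip_map)
    then show "i ! k = rebuild M (l, ps, js) ! k"
      using kM ps(2) by (auto simp: rebuild_def D_def)
  qed
  then show ?thesis using ps js li sub i
    by (intro bexI[of _ "(l, ps, js)"]) (auto simp: words_def)
qed

text \<open>
  A word with one letter in all but 7 positions involves at most 8 letters, so a lower power of
  \<open>1 / c\<close> is already summable; the remaining exponent is spent on the plain square sum.
\<close>

lemma sum_powr_shallow_le:
  fixes A :: "nat multiset \<Rightarrow> real"
  assumes A: "\<And>B. A B \<ge> 0" and M: "M = Suc m" "M > 8"
    and X: "X \<subseteq> words {..<n} M" "\<And>i. i \<in> X \<Longrightarrow> \<exists>l. M \<le> count_list i l + 7"
  shows "(\<Sum>i\<in>X. A (mset i) powr (2 * real M / (real M + 1)))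
    \<le> (\<Sum>i\<in>X. (A (mset i))\<^sup>2) powr ((real M - 8) / (real M + 1))
      * ((mixed_norm n m A)\<^sup>2) powr (8 / (real M + 1)) * (real M ^ 15) powr (1 / (real M + 1))"
proof (cases "mixed_norm n m A > 0")
  case False
  then have "(\<Sum>i\<in>X. A (mset i) powr (2 * real M / (real M + 1))) = 0"
    using entries_zero_of_mixed_norm[OF A False] M X by (intro sum.neutral) auto
  then show ?thesis by simp
next
  case True
  obtain u c where uc:
    "\<And>j. u j \<ge> 0" "(\<Sum>j<n. u j) = 1" "\<And>i. c i \<ge> 0"
    "(\<Sum>i\<in>words {..<n} M. (A (mset i))\<^sup>2 * c i) = (mixed_norm n m A)\<^sup>2"
    "\<And>i. i \<in> words {..<n} M \<Longrightarrow> A (mset i) > 0 \<Longrightarrow> c i > 0"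
    "\<And>i. i \<in> words {..<n} M \<Longrightarrow> A (mset i) > 0 \<Longrightarrow> (1 / c i) ^ M \<le> (\<Prod>j\<leftarrow>i. u j)"
    "\<And>i j. i \<in> words {..<n} M \<Longrightarrow> A (mset i) > 0 \<Longrightarrow> j \<in> set i \<Longrightarrow> 1 / c i \<le> real M * u j"
    by (rule mixed_norm_weights[OF A True M(1)]) (rule that; assumption)
  define R where "R = real M + 1"
  have R: "R > 9" using M by (simp add: R_def)
  define Y where "Y = {i \<in> X. A (mset i) > 0}"
  have YW: "Y \<subseteq> words {..<n} M" and fX: "finite X"
    using X finite_subset[OF X(1)] by (auto simp: Y_def)
  then have fY: "finite Y" by (simp add: Y_def)
  \<comment> \<open>Exponents \<open>(M - 8)/R\<close>, \<open>8/R\<close> and \<open>1/R\<close>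
    for \<open>A^2\<close>, \<open>A^2 c\<close> and \<open>(1/c)^8\<close>, realised by two nested
    Hoelder inequalities: the last two factors are first combined with weights \<open>8/9\<close>
    and \<open>1/9\<close>.\<close>
  have pw: "A (mset i) powr (2 * real M / (real M + 1))
      = ((A (mset i))\<^sup>2) powr ((real M - 8) / R)
        * ((((A (mset i))\<^sup>2 * c i) powr (8 / 9) * ((1 / c i) ^ 8) powr (1 / 9)) powr (9 / R))" if "i \<in> Y" for i
  proof -
    have pos: "A (mset i) > 0" "c i > 0" using that uc YW by (auto simp: Y_def)
    have 1: "((1 / c i) ^ 8) powr (1 / 9) = (1 / c i) powr (8 / 9)"
      using pos by (simp add: powr_powr flip: powr_numeral)
    have 2: "((A (mset i))\<^sup>2 * c i) powr (8 / 9) = A (mset i) powr (16 / 9) * c i powr (8 / 9)"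
      using pos by (simp add: powr_mult powr_powr flip: powr_numeral)
    have 3: "((A (mset i))\<^sup>2 * c i) powr (8 / 9) * ((1 / c i) ^ 8) powr (1 / 9) = A (mset i) powr (16 / 9)"
      unfolding 1 2 using pos by (simp add: powr_divide)
    have 4: "((A (mset i))\<^sup>2) powr ((real M - 8) / R) = A (mset i) powr (2 * ((real M - 8) / R))"
      using pos by (simp add: powr_powr flip: powr_numeral)
    have "2 * ((real M - 8) / R) + 16 / 9 * (9 / R) = 2 * real M / (real M + 1)"
      unfolding R_def by (simp add: add_divide_distrib[symmetric] right_diff_distrib)
    then show ?thesis unfolding 3 4 by (simp add: powr_powr powr_add[symmetric])
  qed
  have "(\<Sum>i\<in>X. A (mset i) powr (2 * real M / (real M + 1)))
      = (\<Sum>i\<in>Y. A (mset i) powr (2 * real M / (real M + 1)))"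
    using A fX by (intro sum.mono_neutral_right) (auto simp: Y_def order.strict_iff_order)
  also have "\<dots> = (\<Sum>i\<in>Y. ((A (mset i))\<^sup>2) powr ((real M - 8) / R)
        * ((((A (mset i))\<^sup>2 * c i) powr (8 / 9) * ((1 / c i) ^ 8) powr (1 / 9)) powr (9 / R)))"
    by (rule sum.cong[OF refl pw])
  also have "\<dots> \<le> (\<Sum>i\<in>Y. (A (mset i))\<^sup>2) powr ((real M - 8) / R)
        * (\<Sum>i\<in>Y. ((A (mset i))\<^sup>2 * c i) powr (8 / 9) * ((1 / c i) ^ 8) powr (1 / 9)) powr (9 / R)"
  proof (intro Holder_sum_powr fY)
    show "(real M - 8) / R + 9 / R = 1"
      using R by (simp add: add_divide_distrib[symmetric]) (simp add: R_def)
  qed (use M R uc(3) in auto)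
  also have "\<dots> \<le> (\<Sum>i\<in>X. (A (mset i))\<^sup>2) powr ((real M - 8) / R)
        * (((mixed_norm n m A)\<^sup>2) powr (8 / 9) * (real M ^ 15) powr (1 / 9)) powr (9 / R)"
  proof (intro mult_mono powr_mono2)
    show "(\<Sum>i\<in>Y. (A (mset i))\<^sup>2) \<le> (\<Sum>i\<in>X. (A (mset i))\<^sup>2)"
      using fX by (intro sum_mono2) (auto simp: Y_def)
    have "(\<Sum>i\<in>Y. ((A (mset i))\<^sup>2 * c i) powr (8 / 9) * ((1 / c i) ^ 8) powr (1 / 9))
        \<le> (\<Sum>i\<in>Y. (A (mset i))\<^sup>2 * c i) powr (8 / 9) * (\<Sum>i\<in>Y. (1 / c i) ^ 8) powr (1 / 9)"
      using uc(3) by (intro Holder_sum_powr fY) auto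
    also have "\<dots> \<le> ((mixed_norm n m A)\<^sup>2) powr (8 / 9) * (real M ^ 15) powr (1 / 9)"
    proof (intro mult_mono powr_mono2)
      show "(\<Sum>i\<in>Y. (A (mset i))\<^sup>2 * c i) \<le> (mixed_norm n m A)\<^sup>2"
        unfolding uc(4)[symmetric] using uc(3) YW by (intro sum_mono2) auto
      \<comment> \<open>Encoding \<open>Y\<close> injectively in \<open>T\<close> turns the sum over
        words into a product of sums of \<open>u\<close>. In the exponent 15, the part 8 comes from
        \<open>1 / c i <= M * u j\<close> for the eight recorded letters and the part 7 from the
        choice of positions.\<close>
      define T where "T = {..<n} \<times> words {..<M} 7 \<times> words {..<n} 7"
      have "\<forall>i\<in>Y. \<exists>\<sigma>\<in>T. i = rebuild M \<sigma> \<and> fst \<sigma> \<in> set i \<and> set (snd (snd \<sigma>)) \<subseteq> set i"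
      proof
        fix i assume i: "i \<in> Y"
        then obtain l where "M \<le> count_list i l + 7" using X(2) by (auto simp: Y_def)
        with i YW M show "\<exists>\<sigma>\<in>T. i = rebuild M \<sigma> \<and> fst \<sigma> \<in> set i \<and> set (snd (snd \<sigma>)) \<subseteq> set i"
          unfolding T_def by (intro ex_rebuild) auto
      qed
      then obtain \<sigma> where \<sigma>: "\<And>i. i \<in> Y \<Longrightarrow> \<sigma> i \<in> T" "\<And>i. i \<in> Y \<Longrightarrow> rebuild M (\<sigma> i) = i"
        "\<And>i. i \<in> Y \<Longrightarrow> fst (\<sigma> i) \<in> set i" "\<And>i. i \<in> Y \<Longrightarrow> set (snd (snd (\<sigma> i))) \<subseteq> set i"
        by metis
      have inj: "inj_on \<sigma> Y" by (metis \<sigma>(2) inj_onI)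
      define v where "v \<tau> = u (fst \<tau>) * (\<Prod>j\<leftarrow>snd (snd \<tau>). u j)" for \<tau> :: "nat \<times> nat list \<times> nat list"
      have v0: "v \<tau> \<ge> 0" for \<tau> unfolding v_def using uc(1) by (intro mult_nonneg_nonneg prod_list_nonneg) auto
      have cv: "(1 / c i) ^ 8 \<le> real M ^ 8 * v (\<sigma> i)" if i: "i \<in> Y" for i
      proof -
        have iW: "i \<in> words {..<n} M" and Ai: "A (mset i) > 0" using i YW by (auto simp: Y_def)
        have c0: "1 / c i \<ge> 0" using uc(3) by simp
        have le: "(1 / c i) ^ length js \<le> real M ^ length js * (\<Prod>j\<leftarrow>js. u j)" if "set js \<subseteq> set i" for js
          using that
        proof (induction js)
          case (Cons j js)
          have "(1 / c i) * (1 / c i) ^ length js \<le> (real M * u j) * (real M ^ length js * (\<Prod>j\<leftarrow>js. u j))"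
            using Cons uc(7)[OF iW Ai] uc(1) c0 by (intro mult_mono) auto
          then show ?case by (simp add: mult_ac)
        qed simp
        have "length (snd (snd (\<sigma> i))) = 7" using \<sigma>(1)[OF i] by (auto simp: T_def words_def)
        then show ?thesis
          using le[of "fst (\<sigma> i) # snd (snd (\<sigma> i))"] \<sigma>(3,4)[OF i] by (simp add: v_def numeral_eq_Suc)
      qed
      have "(\<Sum>i\<in>Y. v (\<sigma> i)) = (\<Sum>\<tau>\<in>\<sigma> ` Y. v \<tau>)"
        using inj by (simp add: sum.reindex)
      also have "\<dots> \<le> (\<Sum>\<tau>\<in>T. v \<tau>)"
      proof (rule sum_mono2)
        show "\<sigma> ` Y \<subseteq> T" using \<sigma>(1) by blast
      qed (use v0 in \<open>simp_all add: T_def\<close>)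
      also have "\<dots> = (\<Sum>l<n. u l) * (real M ^ 7 * (\<Sum>js\<in>words {..<n} 7. \<Prod>j\<leftarrow>js. u j))"
      proof -
        have "(\<Sum>\<tau>\<in>T. v \<tau>) = (\<Sum>l<n. \<Sum>ps\<in>words {..<M} 7. \<Sum>js\<in>words {..<n} 7. u l * (\<Prod>j\<leftarrow>js. u j))"
          unfolding T_def v_def by (simp only: sum.cartesian_product case_prod_unfold)
        then show ?thesis by (simp add: sum_distrib_left[symmetric] sum_distrib_right[symmetric] card_words)
      qed
      also have "\<dots> = real M ^ 7" by (simp add: sum_words_prod_list uc(2))
      finally have "real M ^ 8 * (\<Sum>i\<in>Y. v (\<sigma> i)) \<le> real M ^ 8 * real M ^ 7"
        by (intro mult_left_mono) auto
      moreover have "(\<Sum>i\<in>Y. (1 / c i) ^ 8) \<le> real M ^ 8 * (\<Sum>i\<in>Y. v (\<sigma> i))"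
        unfolding sum_distrib_left by (rule sum_mono[OF cv])
      ultimately show "(\<Sum>i\<in>Y. (1 / c i) ^ 8) \<le> real M ^ 15"
        by (simp add: power_add[symmetric])
    qed (use uc(3) in \<open>auto intro!: sum_nonneg\<close>)
    finally show "(\<Sum>i\<in>Y. ((A (mset i))\<^sup>2 * c i) powr (8 / 9) * ((1 / c i) ^ 8) powr (1 / 9))
        \<le> ((mixed_norm n m A)\<^sup>2) powr (8 / 9) * (real M ^ 15) powr (1 / 9)" .
  qed (use M R in \<open>auto intro!: sum_nonneg simp: R_def\<close>)
  also have "(((mixed_norm n m A)\<^sup>2) powr (8 / 9) * (real M ^ 15) powr (1 / 9)) powr (9 / R)
      = ((mixed_norm n m A)\<^sup>2) powr (8 / R) * (real M ^ 15) powr (1 / R)"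
    by (simp add: powr_mult powr_powr)
  finally show ?thesis by (simp add: R_def mult.assoc)
qed

subsection \<open>Removing the largest pure power\<close>

lemma sum_diag:
  assumes "m > 0"
  shows "(\<Sum>i\<in>{i \<in> words {..<n} m. \<exists>j<n. i = replicate m j}. g i) = (\<Sum>j<n. g (replicate m j))"
proof -
  have "{i \<in> words {..<n} m. \<exists>j<n. i = replicate m j} = replicate m ` {..<n}"
    by (auto simp: words_def set_replicate_conv_if split: if_splits)
  moreover have "inj_on (replicate m) {..<n}" using assms by (auto simp: inj_on_def replicate_eq_replicate)
  ultimately show ?thesis by (simp add: sum.reindex)
qed

lemma word_monom_replicate: "word_monom z (replicate m j) = z j ^ m"
  by (induction m) (simp_all add: word_monom_def)

lemma complex_root_of_unimodular:
  fixes v :: complex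
  assumes "cmod v = 1" "m > 0"
  obtains y where "cmod y = 1" "y ^ m = v"
proof
  show "cmod (cis (Arg v / real m)) = 1" by simp
  have "cis (Arg v / real m) ^ m = cis (real m * (Arg v / real m))" by (rule Complex.DeMoivre)
  also have "\<dots> = v"
  proof -
    have "v \<noteq> 0" using assms by auto
    then show ?thesis using assms cis_Arg[of v] by (simp add: sgn_eq)
  qed
  finally show "cis (Arg v / real m) ^ m = v" .
qed

text \<open>
  Averaging over independent \<open>m\<close>-th roots of unity in the coordinates keeps exactly the pure powers.
\<close>

lemma sum_diag_coeffs_le:
  assumes b: "bounded_form n m t B" and m: "m > 0"
  shows "(\<Sum>j<n. cmod (t (replicate_mset m j))) \<le> B"
proof -
  have "\<exists>y. cmod y = 1 \<and> t (replicate_mset m j) * y ^ m = of_real (cmod (t (replicate_mset m j)))" for j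
  proof (rule sgn_pair[of "t (replicate_mset m j)" 0])
    fix \<kappa> assume \<kappa>: "cmod \<kappa> = 1" "\<kappa> * t (replicate_mset m j) = of_real (cmod (t (replicate_mset m j)))"
    obtain y where "cmod y = 1" "y ^ m = \<kappa>" using complex_root_of_unimodular[OF \<kappa>(1) m] .
    then show ?thesis using \<kappa> by (auto simp: mult.commute)
  qed
  then obtain y where y: "\<And>j. cmod (y j) = 1"
    "\<And>j. t (replicate_mset m j) * y j ^ m = of_real (cmod (t (replicate_mset m j)))" by metis
  let ?U = "words (unity m) n"
  have avg: "(\<Sum>\<omega>\<in>?U. word_monom ((!) \<omega>) i) = (if \<exists>j<n. i = replicate m j then of_nat m ^ n else 0)"
    if i: "i \<in> words {..<n} m" for i
  proof -
    have one: "monom_list \<omega> (replicate k 0) = 1" for \<omega> k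
      by (induction k arbitrary: \<omega>; case_tac \<omega>) auto
    have "(\<Sum>\<omega>\<in>?U. word_monom ((!) \<omega>) i)
        = (\<Sum>\<omega>\<in>?U. monom_list \<omega> (exponents n i) * cnj (monom_list \<omega> (replicate n 0)))"
      by (simp add: one word_monom_eq_monom_list[OF i] length_words)
    also have "\<dots> = (if list_all2 (\<lambda>a b. [a = b] (mod m)) (exponents n i) (replicate n 0) then of_nat m ^ n else 0)"
      by (rule monom_list_orthogonal[OF m]) (simp_all add: exponents_def)
    also have "list_all2 (\<lambda>a b. [a = b] (mod m)) (exponents n i) (replicate n 0) \<longleftrightarrow> (\<forall>j<n. m dvd count_list i j)"
      by (auto simp: list_all2_conv_all_nth exponents_def cong_0_iff)
    \<comment> \<open>Multiplicities with sum \<open>m\<close> that are all divisible by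
      \<open>m\<close> belong to a constant word.\<close>
    also have "(\<forall>j<n. m dvd count_list i j) \<longleftrightarrow> (\<exists>j<n. i = replicate m j)"
    proof
      assume dv: "\<forall>j<n. m dvd count_list i j"
      obtain j where j: "j \<in> set i" using i m by (cases i) (auto simp: words_def)
      have jn: "j < n" using j i by (auto simp: words_def)
      have "count_list i j > 0" using j by (simp add: count_list_0_iff neq0_conv[symmetric] del: neq0_conv)
      then have "m \<le> count_list i j" using dv jn by (auto intro: dvd_imp_le)
      then have "count_list i j = length i" using count_le_length[of i j] length_words[OF i] by simp
      then show "\<exists>j<n. i = replicate m j"
        using replicate_of_count_list[of i j] length_words[OF i] jn by auto
    next
      assume "\<exists>j<n. i = replicate m j"
      then obtain j where "i = replicate m j" by blast
      moreover have "count_list (replicate k j) l = (if l = j then k else 0)" for k l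
        by (induction k) auto
      ultimately show "\<forall>j<n. m dvd count_list i j" by simp
    qed
    finally show ?thesis .
  qed
  have mul: "word_monom (\<lambda>j. a j * c j) i = word_monom a i * word_monom c i" for a c i
    by (induction i) (simp_all add: word_monom_def)
  have "(\<Sum>\<omega>\<in>?U. form n m t (\<lambda>j. y j * \<omega> ! j))
      = (\<Sum>i\<in>words {..<n} m. t (mset i) * word_monom y i * (\<Sum>\<omega>\<in>?U. word_monom ((!) \<omega>) i))"
    unfolding form_def by (subst sum.swap) (simp add: mul[of y "(!) _"] sum_distrib_left mult_ac)
  also have "\<dots> = (\<Sum>i\<in>words {..<n} m. if \<exists>j<n. i = replicate m j then t (mset i) * word_monom y i * of_nat m ^ n else 0)"
    by (intro sum.cong refl) (auto simp: avg)
  also have "\<dots> = (\<Sum>i\<in>{i \<in> words {..<n} m. \<exists>j<n. i = replicate m j}. t (mset i) * word_monom y i * of_nat m ^ n)"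
    by (rule sum.inter_filter[symmetric]) simp
  also have "\<dots> = of_real ((\<Sum>j<n. cmod (t (replicate_mset m j))) * real m ^ n)"
    unfolding sum_diag[OF m] by (simp add: word_monom_replicate y(2) sum_distrib_right)
  finally have "(\<Sum>j<n. cmod (t (replicate_mset m j))) * real m ^ n
      = cmod (\<Sum>\<omega>\<in>?U. form n m t (\<lambda>j. y j * \<omega> ! j))"
    by (simp add: norm_mult norm_power sum_nonneg del: of_real_sum of_real_mult)
  also have "\<dots> \<le> real (card ?U) * B"
  proof (rule sum_norm_bound)
    fix \<omega> assume "\<omega> \<in> ?U"
    then show "cmod (form n m t (\<lambda>j. y j * \<omega> ! j)) \<le> B"
      using y(1) norm_unity[OF m] by (intro bounded_formD[OF b]) (simp add: norm_mult nth_words)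
  qed
  finally show ?thesis using m by (simp add: card_words mult.commute)
qed

text \<open>In the coordinate \<open>z l\<close> alone the form is a polynomial whose coefficient of
  degree \<open>m\<close> is the constant \<open>t (replicate_mset m l)\<close>, whatever the other
  coordinates are. By \<open>coeff_le_defect\<close> each of the \<open>m\<close> lower coefficients
  is at most \<open>2 * \<epsilon>\<close>; the bound 2 is the triangle inequality.\<close>

lemma bounded_form_remove_power:
  assumes b: "bounded_form n m t 1" and l: "l < n"
  defines "\<epsilon> \<equiv> 1 - cmod (t (replicate_mset m l))"
  shows "bounded_form n m (t(replicate_mset m l := 0)) (2 * min 1 (real m * \<epsilon>))" and "\<epsilon> \<ge> 0"
proof -
  define w :: "nat \<Rightarrow> complex" where "w j = (if j = l then 1 else 0)" for j
  have mem: "replicate m l \<in> words {..<n} m"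
    using l by (auto simp: words_def set_replicate_conv_if)
  have mw: "word_monom w i = (if i = replicate (length i) l then 1 else 0)" for i
    by (induction i) (auto simp: word_monom_def w_def)
  have top: "coeff (restrict_line n m t z w) m = t (replicate_mset m l)" for z
  proof -
    have "coeff (restrict_line n m t z w) m = (\<Sum>i\<in>words {..<n} m. if i = replicate m l then t (replicate_mset m l) else 0)"
      unfolding coeff_restrict_line
    proof (rule sum.cong[OF refl])
      fix i assume i: "i \<in> words {..<n} m"
      then have "coeff (line_poly z w i) m = word_monom w i"
        using coeff_line_poly_length[of z w i] by (simp add: length_words)
      then show "t (mset i) * coeff (line_poly z w i) m = (if i = replicate m l then t (replicate_mset m l) else 0)"
        using mw[of i] i by (auto simp: length_words)
    qed
    also have "\<dots> = t (replicate_mset m l)"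
      using mem by (simp add: sum.delta)
    finally show ?thesis .
  qed
  have dec: "form n m t z = (\<Sum>k\<le>m. coeff (restrict_line n m t (z(l := 0)) w) k * z l ^ k)" for z
  proof -
    have "z = (\<lambda>j. (z(l := 0)) j + z l * w j)" by (auto simp: w_def)
    then show ?thesis using form_line_eq_sum[of n m t "z(l := 0)" "z l" w] by simp
  qed
  have circ: "cmod (\<Sum>k\<le>m. coeff (restrict_line n m t (z(l := 0)) w) k * x ^ k) \<le> 1"
    if "\<And>j. cmod (z j) \<le> 1" "cmod x = 1" for z x
    using dec[of "z(l := x)"] bounded_formD[OF b, of "z(l := x)"] that by simp
  have "cmod (t (replicate_mset m l)) \<le> 1"
    using coeff_le_of_circle_bound[OF circ, of "\<lambda>_. 0" m] by (simp add: top)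
  then show e0: "\<epsilon> \<ge> 0" by (simp add: \<epsilon>_def)
  show "bounded_form n m (t(replicate_mset m l := 0)) (2 * min 1 (real m * \<epsilon>))"
    unfolding bounded_form_def
  proof (intro allI impI)
    fix z :: "nat \<Rightarrow> complex" assume z: "\<forall>j. cmod (z j) \<le> 1"
    have rep: "mset i = replicate_mset m l \<longleftrightarrow> i = replicate m l" for i
      by (metis in_replicate_mset length_replicate mset_replicate replicate_eqI set_mset_mset size_mset)
    have "form n m t z - form n m (t(replicate_mset m l := 0)) z
        = (\<Sum>i\<in>words {..<n} m. if i = replicate m l then t (replicate_mset m l) * z l ^ m else 0)"
      unfolding form_def sum_subtractf[symmetric]
      by (rule sum.cong[OF refl]) (auto simp: rep word_monom_replicate)
    also have "\<dots> = t (replicate_mset m l) * z l ^ m"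
      using mem by (simp add: sum.delta)
    finally have eq: "form n m (t(replicate_mset m l := 0)) z = form n m t z - t (replicate_mset m l) * z l ^ m"
      by (simp add: algebra_simps)
    have "cmod (form n m (t(replicate_mset m l := 0)) z) \<le> 2"
    proof -
      have "cmod (t (replicate_mset m l) * z l ^ m) \<le> 1 * 1"
        unfolding norm_mult norm_power using \<open>cmod (t (replicate_mset m l)) \<le> 1\<close> z
        by (intro mult_mono) (auto intro: power_le_one)
      moreover have "cmod (form n m t z) \<le> 1" using bounded_formD[OF b] z by simp
      ultimately show ?thesis
        unfolding eq using norm_triangle_ineq4[of "form n m t z" "t (replicate_mset m l) * z l ^ m"] by simp
    qed
    moreover have "cmod (form n m (t(replicate_mset m l := 0)) z) \<le> 2 * (real m * \<epsilon>)"
    proof -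
      have "form n m (t(replicate_mset m l := 0)) z = (\<Sum>k<m. coeff (restrict_line n m t (z(l := 0)) w) k * z l ^ k)"
        unfolding eq dec[of z] lessThan_Suc_atMost[symmetric] sum.lessThan_Suc by (simp add: top)
      also have "cmod \<dots> \<le> (\<Sum>k<m. 2 * \<epsilon>)"
      proof (rule order_trans[OF norm_sum], rule sum_mono)
        fix k assume k: "k \<in> {..<m}"
        have "cmod (coeff (restrict_line n m t (z(l := 0)) w) k) \<le> 2 * \<epsilon>"
          using coeff_le_defect[OF circ, of z k] z k by (simp add: top \<epsilon>_def)
        moreover have "cmod (z l) ^ k \<le> 1" using z by (intro power_le_one) auto
        ultimately have "cmod (coeff (restrict_line n m t (z(l := 0)) w) k) * cmod (z l) ^ k \<le> 2 * \<epsilon> * 1"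
          using e0 by (intro mult_mono) auto
        then show "cmod (coeff (restrict_line n m t (z(l := 0)) w) k * z l ^ k) \<le> 2 * \<epsilon>"
          by (simp add: norm_mult norm_power)
      qed
      finally show ?thesis by (simp add: mult_ac)
    qed
    ultimately show "cmod (form n m (t(replicate_mset m l := 0)) z) \<le> 2 * min 1 (real m * \<epsilon>)"
      by (simp add: min_def)
  qed
qed

subsection \<open>The inequality for arrays\<close>

text \<open>Multiplicities at most \<open>m - 8\<close> in a word of length \<open>m\<close> leave
  slices of length \<open>m - 1\<close> with multiplicities at most \<open>(m - 1) - 7\<close>, as
  the weight estimate requires. The constant 576 is 4 times the square of \<open>6 * 2\<close>, and
  \<open>m - 1 choose 7\<close> is at least \<open>((m - 1)/7)^7\<close>.\<close>

lemma sum_powr_deep_le: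
  assumes b: "bounded_form n m t (2 * x)" and m: "m > 20" and x: "0 \<le> x" "x \<le> 1"
    and X: "X \<subseteq> words {..<n} m" "\<And>i l. i \<in> X \<Longrightarrow> count_list i l + 8 \<le> m"
  shows "(\<Sum>i\<in>X. cmod (t (mset i)) powr (2 * real m / (real m + 1)))
    \<le> (576 * real m ^ 4 * (7 / (real m - 1)) ^ 7) powr (real m / (real m + 1)) * x"
proof -
  obtain k where k: "m = Suc k" using m by (cases m) auto
  define deep where "deep A \<longleftrightarrow> (\<forall>l. count A l + 8 \<le> m)" for A :: "nat multiset"
  define A where "A B = (if deep B then cmod (t B) else 0)" for B
  define \<rho> where "\<rho> = 4 * real m ^ 4 / real (k choose 7)"
  define e where "e = real m / (real m + 1)"
  have e: "0 < e" "e \<le> 1" "1 \<le> 2 * e" using m by (simp_all add: e_def field_simps)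
  have \<rho>0: "\<rho> \<ge> 0" by (simp add: \<rho>_def)
  have \<rho>le: "\<rho> \<le> 4 * real m ^ 4 * (7 / (real m - 1)) ^ 7"
  proof -
    have "(real k / real 7) ^ 7 \<le> real (k choose 7)"
      using m k by (intro binomial_ge_n_over_k_pow_k) auto
    then have "\<rho> \<le> 4 * real m ^ 4 / (real k / 7) ^ 7"
      unfolding \<rho>_def using m k by (intro divide_left_mono) auto
    then show ?thesis using k by (simp add: power_divide)
  qed
  have sq: "(A B)\<^sup>2 = (if deep B then (cmod (t B))\<^sup>2 else 0)" for B by (simp add: A_def)
  have "mixed_norm n k A \<le> 6 * sqrt \<rho> * (2 * x)"
    unfolding mixed_norm_def mixed_col_def sq
  proof (rule sum_sqrt_slices_le[OF b[unfolded k] \<rho>0])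
    fix j i assume ji: "j < n" "i \<in> words {..<n} k" "deep (add_mset j (mset i))"
    have "count_list i l + 7 \<le> k" for l
    proof -
      have "count (add_mset j (mset i)) l + 8 \<le> m" using ji(3) by (simp add: deep_def)
      moreover have "count_list i l \<le> count (add_mset j (mset i)) l" by (simp add: count_mset)
      ultimately show ?thesis using k by simp
    qed
    then have "(\<Prod>l<n. weight (count_list i l)) \<le> 4 * (real k + 1) ^ 4 / real (k choose 7) * real (arrangements i)"
      using m k by (intro weight_le_arrangements_deep[OF ji(2)]) auto
    then show "(\<Prod>l<n. weight (count_list i l)) \<le> \<rho> * real (arrangements i)"
      by (simp add: \<rho>_def k add.commute)
  qed
  then have "(mixed_norm n k A)\<^sup>2 \<le> (6 * sqrt \<rho> * (2 * x))\<^sup>2"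
    by (intro power_mono mixed_norm_nonneg)
  also have "\<dots> = 144 * \<rho> * x\<^sup>2" using \<rho>0 by (simp add: power_mult_distrib)
  also have "\<dots> \<le> (576 * real m ^ 4 * (7 / (real m - 1)) ^ 7) * x\<^sup>2"
    using \<rho>le by (intro mult_right_mono) auto
  finally have S: "(mixed_norm n k A)\<^sup>2 \<le> (576 * real m ^ 4 * (7 / (real m - 1)) ^ 7) * x\<^sup>2" .
  have "(\<Sum>i\<in>X. cmod (t (mset i)) powr (2 * real m / (real m + 1)))
      = (\<Sum>i\<in>X. A (mset i) powr (2 * real m / (real m + 1)))"
    using X(2) by (intro sum.cong refl) (auto simp: A_def deep_def count_mset)
  also have "\<dots> \<le> (\<Sum>i\<in>words {..<n} m. A (mset i) powr (2 * real m / (real m + 1)))"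
    using X(1) by (intro sum_mono2) auto
  also have "\<dots> \<le> ((mixed_norm n k A)\<^sup>2) powr e"
    unfolding e_def by (rule sum_powr_le_mixed_norm) (auto simp: A_def k)
  also have "\<dots> \<le> ((576 * real m ^ 4 * (7 / (real m - 1)) ^ 7) * x\<^sup>2) powr e"
    using e S by (intro powr_mono2) auto
  also have "\<dots> = (576 * real m ^ 4 * (7 / (real m - 1)) ^ 7) powr e * (x\<^sup>2) powr e"
    by (rule powr_mult)
  also have "\<dots> \<le> (576 * real m ^ 4 * (7 / (real m - 1)) ^ 7) powr e * x"
  proof (rule mult_left_mono)
    \<comment> \<open>This uses \<open>2 * e >= 1\<close> and \<open>x <= 1\<close>; the remaining
      single power of \<open>x\<close> is what carries \<epsilon>.\<close>
    show "(x\<^sup>2) powr e \<le> x"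
    proof (cases "x = 0")
      case False
      then have "(x\<^sup>2) powr e = x powr (2 * e)" using x by (simp add: powr_powr flip: powr_numeral)
      also have "\<dots> \<le> x powr 1" using x e by (intro powr_mono') auto
      finally show ?thesis using x False by simp
    qed simp
  qed simp
  finally show ?thesis by (simp add: e_def)
qed

text \<open>The mixed norm is bounded through the crude quadratic weight estimate, which its small
  exponent tolerates. The powers of \<epsilon> from the square sum and from
  \<open>x <= m \<epsilon>\<close> have exponents \<open>(m - 8)/(m + 1)\<close> and
  \<open>9/(m + 1)\<close>, which add up to exactly 1.\<close>

lemma sum_powr_shallow_form_le:
  assumes b: "bounded_form n m t (2 * x)" and m: "m > 8" and x: "0 \<le> x" "x \<le> 1" "x \<le> real m * \<epsilon>"
    and \<epsilon>: "\<epsilon> > 0"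
    and X: "X \<subseteq> words {..<n} m" "\<And>i. i \<in> X \<Longrightarrow> \<exists>l. m \<le> count_list i l + 7"
    and sq: "(\<Sum>i\<in>X. (cmod (t (mset i)))\<^sup>2) \<le> 2 * \<epsilon> / real m"
  shows "(\<Sum>i\<in>X. cmod (t (mset i)) powr (2 * real m / (real m + 1)))
    \<le> (2 / real m) powr ((real m - 8) / (real m + 1)) * (288 * real m ^ 2) powr (8 / (real m + 1))
        * real m powr (9 / (real m + 1)) * (real m ^ 15) powr (1 / (real m + 1)) * \<epsilon>"
proof -
  obtain k where k: "m = Suc k" using m by (cases m) auto
  define R where "R = real m + 1"
  have R: "R > 9" using m by (simp add: R_def)
  define A where "A B = cmod (t B)" for B
  have "mixed_norm n k A \<le> 6 * sqrt (2 * real m ^ 2) * (2 * x)"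
  proof -
    have "(\<Prod>l<n. weight (count_list i l)) \<le> 2 * real m ^ 2 * real (arrangements i)" if "i \<in> words {..<n} k" for i
      using weight_le_arrangements_all[OF that] by (simp add: k add.commute)
    then show ?thesis
      using sum_sqrt_slices_le[OF b[unfolded k], of "2 * real m ^ 2" "\<lambda>_. True"]
      by (simp add: mixed_norm_def mixed_col_def A_def)
  qed
  then have "(mixed_norm n k A)\<^sup>2 \<le> (6 * sqrt (2 * real m ^ 2) * (2 * x))\<^sup>2"
    by (intro power_mono mixed_norm_nonneg)
  also have "\<dots> = 288 * real m ^ 2 * x\<^sup>2" by (simp add: power_mult_distrib)
  finally have S: "(mixed_norm n k A)\<^sup>2 \<le> 288 * real m ^ 2 * x\<^sup>2" .
  have "(\<Sum>i\<in>X. A (mset i) powr (2 * real m / (real m + 1)))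
    \<le> (\<Sum>i\<in>X. (A (mset i))\<^sup>2) powr ((real m - 8) / R)
      * ((mixed_norm n k A)\<^sup>2) powr (8 / R) * (real m ^ 15) powr (1 / R)"
    unfolding R_def by (rule sum_powr_shallow_le) (use k m X in \<open>auto simp: A_def\<close>)
  also have "\<dots> \<le> (2 * \<epsilon> / real m) powr ((real m - 8) / R)
      * ((288 * real m ^ 2) powr (8 / R) * (real m * \<epsilon>) powr (9 / R)) * (real m ^ 15) powr (1 / R)"
  proof (intro mult_right_mono mult_mono)
    show "(\<Sum>i\<in>X. (A (mset i))\<^sup>2) powr ((real m - 8) / R) \<le> (2 * \<epsilon> / real m) powr ((real m - 8) / R)"
      using sq m R by (intro powr_mono2) (auto simp: A_def sum_nonneg)
    have "((mixed_norm n k A)\<^sup>2) powr (8 / R) \<le> (288 * real m ^ 2 * x\<^sup>2) powr (8 / R)"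
      using S R by (intro powr_mono2) auto
    also have "\<dots> = (288 * real m ^ 2) powr (8 / R) * (x\<^sup>2) powr (8 / R)" by (rule powr_mult)
    also have "(x\<^sup>2) powr (8 / R) \<le> (real m * \<epsilon>) powr (9 / R)"
    proof (cases "x = 0")
      case False
      then have "(x\<^sup>2) powr (8 / R) = x powr (16 / R)" using x by (simp add: powr_powr flip: powr_numeral)
      \<comment> \<open>Lowering the exponent from \<open>16/R\<close> to \<open>9/R\<close> is free
        for \<open>x <= 1\<close> and leaves just the missing power of \<epsilon>.\<close>
      also have "\<dots> \<le> x powr (9 / R)" using x R by (intro powr_mono' divide_right_mono) auto
      also have "\<dots> \<le> (real m * \<epsilon>) powr (9 / R)" using x R by (intro powr_mono2) auto
      finally show ?thesis .
    qed simp
    finally show "((mixed_norm n k A)\<^sup>2) powr (8 / R) \<le> (288 * real m ^ 2) powr (8 / R) * (real m * \<epsilon>) powr (9 / R)"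
      by (simp add: mult_left_mono)
  qed auto
  also have "\<dots> = (2 / real m) powr ((real m - 8) / R) * (288 * real m ^ 2) powr (8 / R)
        * real m powr (9 / R) * (real m ^ 15) powr (1 / R) * (\<epsilon> powr ((real m - 8) / R) * \<epsilon> powr (9 / R))"
  proof -
    have "(2 * \<epsilon> / real m) powr ((real m - 8) / R) = (2 / real m) powr ((real m - 8) / R) * \<epsilon> powr ((real m - 8) / R)"
      using \<epsilon> by (subst powr_mult[symmetric]) auto
    moreover have "(real m * \<epsilon>) powr (9 / R) = real m powr (9 / R) * \<epsilon> powr (9 / R)"
      by (rule powr_mult)
    ultimately show ?thesis by (simp only: mult_ac)
  qed
  also have "\<epsilon> powr ((real m - 8) / R) * \<epsilon> powr (9 / R) = \<epsilon>"
  proof -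
    have "(real m - 8) / R + 9 / R = 1"
      using R by (simp add: add_divide_distrib[symmetric]) (simp add: R_def)
    then show ?thesis using \<epsilon> by (simp add: powr_add[symmetric])
  qed
  finally show ?thesis by (simp add: A_def R_def)
qed

text \<open>The first expression is of order \<open>m^4 m^(-7) m = m^(-2)\<close>. In the second the
  leading factor is of order \<open>1 / m\<close>, and powers of \<open>m\<close> with exponents of
  order \<open>1 / m\<close> tend to 1.\<close>

lemma eventually_small_constants:
  "\<exists>m0::nat. \<forall>m\<ge>m0. 21 \<le> m
    \<and> (576 * real m ^ 4 * (7 / (real m - 1)) ^ 7) powr (real m / (real m + 1)) * real m < 1/8
    \<and> (2 / real m) powr ((real m - 8) / (real m + 1)) * (288 * real m ^ 2) powr (8 / (real m + 1))
        * real m powr (9 / (real m + 1)) * (real m ^ 15) powr (1 / (real m + 1)) < 1/8"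
proof -
  have "((\<lambda>m::nat. (576 * real m ^ 4 * (7 / (real m - 1)) ^ 7) powr (real m / (real m + 1)) * real m) \<longlongrightarrow> 0) sequentially"
    by real_asymp
  moreover have "((\<lambda>m::nat. (2 / real m) powr ((real m - 8) / (real m + 1)) * (288 * real m ^ 2) powr (8 / (real m + 1))
        * real m powr (9 / (real m + 1)) * (real m ^ 15) powr (1 / (real m + 1))) \<longlongrightarrow> 0) sequentially"
    by real_asymp
  ultimately have "eventually (\<lambda>m::nat. 21 \<le> m
    \<and> (576 * real m ^ 4 * (7 / (real m - 1)) ^ 7) powr (real m / (real m + 1)) * real m < 1/8
    \<and> (2 / real m) powr ((real m - 8) / (real m + 1)) * (288 * real m ^ 2) powr (8 / (real m + 1))
        * real m powr (9 / (real m + 1)) * (real m ^ 15) powr (1 / (real m + 1)) < 1/8) sequentially"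
    by (intro eventually_conj eventually_ge_at_top order_tendstoD(2)[of _ 0]) auto
  then show ?thesis by (simp add: eventually_sequentially)
qed

lemma arrangements_pos: "arrangements i \<ge> 1"
  by (simp add: arrangements_def Suc_le_eq card_gt_0_iff)

text \<open>Equality is possible only for \<epsilon> = 0, where Parseval leaves no room for other
  entries. For \<epsilon> > 0 the sum is at most
  \<open>1 - \<epsilon>/2 + \<epsilon>/8 + \<epsilon>/8 < 1\<close>.\<close>

lemma array_inequality:
  "\<exists>m0::nat. \<forall>m\<ge>m0. m > 0 \<and> (\<forall>n t. bounded_form n m t 1 \<longrightarrow>
    (\<Sum>i\<in>words {..<n} m. cmod (t (mset i)) powr (2 * real m / (real m + 1))) \<le> 1 \<and>
    ((\<Sum>i\<in>words {..<n} m. cmod (t (mset i)) powr (2 * real m / (real m + 1))) = 1 \<longrightarrow>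
      (\<exists>l<n. \<forall>i\<in>words {..<n} m. i \<noteq> replicate m l \<longrightarrow> t (mset i) = 0)))"
proof -
  obtain m0 :: nat where m0: "\<And>m. m \<ge> m0 \<Longrightarrow> 21 \<le> m"
    "\<And>m. m \<ge> m0 \<Longrightarrow> (576 * real m ^ 4 * (7 / (real m - 1)) ^ 7) powr (real m / (real m + 1)) * real m < 1/8"
    "\<And>m. m \<ge> m0 \<Longrightarrow> (2 / real m) powr ((real m - 8) / (real m + 1)) * (288 * real m ^ 2) powr (8 / (real m + 1))
        * real m powr (9 / (real m + 1)) * (real m ^ 15) powr (1 / (real m + 1)) < 1/8"
    using eventually_small_constants by metis
  show ?thesis
  proof (rule exI[of _ m0], intro allI impI conjI)
    fix m assume "m \<ge> m0"
    note m = m0[OF this]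
    show "0 < m" using m(1) by simp
    fix n t assume b: "bounded_form n m t 1"
    define p where "p = 2 * real m / (real m + 1)"
    define W where "W = words {..<n} m"
    have goal: "(\<Sum>i\<in>W. cmod (t (mset i)) powr p) < 1 \<or>
      ((\<Sum>i\<in>W. cmod (t (mset i)) powr p) \<le> 1 \<and> (\<exists>l<n. \<forall>i\<in>W. i \<noteq> replicate m l \<longrightarrow> t (mset i) = 0))"
    proof (cases "n = 0")
      case True
      then have "W = {}" using m(1) by (auto simp: W_def words_def)
      then show ?thesis by simp
    next
      case False
      define a where "a j = cmod (t (replicate_mset m j))" for j
      obtain l where l: "l < n" "\<And>j. j < n \<Longrightarrow> a j \<le> a l"
      proof -
        have "Max (a ` {..<n}) \<in> a ` {..<n}" using False by (intro Max_in) auto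
        then obtain l where "l < n" "a l = Max (a ` {..<n})" by auto
        then show ?thesis using that[of l] by simp
      qed
      define \<epsilon> where "\<epsilon> = 1 - a l"
      define t' where "t' = t(replicate_mset m l := 0)"
      define x where "x = min 1 (real m * \<epsilon>)"
      have b': "bounded_form n m t' (2 * x)" and \<epsilon>0: "\<epsilon> \<ge> 0"
        using bounded_form_remove_power[OF b l(1)] by (simp_all add: t'_def x_def \<epsilon>_def a_def)
      have rW: "replicate m l \<in> W" using l by (auto simp: W_def words_def set_replicate_conv_if)
      have fW: "finite W" by (simp add: W_def)
      have off: "(\<Sum>i\<in>W - {replicate m l}. real (arrangements i) * (cmod (t (mset i)))\<^sup>2) \<le> 2 * \<epsilon>"
      proof -
        have "(a l)\<^sup>2 \<le> real (arrangements (replicate m l)) * (a l)\<^sup>2"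
          using mult_right_mono[of 1 "real (arrangements (replicate m l))" "(a l)\<^sup>2"] arrangements_pos by simp
        moreover have "real (arrangements (replicate m l)) * (a l)\<^sup>2
            + (\<Sum>i\<in>W - {replicate m l}. real (arrangements i) * (cmod (t (mset i)))\<^sup>2) \<le> 1"
          using Parseval_form[OF b] sum.remove[OF fW rW, of "\<lambda>i. real (arrangements i) * (cmod (t (mset i)))\<^sup>2"]
          by (simp add: W_def a_def)
        moreover have "1 - (a l)\<^sup>2 = 2 * \<epsilon> - \<epsilon>\<^sup>2" by (simp add: \<epsilon>_def power2_eq_square algebra_simps)
        moreover have "\<epsilon>\<^sup>2 \<ge> 0" by simp
        ultimately show ?thesis by linarith
      qed
      show ?thesis
      proof (cases "\<epsilon> = 0")
        case True
        have z: "t (mset i) = 0" if i: "i \<in> W - {replicate m l}" for i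
        proof -
          have "real (arrangements i) * (cmod (t (mset i)))\<^sup>2 \<le> 2 * \<epsilon>"
            by (rule order_trans[OF member_le_sum[OF i] off]) (use fW in auto)
          then have "real (arrangements i) * (cmod (t (mset i)))\<^sup>2 \<le> 0" using True by simp
          moreover have "real (arrangements i) \<ge> 1" using arrangements_pos by simp
          ultimately show ?thesis by (simp add: mult_le_0_iff)
        qed
        have "(\<Sum>i\<in>W. cmod (t (mset i)) powr p) = a l powr p + (\<Sum>i\<in>W - {replicate m l}. cmod (t (mset i)) powr p)"
          using sum.remove[OF fW rW, of "\<lambda>i. cmod (t (mset i)) powr p"] by (simp add: a_def)
        also have "(\<Sum>i\<in>W - {replicate m l}. cmod (t (mset i)) powr p) = 0"
          using z by (intro sum.neutral) auto
        finally have "(\<Sum>i\<in>W. cmod (t (mset i)) powr p) \<le> 1" using True by (simp add: \<epsilon>_def)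
        then show ?thesis using z l(1) by blast
      next
        case False
        then have \<epsilon>: "\<epsilon> > 0" using \<epsilon>0 by simp
        have x: "0 \<le> x" "x \<le> 1" "x \<le> real m * \<epsilon>" using \<epsilon> by (simp_all add: x_def)
        define Dg where "Dg = {i \<in> W. \<exists>j<n. i = replicate m j}"
        define Dp where "Dp = {i \<in> W - Dg. \<forall>l. count_list i l + 8 \<le> m}"
        define Sh where "Sh = {i \<in> W - Dg. \<exists>l. m \<le> count_list i l + 7}"
        have rD: "replicate m l \<in> Dg" using rW l by (auto simp: Dg_def)
        have tt: "t' (mset i) = t (mset i)" if "i \<in> W - Dg" for i
        proof -
          have "mset i \<noteq> replicate_mset m l"
            using that rD by (metis DiffD2 in_replicate_mset length_replicate mset_replicate
                replicate_eqI set_mset_mset size_mset)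
          then show ?thesis by (simp add: t'_def)
        qed
        have deep: "(\<Sum>i\<in>Dp. cmod (t (mset i)) powr p) \<le> \<epsilon> / 8"
        proof -
          have "(\<Sum>i\<in>Dp. cmod (t (mset i)) powr p) = (\<Sum>i\<in>Dp. cmod (t' (mset i)) powr p)"
            by (rule sum.cong) (auto simp: Dp_def tt)
          also have "\<dots> \<le> (576 * real m ^ 4 * (7 / (real m - 1)) ^ 7) powr (real m / (real m + 1)) * x"
            unfolding p_def using m(1) x by (intro sum_powr_deep_le[OF b']) (auto simp: Dp_def W_def)
          also have "\<dots> \<le> (576 * real m ^ 4 * (7 / (real m - 1)) ^ 7) powr (real m / (real m + 1)) * (real m * \<epsilon>)"
            using x by (intro mult_left_mono) auto
          also have "\<dots> \<le> 1/8 * \<epsilon>"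
            using m(2) \<epsilon> unfolding mult.assoc[symmetric] by (intro mult_right_mono) auto
          finally show ?thesis by simp
        qed
        have shallow: "(\<Sum>i\<in>Sh. cmod (t (mset i)) powr p) \<le> \<epsilon> / 8"
        proof -
          \<comment> \<open>A word that is not constant has at least \<open>m\<close> arrangements;
            this gains the factor \<open>1 / m\<close> in the square sum.\<close>
          have "real m * (\<Sum>i\<in>Sh. (cmod (t (mset i)))\<^sup>2)
              \<le> (\<Sum>i\<in>Sh. real (arrangements i) * (cmod (t (mset i)))\<^sup>2)"
            unfolding sum_distrib_left
          proof (intro sum_mono mult_right_mono)
            fix i assume "i \<in> Sh"
            then show "real m \<le> real (arrangements i)"
              using m(1) by (intro arrangements_ge_length[of i n]) (auto simp: Sh_def Dg_def W_def)
          qed simp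
          also have "\<dots> \<le> (\<Sum>i\<in>W - {replicate m l}. real (arrangements i) * (cmod (t (mset i)))\<^sup>2)"
            using fW rD by (intro sum_mono2) (auto simp: Sh_def)
          also have "\<dots> \<le> 2 * \<epsilon>" by (rule off)
          finally have "(\<Sum>i\<in>Sh. (cmod (t (mset i)))\<^sup>2) \<le> 2 * \<epsilon> / real m"
            using m(1) by (simp add: field_simps)
          also have "(\<Sum>i\<in>Sh. (cmod (t (mset i)))\<^sup>2) = (\<Sum>i\<in>Sh. (cmod (t' (mset i)))\<^sup>2)"
            by (rule sum.cong) (auto simp: Sh_def tt)
          finally have sq: "(\<Sum>i\<in>Sh. (cmod (t' (mset i)))\<^sup>2) \<le> 2 * \<epsilon> / real m" .
          have "(\<Sum>i\<in>Sh. cmod (t (mset i)) powr p) = (\<Sum>i\<in>Sh. cmod (t' (mset i)) powr p)"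
            by (rule sum.cong) (auto simp: Sh_def tt)
          also have "\<dots> \<le> (2 / real m) powr ((real m - 8) / (real m + 1)) * (288 * real m ^ 2) powr (8 / (real m + 1))
              * real m powr (9 / (real m + 1)) * (real m ^ 15) powr (1 / (real m + 1)) * \<epsilon>"
            unfolding p_def using m(1)
            by (intro sum_powr_shallow_form_le[OF b' _ x \<epsilon> _ _ sq]) (auto simp: Sh_def W_def)
          also have "\<dots> \<le> 1/8 * \<epsilon>"
            using m(3) \<epsilon> by (intro mult_right_mono) auto
          finally show ?thesis by simp
        qed
        have diag: "(\<Sum>i\<in>Dg. cmod (t (mset i)) powr p) \<le> 1 - \<epsilon> / 2"
        proof -
          have a0: "a j \<ge> 0" for j by (simp add: a_def)
          \<comment> \<open>One factor of each power is kept for the bound on the sum of the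
            \<open>a j\<close>; the exponent \<open>p - 1 >= 1/2\<close> falls on the largest
            coefficient and produces \<open>sqrt (1 - \<epsilon>)\<close>.\<close>
          have p1: "p - 1 \<ge> 1/2" using m(1) by (simp add: p_def field_simps)
          have "(\<Sum>i\<in>Dg. cmod (t (mset i)) powr p) = (\<Sum>j<n. a j powr p)"
            unfolding Dg_def W_def using m(1) by (subst sum_diag) (simp_all add: a_def)
          also have "\<dots> \<le> (\<Sum>j<n. a l powr (p - 1) * a j)"
          proof (rule sum_mono)
            fix j assume j: "j \<in> {..<n}"
            have "a j powr p = a j powr (p - 1) * a j"
              using a0[of j] powr_add[of "a j" "p - 1" 1] by (cases "a j = 0") auto
            also have "\<dots> \<le> a l powr (p - 1) * a j"
              using a0 l(2)[of j] j p1 by (intro mult_right_mono powr_mono2) auto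
            finally show "a j powr p \<le> a l powr (p - 1) * a j" .
          qed
          also have "\<dots> = a l powr (p - 1) * (\<Sum>j<n. a j)" by (simp add: sum_distrib_left)
          also have "\<dots> \<le> a l powr (p - 1) * 1"
            using sum_diag_coeffs_le[OF b] m(1) by (intro mult_left_mono) (auto simp: a_def)
          also have "\<dots> \<le> a l powr (1/2)"
            using a0[of l] \<epsilon> p1 by (simp add: \<epsilon>_def powr_mono')
          also have "\<dots> = sqrt (1 - \<epsilon>)"
            using a0[of l] by (simp add: powr_half_sqrt \<epsilon>_def)
          also have "\<dots> \<le> 1 - \<epsilon> / 2"
          proof (rule real_le_lsqrt)
            show "0 \<le> 1 - \<epsilon> / 2" using a0[of l] by (simp add: \<epsilon>_def)
            show "1 - \<epsilon> \<le> (1 - \<epsilon> / 2)\<^sup>2" by (simp add: power2_eq_square algebra_simps)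
          qed
          finally show ?thesis .
        qed
        have nle: "count_list i k + 8 \<le> m \<longleftrightarrow> \<not> m \<le> count_list i k + 7" for i :: "nat list" and k
          by linarith
        have split: "W = Dg \<union> (Dp \<union> Sh)"
          unfolding Dg_def Dp_def Sh_def nle by blast
        have "(\<Sum>i\<in>W. cmod (t (mset i)) powr p)
            = (\<Sum>i\<in>Dg. cmod (t (mset i)) powr p) + (\<Sum>i\<in>Dp \<union> Sh. cmod (t (mset i)) powr p)"
          unfolding split using fW by (intro sum.union_disjoint) (auto simp: Dg_def Dp_def Sh_def)
        also have "(\<Sum>i\<in>Dp \<union> Sh. cmod (t (mset i)) powr p)
            = (\<Sum>i\<in>Dp. cmod (t (mset i)) powr p) + (\<Sum>i\<in>Sh. cmod (t (mset i)) powr p)"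
        proof (intro sum.union_disjoint)
          show "Dp \<inter> Sh = {}" unfolding Dp_def Sh_def nle by blast
        qed (use fW in \<open>auto simp: Dp_def Sh_def\<close>)
        finally have "(\<Sum>i\<in>W. cmod (t (mset i)) powr p) < 1"
          using diag deep shallow \<epsilon> by linarith
        then show ?thesis by blast
      qed
    qed
    then show "(\<Sum>i\<in>words {..<n} m. cmod (t (mset i)) powr (2 * real m / (real m + 1))) \<le> 1"
      by (auto simp: W_def p_def)
    assume "(\<Sum>i\<in>words {..<n} m. cmod (t (mset i)) powr (2 * real m / (real m + 1))) = 1"
    then show "\<exists>l<n. \<forall>i\<in>words {..<n} m. i \<noteq> replicate m l \<longrightarrow> t (mset i) = 0"
      using goal by (auto simp: W_def p_def)
  qed
qed

subsection \<open>Symmetric multilinear forms\<close>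

text \<open>The vector is built up one coordinate at a time through its truncations
  \<open>v q\<close>; the empty truncation is 0 times itself, so homogeneity kills it.\<close>

lemma multilinear_form_expand_slot:
  assumes T: "multilinear_form n m T" and vs: "vs \<in> vec_tuples n m" "k < m" and z: "z \<in> carrier_vec n"
  shows "T (vs[k := z]) = (\<Sum>j<n. vec_index z j * T (vs[k := unit_vec n j]))"
proof -
  have add: "T (vs[k := x + y]) = T (vs[k := x]) + T (vs[k := y])"
    and smult: "T (vs[k := a \<cdot>\<^sub>v x]) = a * T (vs[k := x])"
    if "x \<in> carrier_vec n" "y \<in> carrier_vec n" for x y a
    using T vs that unfolding multilinear_form_def by blast+
  define v where "v q = Matrix.vec n (\<lambda>j. if j < q then vec_index z j else 0)" for q
  have vc: "v q \<in> carrier_vec n" for q by (simp add: v_def)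
  have "T (vs[k := v q]) = (\<Sum>j<q. vec_index z j * T (vs[k := unit_vec n j]))" if "q \<le> n" for q
    using that
  proof (induction q)
    case 0
    have "v 0 = 0 \<cdot>\<^sub>v v 0" by (auto simp: v_def)
    then show ?case using smult[OF vc vc, of 0 0] by (metis lessThan_0 mult_zero_left sum.empty)
  next
    case (Suc q)
    have "v (Suc q) = v q + vec_index z q \<cdot>\<^sub>v unit_vec n q"
      using Suc.prems by (intro eq_vecI) (auto simp: v_def less_Suc_eq)
    then show ?case
      using add[OF vc, of "vec_index z q \<cdot>\<^sub>v unit_vec n q"] smult[of "unit_vec n q" "unit_vec n q"] Suc
      by simp
  qed
  from this[of n] have "T (vs[k := v n]) = (\<Sum>j<n. vec_index z j * T (vs[k := unit_vec n j]))" by simp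
  moreover have "v n = z" using z by (intro eq_vecI) (auto simp: v_def)
  ultimately show ?thesis by simp
qed

lemma multilinear_form_expand_middle:
  assumes T: "multilinear_form n m T" and len: "length xs + Suc (length ws) = m"
    and c: "set xs \<subseteq> carrier_vec n" "set ws \<subseteq> carrier_vec n" "z \<in> carrier_vec n"
  shows "T (xs @ z # ws) = (\<Sum>j<n. vec_index z j * T ((xs @ [unit_vec n j]) @ ws))"
  using multilinear_form_expand_slot[OF T, of "xs @ z # ws" "length xs" z] len c
  by (simp add: vec_tuples_def)

lemma multilinear_form_diag_expand:
  assumes T: "multilinear_form n m T" and z: "z \<in> carrier_vec n"
  shows "length xs + r = m \<Longrightarrow> set xs \<subseteq> carrier_vec n \<Longrightarrow>
    T (xs @ replicate r z) = (\<Sum>i\<in>words {..<n} r. T (xs @ map (unit_vec n) i) * word_monom (vec_index z) i)"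
proof (induction r arbitrary: xs)
  case 0
  then show ?case by (simp add: word_monom_def)
next
  case (Suc r)
  have "T (xs @ replicate (Suc r) z) = (\<Sum>j<n. vec_index z j * T ((xs @ [unit_vec n j]) @ replicate r z))"
    using multilinear_form_expand_middle[OF T, of xs "replicate r z" z] Suc.prems z
    by (simp add: set_replicate_conv_if)
  also have "\<dots> = (\<Sum>j<n. vec_index z j * (\<Sum>i\<in>words {..<n} r.
      T ((xs @ [unit_vec n j]) @ map (unit_vec n) i) * word_monom (vec_index z) i))"
    using Suc.prems by (subst Suc.IH) auto
  also have "\<dots> = (\<Sum>i\<in>words {..<n} (Suc r). T (xs @ map (unit_vec n) i) * word_monom (vec_index z) i)"
    by (simp add: sum_words_Suc sum_distrib_left word_monom_def mult_ac)
  finally show ?case .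
qed

text \<open>Slots are expanded from left to right, the prefix \<open>i\<close> holding those already
  replaced by basis vectors. This turns \<open>nonzero_form\<close>, which speaks of arbitrary
  tuples, into a nonzero entry of the array.\<close>

lemma multilinear_form_zero:
  assumes T: "multilinear_form n m T" and zero: "\<And>i. i \<in> words {..<n} m \<Longrightarrow> T (map (unit_vec n) i) = 0"
  shows "i \<in> words {..<n} r \<Longrightarrow> r + length ws = m \<Longrightarrow> set ws \<subseteq> carrier_vec n \<Longrightarrow>
    T (map (unit_vec n) i @ ws) = 0"
proof (induction ws arbitrary: i r)
  case Nil
  then show ?case using zero by simp
next
  case (Cons w ws)
  have "T (map (unit_vec n) i @ w # ws)
      = (\<Sum>j<n. vec_index w j * T ((map (unit_vec n) i @ [unit_vec n j]) @ ws))"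
    using Cons.prems by (intro multilinear_form_expand_middle[OF T]) (auto simp: length_words)
  also have "\<dots> = 0"
  proof (intro sum.neutral ballI)
    fix j assume "j \<in> {..<n}"
    then have "i @ [j] \<in> words {..<n} (Suc r)" using Cons.prems by (auto simp: words_def)
    from Cons.IH[OF this] Cons.prems
    show "vec_index w j * T ((map (unit_vec n) i @ [unit_vec n j]) @ ws) = 0" by simp
  qed
  finally show ?case .
qed

text \<open>The sorted word represents the multiset; for a symmetric form any other word with these
  letters gives the same value.\<close>

definition coeff_array :: "nat \<Rightarrow> (cvec list \<Rightarrow> complex) \<Rightarrow> nat multiset \<Rightarrow> complex" where
  "coeff_array n T A = T (map (unit_vec n) (sorted_list_of_multiset A))"

lemma coeff_array_mset:
  assumes T: "symmetric_form n m T" and i: "i \<in> words {..<n} m"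
  shows "coeff_array n T (mset i) = T (map (unit_vec n) i)"
proof -
  have "mset (sort i) = mset i" by simp
  then obtain p where p: "p permutes {..<length i}" "permute_list p i = sort i"
    by (rule mset_eq_permutation)
  have "map (unit_vec n) i \<in> vec_tuples n m" using i by (auto simp: vec_tuples_def words_def)
  then have "T (permute_list p (map (unit_vec n) i)) = T (map (unit_vec n) i)"
    using T p(1) length_words[OF i] unfolding symmetric_form_def by auto
  then show ?thesis using p by (simp add: coeff_array_def permute_list_map)
qed

lemma form_coeff_array:
  assumes T: "multilinear_form n m T" "symmetric_form n m T" and z: "z \<in> carrier_vec n"
  shows "form n m (coeff_array n T) (vec_index z) = T (replicate m z)"
  using multilinear_form_diag_expand[OF T(1) z, of "[]" m]
  by (simp add: form_def coeff_array_mset[OF T(2)])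

section \<open>The supremum over the polydisc\<close>

lemma linf_norm_le_1: "z \<in> carrier_vec n \<Longrightarrow> linf_norm z \<le> 1 \<longleftrightarrow> (\<forall>j<n. cmod (vec_index z j) \<le> 1)"
  by (auto simp: linf_norm_def)

lemma diag_sup_upper:
  assumes T: "multilinear_form n m T" "symmetric_form n m T"
    and z: "z \<in> carrier_vec n" "linf_norm z \<le> 1"
  shows "cmod (T (replicate m z)) \<le> diag_sup n m T"
proof -
  have "cmod (T (replicate m y)) \<le> (\<Sum>i\<in>words {..<n} m. cmod (coeff_array n T (mset i)))"
    if y: "y \<in> carrier_vec n" "linf_norm y \<le> 1" for y
  proof -
    have "cmod (word_monom (vec_index y) i) \<le> 1" if "i \<in> words {..<n} m" for i
    proof -
      have "set i \<subseteq> {..<n}" using that by (auto simp: words_def)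
      then show ?thesis using y linf_norm_le_1[OF y(1)]
        by (induction i) (auto simp: word_monom_def norm_mult intro!: mult_le_one)
    qed
    then show ?thesis
      unfolding form_coeff_array[OF T y(1), symmetric] form_def
      by (intro order_trans[OF norm_sum] sum_mono) (simp add: norm_mult mult_left_le)
  qed
  then have "bdd_above ((\<lambda>z. cmod (T (replicate m z))) ` {z \<in> carrier_vec n. linf_norm z \<le> 1})"
    by (intro bdd_aboveI2) auto
  then show ?thesis
    unfolding diag_sup_def using z by (intro cSUP_upper) auto
qed

lemma diag_sup_least:
  assumes "\<And>z. z \<in> carrier_vec n \<Longrightarrow> linf_norm z \<le> 1 \<Longrightarrow> cmod (T (replicate m z)) \<le> B"
  shows "diag_sup n m T \<le> B"
proof -
  have "linf_norm (0\<^sub>v n :: cvec) \<le> 1" by (subst linf_norm_le_1[of _ n]) auto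
  then have "0\<^sub>v n \<in> {z :: cvec. z \<in> carrier_vec n \<and> linf_norm z \<le> 1}" by simp
  then have "{z :: cvec. z \<in> carrier_vec n \<and> linf_norm z \<le> 1} \<noteq> {}" by blast
  then show ?thesis unfolding diag_sup_def using assms by (intro cSUP_least) auto
qed

lemma bounded_coeff_array:
  assumes T: "multilinear_form n m T" "symmetric_form n m T"
  shows "bounded_form n m (coeff_array n T) (diag_sup n m T)"
  unfolding bounded_form_def
proof (intro allI impI)
  fix z :: "nat \<Rightarrow> complex" assume z: "\<forall>j. cmod (z j) \<le> 1"
  have "form n m (coeff_array n T) z = form n m (coeff_array n T) (vec_index (Matrix.vec n z))"
    by (rule form_cong) simp
  also have "\<dots> = T (replicate m (Matrix.vec n z))" by (rule form_coeff_array[OF T]) simp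
  finally show "cmod (form n m (coeff_array n T) z) \<le> diag_sup n m T"
    using z by (simp add: diag_sup_upper[OF T] linf_norm_le_1)
qed

lemma coeff_norm_eq:
  assumes "symmetric_form n m T"
  shows "coeff_norm n m T = (\<Sum>i\<in>words {..<n} m.
    cmod (coeff_array n T (mset i)) powr (2 * real m / (real m + 1))) powr ((real m + 1) / (2 * real m))"
  unfolding coeff_norm_def words_def[symmetric] by (simp add: coeff_array_mset[OF assms] cong: sum.cong)

theorem corollary1p4:
  shows "\<exists>m0::nat. \<forall>m\<ge>m0. \<forall>n::nat. \<forall>T :: cvec list \<Rightarrow> complex.
    multilinear_form n m T \<longrightarrow> symmetric_form n m T \<longrightarrow>
      coeff_norm n m T \<le> diag_sup n m T \<and>
      (nonzero_form n m T \<longrightarrow>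
        (coeff_norm n m T = diag_sup n m T \<longleftrightarrow>
          (\<exists>j<n. \<exists>c. c \<noteq> 0 \<and>
            (\<forall>z \<in> carrier_vec n. T (replicate m z) = c * vec_index z j ^ m))))"
proof -
  obtain m0 :: nat where m0: "\<And>m. m \<ge> m0 \<Longrightarrow> m > 0"
    "\<And>m n t. m \<ge> m0 \<Longrightarrow> bounded_form n m t 1 \<Longrightarrow>
      (\<Sum>i\<in>words {..<n} m. cmod (t (mset i)) powr (2 * real m / (real m + 1))) \<le> 1"
    "\<And>m n t. m \<ge> m0 \<Longrightarrow> bounded_form n m t 1 \<Longrightarrow>
      (\<Sum>i\<in>words {..<n} m. cmod (t (mset i)) powr (2 * real m / (real m + 1))) = 1 \<Longrightarrow>
      \<exists>l<n. \<forall>i\<in>words {..<n} m. i \<noteq> replicate m l \<longrightarrow> t (mset i) = 0"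
    using array_inequality by metis
  show ?thesis
  proof (intro exI[of _ m0] allI impI)
    fix m n and T :: "cvec list \<Rightarrow> complex"
    assume m: "m \<ge> m0" and T: "multilinear_form n m T" "symmetric_form n m T"
    have mpos: "m > 0" using m0(1)[OF m] .
    define W where "W = words {..<n} m"
    define t where "t = coeff_array n T"
    define D where "D = diag_sup n m T"
    define p where "p = 2 * real m / (real m + 1)"
    define \<Sigma> where "\<Sigma> = (\<Sum>i\<in>W. cmod (t (mset i)) powr p)"
    have p: "p > 0" "(real m + 1) / (2 * real m) = 1 / p" using mpos by (simp_all add: p_def)
    have cn: "coeff_norm n m T = \<Sigma> powr (1 / p)"
      by (simp add: coeff_norm_eq[OF T(2)] \<Sigma>_def W_def t_def p(2)[symmetric] p_def)
    have \<Sigma>0: "\<Sigma> \<ge> 0" by (simp add: \<Sigma>_def sum_nonneg)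
    have fW: "finite W" by (simp add: W_def)
    have b: "bounded_form n m t D" unfolding t_def D_def by (rule bounded_coeff_array[OF T])
    have D0: "D \<ge> 0" by (rule bounded_form_nonneg[OF b])
    \<comment> \<open>Scaling to supremum 1 requires \<open>D > 0\<close>; for \<open>D = 0\<close>
      Parseval annihilates all entries instead.\<close>
    have le: "coeff_norm n m T \<le> D \<and> (D > 0 \<longrightarrow> coeff_norm n m T = D \<longrightarrow>
      (\<exists>l<n. \<forall>i\<in>W. i \<noteq> replicate m l \<longrightarrow> t (mset i) = 0)) \<and> (D = 0 \<longrightarrow> (\<forall>i\<in>W. t (mset i) = 0))"
    proof (cases "D = 0")
      case True
      have "t (mset i) = 0" if i: "i \<in> W" for i
      proof -
        have "real (arrangements i) * (cmod (t (mset i)))\<^sup>2 \<le> 0"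
          using member_le_sum[OF i, of "\<lambda>i. real (arrangements i) * (cmod (t (mset i)))\<^sup>2"] fW
            Parseval_form[OF b] True by (simp add: W_def)
        then show ?thesis using arrangements_pos[of i] by (simp add: mult_le_0_iff)
      qed
      moreover from this have "\<Sigma> = 0" by (simp add: \<Sigma>_def)
      ultimately show ?thesis using True cn by simp
    next
      case False
      then have D: "D > 0" using D0 by simp
      define s where "s A = t A / of_real D" for A
      have "form n m s z = form n m t z / of_real D" for z
        by (simp add: form_def s_def sum_divide_distrib)
      then have bs: "bounded_form n m s 1"
        using b D by (simp add: bounded_form_def norm_divide)
      have ss: "(\<Sum>i\<in>words {..<n} m. cmod (s (mset i)) powr (2 * real m / (real m + 1))) = \<Sigma> / D powr p"
        using D by (simp add: s_def norm_divide powr_divide \<Sigma>_def sum_divide_distrib W_def p_def)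
      have "\<Sigma> \<le> D powr p" using m0(2)[OF m bs] D unfolding ss by (simp add: divide_le_eq)
      then have "\<Sigma> powr (1 / p) \<le> (D powr p) powr (1 / p)" using \<Sigma>0 p by (intro powr_mono2) auto
      also have "\<dots> = D" using p D by (simp add: powr_powr)
      finally have "coeff_norm n m T \<le> D" by (simp add: cn)
      moreover have "\<exists>l<n. \<forall>i\<in>W. i \<noteq> replicate m l \<longrightarrow> t (mset i) = 0" if "coeff_norm n m T = D"
      proof -
        have "D powr p = (\<Sigma> powr (1 / p)) powr p" using that by (simp add: cn)
        also have "\<dots> = \<Sigma>" using \<Sigma>0 p by (simp add: powr_powr)
        finally have "\<Sigma> = D powr p" by simp
        then have "\<Sigma> / D powr p = 1" using D by simp
        then show ?thesis using m0(3)[OF m bs] D unfolding ss by (auto simp: s_def W_def)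
      qed
      ultimately show ?thesis using False by blast
    qed
    have "coeff_norm n m T = D \<longleftrightarrow> (\<exists>j<n. \<exists>c. c \<noteq> 0 \<and>
            (\<forall>z \<in> carrier_vec n. T (replicate m z) = c * vec_index z j ^ m))" if nz: "nonzero_form n m T"
    proof
      have nzW: "\<exists>i\<in>W. t (mset i) \<noteq> 0"
      proof (rule ccontr)
        assume "\<not> (\<exists>i\<in>W. t (mset i) \<noteq> 0)"
        then have "\<And>i. i \<in> words {..<n} m \<Longrightarrow> T (map (unit_vec n) i) = 0"
          using coeff_array_mset[OF T(2)] by (simp add: W_def t_def)
        from multilinear_form_zero[OF T(1) this, of "[]" 0] have "\<forall>vs\<in>vec_tuples n m. T vs = 0"
          by (simp add: vec_tuples_def)
        then show False using nz by (simp add: nonzero_form_def)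
      qed
      assume eq: "coeff_norm n m T = D"
      have "D > 0" using le nzW D0 by (auto simp: order.strict_iff_order)
      then obtain l where l: "l < n" "\<And>i. i \<in> W \<Longrightarrow> i \<noteq> replicate m l \<Longrightarrow> t (mset i) = 0"
        using le eq by blast
      have rW: "replicate m l \<in> W" using l(1) by (auto simp: W_def words_def set_replicate_conv_if)
      have "t (replicate_mset m l) \<noteq> 0"
      proof
        assume "t (replicate_mset m l) = 0"
        then have "t (mset i) = 0" if "i \<in> W" for i using l(2)[OF that] by (cases "i = replicate m l") auto
        then show False using nzW by blast
      qed
      moreover have "T (replicate m z) = t (replicate_mset m l) * vec_index z l ^ m" if "z \<in> carrier_vec n" for z
      proof -
        have "T (replicate m z) = (\<Sum>i\<in>W. t (mset i) * word_monom (vec_index z) i)"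
          using form_coeff_array[OF T that] by (simp add: form_def W_def t_def)
        also have "\<dots> = (\<Sum>i\<in>{replicate m l}. t (mset i) * word_monom (vec_index z) i)"
          using fW rW l(2) by (intro sum.mono_neutral_right) auto
        finally show ?thesis by (simp add: word_monom_replicate)
      qed
      ultimately show "\<exists>j<n. \<exists>c. c \<noteq> 0 \<and> (\<forall>z \<in> carrier_vec n. T (replicate m z) = c * vec_index z j ^ m)"
        using l(1) by blast
    next
      assume "\<exists>j<n. \<exists>c. c \<noteq> 0 \<and> (\<forall>z \<in> carrier_vec n. T (replicate m z) = c * vec_index z j ^ m)"
      then obtain j c where j: "j < n" and c: "\<And>z. z \<in> carrier_vec n \<Longrightarrow> T (replicate m z) = c * vec_index z j ^ m"
        by blast
      \<comment> \<open>For the converse, \<open>D\<close> is squeezed between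
        \<open>coeff_norm\<close> and \<open>cmod c\<close>, since \<open>c\<close> is itself one of
        the entries, the value of \<open>T\<close> at \<open>m\<close> copies of a basis
        vector.\<close>
      have "D \<le> cmod c"
        unfolding D_def
      proof (rule diag_sup_least)
        fix z :: cvec assume z: "z \<in> carrier_vec n" "linf_norm z \<le> 1"
        then have "cmod (vec_index z j) ^ m \<le> 1" using j linf_norm_le_1[OF z(1)] by (intro power_le_one) auto
        then show "cmod (T (replicate m z)) \<le> cmod c" using c[OF z(1)] by (simp add: norm_mult norm_power mult_left_le)
      qed
      also have "cmod c \<le> coeff_norm n m T"
      proof -
        have rW: "replicate m j \<in> W" using j by (auto simp: W_def words_def set_replicate_conv_if)
        have "t (mset (replicate m j)) = T (replicate m (unit_vec n j))"
          using coeff_array_mset[OF T(2), of "replicate m j"] rW by (simp add: t_def W_def)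
        also have "\<dots> = c" using c[of "unit_vec n j"] j by simp
        finally have "cmod c powr p \<le> \<Sigma>"
          using member_le_sum[OF rW, of "\<lambda>i. cmod (t (mset i)) powr p"] fW by (simp add: \<Sigma>_def)
        then have "(cmod c powr p) powr (1 / p) \<le> \<Sigma> powr (1 / p)" using p by (intro powr_mono2) auto
        then show ?thesis using p by (simp add: cn powr_powr)
      qed
      finally show "coeff_norm n m T = D" using le by simp
    qed
    then show "coeff_norm n m T \<le> diag_sup n m T \<and>
      (nonzero_form n m T \<longrightarrow>
        (coeff_norm n m T = diag_sup n m T \<longleftrightarrow>
          (\<exists>j<n. \<exists>c. c \<noteq> 0 \<and>
            (\<forall>z \<in> carrier_vec n. T (replicate m z) = c * vec_index z j ^ m))))"
      using le by (simp add: D_def)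
  qed
qed

end
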